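(* Let $X$ be a Gromov manifold. If $M\subset X$ is a Lagrangian submanifold which is also a minimal submanifold, then the restriction $u|_M$ of a Lagrangian plurisubharmonic function $u$ to $M$ is subharmonic.
   Context: A Gromov manifold is a triple $(X,\omega,J)$ where $(X,\omega)$ is a symplectic manifold of real dimension $2n$ and $J$ is an almost complex structure with $\omega(v,w)=\omega(Jv,Jw)$ and $\omega(Jv,v)>0$ for all non-zero tangent vectors. It carries the riemannian metric $\langle v,w\rangle=\omega(Jv,w)$, with Levi-Civita connection $\nabla$ and riemannian Hessian $(\mathrm{Hess}\,f)(v,w)=vwf-(\nabla_vw)f$. A Lagrangian submanifold is an $n$-dimensional submanifold $M$ with $\omega|_{TM}=0$; minimal means its mean curvature vector vanishes for this metric. An upper semi-continuous function $u:X\to[-\infty,\infty)$ is Lagrangian plurisubharmonic if for each $x\in X$ and each smooth $\varphi$ defined near $x$ with $u\le\varphi$ near $x$ and equality at $x$, one has $\mathrm{tr}(\mathrm{Hess}_x\varphi|_W)\ge0$ for every Lagrangian $n$-plane $W\subset T_xX$ (i.e. $\omega|_W=0$). Subharmonicity on $M$ is with respect to the Laplace-Beltrami operator of the induced metric (in the viscosity sense, so the value $-\infty$ and the function $\equiv-\infty$ are allowed). *)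

theory Defs
  imports "HOL-Analysis.Analysis" "HOL-Library.Function_Algebras"
begin

section \<open>Pointwise vector space structure on functions\<close>

instantiation "fun" :: (type, real_vector) real_vector
begin

definition scaleR_fun :: "real \<Rightarrow> ('a \<Rightarrow> 'b) \<Rightarrow> 'a \<Rightarrow> 'b"
  where "scaleR_fun r f = (\<lambda>x. r *\<^sub>R f x)"

instance
  by standard (simp_all add: scaleR_fun_def plus_fun_def fun_eq_iff algebra_simps)

end

definition bilinear_on :: "'v::real_vector set \<Rightarrow> ('v \<Rightarrow> 'v \<Rightarrow> real) \<Rightarrow> bool"
  where "bilinear_on V B \<longleftrightarrow>
    (\<forall>u\<in>V. \<forall>v\<in>V. \<forall>w\<in>V. \<forall>a b.
      B (a *\<^sub>R u + b *\<^sub>R v) w = a * B u w + b * B v w \<and>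
      B w (a *\<^sub>R u + b *\<^sub>R v) = a * B w u + b * B w v)"

definition orthonormal_basis :: "('v::real_vector \<Rightarrow> 'v \<Rightarrow> real) \<Rightarrow> 'v set \<Rightarrow> 'v set \<Rightarrow> bool"
  where "orthonormal_basis g W E \<longleftrightarrow>
    finite E \<and> E \<subseteq> W \<and> span E = W \<and>
    (\<forall>e\<in>E. \<forall>e'\<in>E. g e e' = (if e = e' then 1 else 0))"

text \<open>The trace over \<open>W\<close> of a (scalar- or vector-valued) bilinear map; it does not depend on
  the orthonormal basis.\<close>

definition trace_on ::
    "('v::real_vector \<Rightarrow> 'v \<Rightarrow> real) \<Rightarrow> 'v set \<Rightarrow> ('v \<Rightarrow> 'v \<Rightarrow> 'b::comm_monoid_add) \<Rightarrow> 'b"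
  where "trace_on g W B = (\<Sum>e\<in>(SOME E. orthonormal_basis g W E). B e e)"

text \<open>The component orthogonal to \<open>S\<close> of a vector \<open>v\<close> of \<open>V\<close>, where \<open>S\<close> is a subspace of \<open>V\<close>.\<close>

definition normal_part ::
    "('v::real_vector \<Rightarrow> 'v \<Rightarrow> real) \<Rightarrow> 'v set \<Rightarrow> 'v set \<Rightarrow> 'v \<Rightarrow> 'v"
  where "normal_part g V S v = (THE z. z \<in> V \<and> (\<forall>w\<in>S. g z w = 0) \<and> v - z \<in> S)"


section \<open>Smooth manifolds\<close>

text \<open>\<open>C_k k f S\<close>: \<open>f\<close> is \<open>k\<close> times continuously differentiable on the open set \<open>S\<close>.\<close>

primrec C_k :: "nat \<Rightarrow> ('e::real_normed_vector \<Rightarrow> 'b::real_normed_vector) \<Rightarrow> 'e set \<Rightarrow> bool"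
  where
    "C_k 0 f S \<longleftrightarrow> continuous_on S f"
  | "C_k (Suc k) f S \<longleftrightarrow>
      (\<forall>x\<in>S. f differentiable (at x)) \<and>
      (\<forall>e. C_k k (\<lambda>x. frechet_derivative f (at x) e) S)"

definition C_infinity :: "('e::real_normed_vector \<Rightarrow> 'b::real_normed_vector) \<Rightarrow> 'e set \<Rightarrow> bool"
  where "C_infinity f S \<longleftrightarrow> (\<forall>k. C_k k f S)"

text \<open>A chart is a pair \<open>(U, \<phi>)\<close>; outside \<open>U\<close> the values of \<open>\<phi>\<close> are irrelevant. The
  dimension of the manifold is \<open>DIM('e)\<close>.\<close>

record ('a, 'e) mfd =
  mtop :: "'a topology"
  atlas :: "('a set \<times> ('a \<Rightarrow> 'e)) set"

abbreviation pts :: "('a, 'e) mfd \<Rightarrow> 'a set"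
  where "pts X \<equiv> topspace (mtop X)"

abbreviation opens :: "('a, 'e) mfd \<Rightarrow> 'a set \<Rightarrow> bool"
  where "opens X N \<equiv> openin (mtop X) N"

definition smooth_manifold :: "('a, 'e::euclidean_space) mfd \<Rightarrow> bool"
  where "smooth_manifold X \<longleftrightarrow>
    Hausdorff_space (mtop X) \<and> second_countable (mtop X) \<and>
    (\<Union>(U, \<phi>)\<in>atlas X. U) = pts X \<and>
    (\<forall>(U, \<phi>)\<in>atlas X. opens X U \<and> open (\<phi> ` U) \<and>
        homeomorphic_map (subtopology (mtop X) U) (top_of_set (\<phi> ` U)) \<phi>) \<and>
    (\<forall>(U, \<phi>)\<in>atlas X. \<forall>(U', \<phi>')\<in>atlas X.
        C_infinity (\<phi>' \<circ> inv_into U \<phi>) (\<phi> ` (U \<inter> U')))"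

definition smooth_on :: "('a, 'e::euclidean_space) mfd \<Rightarrow> 'a set \<Rightarrow> ('a \<Rightarrow> real) \<Rightarrow> bool"
  where "smooth_on X N f \<longleftrightarrow>
    (\<forall>(U, \<phi>)\<in>atlas X. C_infinity (f \<circ> inv_into U \<phi>) (\<phi> ` (U \<inter> N)))"

definition smooth_near :: "('a, 'e::euclidean_space) mfd \<Rightarrow> 'a \<Rightarrow> ('a \<Rightarrow> real) \<Rightarrow> bool"
  where "smooth_near X x f \<longleftrightarrow> (\<exists>N. opens X N \<and> x \<in> N \<and> smooth_on X N f)"


section \<open>Tangent vectors and vector fields\<close>

text \<open>A tangent vector at \<open>x\<close> is a directional derivative acting on the functions that are
  defined and smooth near \<open>x\<close>. As functions are total here, a tangent vector takes the value
  \<open>0\<close> on every function which is not smooth near \<open>x\<close>; this makes equality of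
  operators agree with equality of tangent vectors.\<close>

type_synonym 'a tvec = "('a \<Rightarrow> real) \<Rightarrow> real"

definition chart_vec ::
    "('a, 'e::euclidean_space) mfd \<Rightarrow> 'a set \<times> ('a \<Rightarrow> 'e) \<Rightarrow> 'a \<Rightarrow> 'e \<Rightarrow> 'a tvec"
  where "chart_vec X c x e = (\<lambda>f. if smooth_near X x f
    then frechet_derivative (f \<circ> inv_into (fst c) (snd c)) (at (snd c x)) e else 0)"

definition tangent_space :: "('a, 'e::euclidean_space) mfd \<Rightarrow> 'a \<Rightarrow> 'a tvec set"
  where "tangent_space X x = {chart_vec X c x e | c e. c \<in> atlas X \<and> x \<in> fst c}"

definition smooth_vf :: "('a, 'e::euclidean_space) mfd \<Rightarrow> 'a set \<Rightarrow> ('a \<Rightarrow> 'a tvec) \<Rightarrow> bool"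
  where "smooth_vf X N V \<longleftrightarrow>
    (\<forall>y\<in>N. V y \<in> tangent_space X y) \<and>
    (\<forall>N' f. opens X N' \<and> N' \<subseteq> N \<and> smooth_on X N' f \<longrightarrow> smooth_on X N' (\<lambda>y. V y f))"

definition smooth_vf_near :: "('a, 'e::euclidean_space) mfd \<Rightarrow> 'a \<Rightarrow> ('a \<Rightarrow> 'a tvec) \<Rightarrow> bool"
  where "smooth_vf_near X x V \<longleftrightarrow> (\<exists>N. opens X N \<and> x \<in> N \<and> smooth_vf X N V)"

definition lie_bracket ::
    "('a, 'e::euclidean_space) mfd \<Rightarrow> ('a \<Rightarrow> 'a tvec) \<Rightarrow> ('a \<Rightarrow> 'a tvec) \<Rightarrow> 'a \<Rightarrow> 'a tvec"
  where "lie_bracket X V W x = (\<lambda>f. if smooth_near X x f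
    then V x (\<lambda>y. W y f) - W x (\<lambda>y. V y f) else 0)"

type_synonym 'a form2 = "'a \<Rightarrow> 'a tvec \<Rightarrow> 'a tvec \<Rightarrow> real"

definition smooth_tensor2 :: "('a, 'e::euclidean_space) mfd \<Rightarrow> 'a form2 \<Rightarrow> bool"
  where "smooth_tensor2 X b \<longleftrightarrow>
    (\<forall>x\<in>pts X. bilinear_on (tangent_space X x) (b x)) \<and>
    (\<forall>N V W. opens X N \<and> smooth_vf X N V \<and> smooth_vf X N W \<longrightarrow>
      smooth_on X N (\<lambda>y. b y (V y) (W y)))"


section \<open>Levi-Civita connection, Hessian, Laplace-Beltrami operator\<close>

text \<open>\<open>D x v W\<close> is the covariant derivative at \<open>x\<close> of the vector field \<open>W\<close> in the direction
  \<open>v \<in> T\<^sub>xX\<close>. It is specified for all fields that are smooth near \<open>x\<close>. That \<open>D x v W\<close> depends only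
  on the germ of \<open>W\<close> at \<open>x\<close> follows from the Leibniz rule: the
  multiplier \<open>f\<close> there is only required to be smooth near \<open>x\<close>.\<close>

type_synonym 'a conn = "'a \<Rightarrow> 'a tvec \<Rightarrow> ('a \<Rightarrow> 'a tvec) \<Rightarrow> 'a tvec"

definition affine_connection :: "('a, 'e::euclidean_space) mfd \<Rightarrow> 'a conn \<Rightarrow> bool"
  where "affine_connection X D \<longleftrightarrow>
    (\<forall>x\<in>pts X. \<forall>v\<in>tangent_space X x. \<forall>W. smooth_vf_near X x W \<longrightarrow>
      D x v W \<in> tangent_space X x) \<and>
    (\<forall>x\<in>pts X. \<forall>u\<in>tangent_space X x. \<forall>v\<in>tangent_space X x. \<forall>a b W. smooth_vf_near X x W \<longrightarrow>
      D x (a *\<^sub>R u + b *\<^sub>R v) W = a *\<^sub>R D x u W + b *\<^sub>R D x v W) \<and>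
    (\<forall>x\<in>pts X. \<forall>v\<in>tangent_space X x. \<forall>V W. smooth_vf_near X x V \<and> smooth_vf_near X x W \<longrightarrow>
      D x v (\<lambda>y. V y + W y) = D x v V + D x v W) \<and>
    (\<forall>x\<in>pts X. \<forall>v\<in>tangent_space X x. \<forall>f W. smooth_near X x f \<and> smooth_vf_near X x W \<longrightarrow>
      D x v (\<lambda>y. f y *\<^sub>R W y) = v f *\<^sub>R W x + f x *\<^sub>R D x v W) \<and>
    (\<forall>N V W. opens X N \<and> smooth_vf X N V \<and> smooth_vf X N W \<longrightarrow>
      smooth_vf X N (\<lambda>y. D y (V y) W))"

definition levi_civita :: "('a, 'e::euclidean_space) mfd \<Rightarrow> 'a form2 \<Rightarrow> 'a conn \<Rightarrow> bool"
  where "levi_civita X g D \<longleftrightarrow>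
    affine_connection X D \<and>
    (\<forall>x\<in>pts X. \<forall>V W. smooth_vf_near X x V \<and> smooth_vf_near X x W \<longrightarrow>
      D x (V x) W - D x (W x) V = lie_bracket X V W x) \<and>
    (\<forall>x\<in>pts X. \<forall>v\<in>tangent_space X x. \<forall>V W. smooth_vf_near X x V \<and> smooth_vf_near X x W \<longrightarrow>
      v (\<lambda>y. g y (V y) (W y)) = g x (D x v V) (W x) + g x (V x) (D x v W))"

text \<open>\<open>v w f - (\<nabla>\<^sub>v w) f\<close>, where \<open>w\<close> is extended to a vector field near \<open>x\<close>; the result
  does not depend on the extension.\<close>

definition hessian ::
    "('a, 'e::euclidean_space) mfd \<Rightarrow> 'a conn \<Rightarrow> ('a \<Rightarrow> real) \<Rightarrow> 'a \<Rightarrow> 'a tvec \<Rightarrow> 'a tvec \<Rightarrow> real"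
  where "hessian X D f x v w =
    (let W = (SOME W. smooth_vf_near X x W \<and> W x = w)
     in v (\<lambda>y. W y f) - D x v W f)"

definition laplace_beltrami ::
    "('a, 'e::euclidean_space) mfd \<Rightarrow> 'a form2 \<Rightarrow> 'a conn \<Rightarrow> ('a \<Rightarrow> real) \<Rightarrow> 'a \<Rightarrow> real"
  where "laplace_beltrami X g D f x = trace_on (g x) (tangent_space X x) (hessian X D f x)"


section \<open>Gromov manifolds\<close>

definition closed_form2 :: "('a, 'e::euclidean_space) mfd \<Rightarrow> 'a form2 \<Rightarrow> bool"
  where "closed_form2 X \<omega> \<longleftrightarrow>
    (\<forall>x\<in>pts X. \<forall>U V W. smooth_vf_near X x U \<and> smooth_vf_near X x V \<and> smooth_vf_near X x W \<longrightarrow>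
      U x (\<lambda>y. \<omega> y (V y) (W y)) + V x (\<lambda>y. \<omega> y (W y) (U y)) + W x (\<lambda>y. \<omega> y (U y) (V y))
      - \<omega> x (lie_bracket X U V x) (W x) - \<omega> x (lie_bracket X V W x) (U x)
      - \<omega> x (lie_bracket X W U x) (V x) = 0)"

definition symplectic_form :: "('a, 'e::euclidean_space) mfd \<Rightarrow> 'a form2 \<Rightarrow> bool"
  where "symplectic_form X \<omega> \<longleftrightarrow>
    smooth_tensor2 X \<omega> \<and>
    (\<forall>x\<in>pts X. \<forall>v\<in>tangent_space X x. \<omega> x v v = 0) \<and>
    (\<forall>x\<in>pts X. \<forall>v\<in>tangent_space X x. (\<forall>w\<in>tangent_space X x. \<omega> x v w = 0) \<longrightarrow> v = 0) \<and>
    closed_form2 X \<omega>"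

definition almost_complex_structure ::
    "('a, 'e::euclidean_space) mfd \<Rightarrow> ('a \<Rightarrow> 'a tvec \<Rightarrow> 'a tvec) \<Rightarrow> bool"
  where "almost_complex_structure X J \<longleftrightarrow>
    (\<forall>x\<in>pts X. \<forall>v\<in>tangent_space X x. J x v \<in> tangent_space X x \<and> J x (J x v) = - v) \<and>
    (\<forall>x\<in>pts X. \<forall>u\<in>tangent_space X x. \<forall>v\<in>tangent_space X x. \<forall>a b.
      J x (a *\<^sub>R u + b *\<^sub>R v) = a *\<^sub>R J x u + b *\<^sub>R J x v) \<and>
    (\<forall>N V. opens X N \<and> smooth_vf X N V \<longrightarrow> smooth_vf X N (\<lambda>y. J y (V y)))"

definition gromov_manifold ::
    "('a, 'e::euclidean_space) mfd \<Rightarrow> 'a form2 \<Rightarrow> ('a \<Rightarrow> 'a tvec \<Rightarrow> 'a tvec) \<Rightarrow> bool"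
  where "gromov_manifold X \<omega> J \<longleftrightarrow>
    smooth_manifold X \<and> symplectic_form X \<omega> \<and> almost_complex_structure X J \<and>
    (\<forall>x\<in>pts X. \<forall>v\<in>tangent_space X x. \<forall>w\<in>tangent_space X x. \<omega> x v w = \<omega> x (J x v) (J x w)) \<and>
    (\<forall>x\<in>pts X. \<forall>v\<in>tangent_space X x. v \<noteq> 0 \<longrightarrow> \<omega> x (J x v) v > 0)"

definition gromov_metric :: "'a form2 \<Rightarrow> ('a \<Rightarrow> 'a tvec \<Rightarrow> 'a tvec) \<Rightarrow> 'a form2"
  where "gromov_metric \<omega> J = (\<lambda>x v w. \<omega> x (J x v) w)"


section \<open>Submanifolds\<close>

text \<open>The differential of the inclusion of a submanifold into \<open>X\<close>: a tangent vector of the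
  submanifold, applied to the restrictions of functions that are smooth near \<open>x\<close> in \<open>X\<close>.\<close>

definition push :: "('a, 'e::euclidean_space) mfd \<Rightarrow> 'a \<Rightarrow> 'a tvec \<Rightarrow> 'a tvec"
  where "push X x v = (\<lambda>f. if smooth_near X x f then v f else 0)"

definition submanifold ::
    "('a, 'e::euclidean_space) mfd \<Rightarrow> ('a, 'f::euclidean_space) mfd \<Rightarrow> bool"
  where "submanifold X M \<longleftrightarrow>
    smooth_manifold M \<and> pts M \<subseteq> pts X \<and> mtop M = subtopology (mtop X) (pts M) \<and>
    (\<forall>(U, \<phi>)\<in>atlas M. \<forall>(U', \<phi>')\<in>atlas X.
        C_infinity (\<phi>' \<circ> inv_into U \<phi>) (\<phi> ` (U \<inter> U'))) \<and>
    (\<forall>x\<in>pts M. inj_on (push X x) (tangent_space M x))"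

definition tangent_in ::
    "('a, 'e::euclidean_space) mfd \<Rightarrow> ('a, 'f::euclidean_space) mfd \<Rightarrow> 'a \<Rightarrow> 'a tvec set"
  where "tangent_in X M x = push X x ` tangent_space M x"

definition induced_metric :: "('a, 'e::euclidean_space) mfd \<Rightarrow> 'a form2 \<Rightarrow> 'a form2"
  where "induced_metric X g = (\<lambda>x v w. g x (push X x v) (push X x w))"

definition lagrangian_submanifold ::
    "('a, 'e::euclidean_space) mfd \<Rightarrow> 'a form2 \<Rightarrow> ('a, 'f::euclidean_space) mfd \<Rightarrow> bool"
  where "lagrangian_submanifold X \<omega> M \<longleftrightarrow>
    submanifold X M \<and> 2 * DIM('f) = DIM('e) \<and>
    (\<forall>x\<in>pts M. \<forall>v\<in>tangent_in X M x. \<forall>w\<in>tangent_in X M x. \<omega> x v w = 0)"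

text \<open>The normal component of \<open>\<nabla>\<^sub>v W\<close>, where \<open>W\<close> is an extension of \<open>w\<close> to a vector field of \<open>X\<close>
  near \<open>x\<close> that is tangent to \<open>M\<close> along \<open>M\<close>; the result does not depend on the extension.\<close>

definition second_fundamental_form ::
    "('a, 'e::euclidean_space) mfd \<Rightarrow> 'a form2 \<Rightarrow> 'a conn \<Rightarrow> ('a, 'f::euclidean_space) mfd \<Rightarrow>
      'a \<Rightarrow> 'a tvec \<Rightarrow> 'a tvec \<Rightarrow> 'a tvec"
  where "second_fundamental_form X g D M x v w =
    (let W = (SOME W. W x = w \<and>
        (\<exists>N. opens X N \<and> x \<in> N \<and> smooth_vf X N W \<and> (\<forall>y\<in>N \<inter> pts M. W y \<in> tangent_in X M y)))
     in normal_part (g x) (tangent_space X x) (tangent_in X M x) (D x v W))"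

definition mean_curvature ::
    "('a, 'e::euclidean_space) mfd \<Rightarrow> 'a form2 \<Rightarrow> 'a conn \<Rightarrow> ('a, 'f::euclidean_space) mfd \<Rightarrow>
      'a \<Rightarrow> 'a tvec"
  where "mean_curvature X g D M x =
    trace_on (g x) (tangent_in X M x) (second_fundamental_form X g D M x)"

definition minimal_submanifold ::
    "('a, 'e::euclidean_space) mfd \<Rightarrow> 'a form2 \<Rightarrow> 'a conn \<Rightarrow> ('a, 'f::euclidean_space) mfd \<Rightarrow> bool"
  where "minimal_submanifold X g D M \<longleftrightarrow>
    submanifold X M \<and> (\<forall>x\<in>pts M. mean_curvature X g D M x = 0)"


section \<open>Lagrangian plurisubharmonic and subharmonic functions\<close>

definition usc :: "('a, 'e) mfd \<Rightarrow> ('a \<Rightarrow> ereal) \<Rightarrow> bool"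
  where "usc X u \<longleftrightarrow>
    (\<forall>x\<in>pts X. u x < \<infinity>) \<and> (\<forall>a. opens X {x \<in> pts X. u x < a})"

definition test_function ::
    "('a, 'e::euclidean_space) mfd \<Rightarrow> ('a \<Rightarrow> ereal) \<Rightarrow> 'a \<Rightarrow> ('a \<Rightarrow> real) \<Rightarrow> bool"
  where "test_function X u x \<phi> \<longleftrightarrow>
    (\<exists>N. opens X N \<and> x \<in> N \<and> smooth_on X N \<phi> \<and> (\<forall>y\<in>N. u y \<le> ereal (\<phi> y))) \<and>
    u x = ereal (\<phi> x)"

definition lagrangian_plane ::
    "('a, 'e::euclidean_space) mfd \<Rightarrow> 'a form2 \<Rightarrow> 'a \<Rightarrow> 'a tvec set \<Rightarrow> bool"
  where "lagrangian_plane X \<omega> x W \<longleftrightarrow>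
    subspace W \<and> W \<subseteq> tangent_space X x \<and> 2 * dim W = DIM('e) \<and>
    (\<forall>v\<in>W. \<forall>w\<in>W. \<omega> x v w = 0)"

definition lagrangian_psh ::
    "('a, 'e::euclidean_space) mfd \<Rightarrow> 'a form2 \<Rightarrow> ('a \<Rightarrow> 'a tvec \<Rightarrow> 'a tvec) \<Rightarrow> 'a conn \<Rightarrow>
      ('a \<Rightarrow> ereal) \<Rightarrow> bool"
  where "lagrangian_psh X \<omega> J D u \<longleftrightarrow>
    usc X u \<and>
    (\<forall>x\<in>pts X. \<forall>\<phi>. test_function X u x \<phi> \<longrightarrow>
      (\<forall>W. lagrangian_plane X \<omega> x W \<longrightarrow>
        trace_on (gromov_metric \<omega> J x) W (hessian X D \<phi> x) \<ge> 0))"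

definition subharmonic ::
    "('a, 'e::euclidean_space) mfd \<Rightarrow> 'a form2 \<Rightarrow> 'a conn \<Rightarrow> ('a \<Rightarrow> ereal) \<Rightarrow> bool"
  where "subharmonic X g D u \<longleftrightarrow>
    usc X u \<and>
    (\<forall>x\<in>pts X. \<forall>\<phi>. test_function X u x \<phi> \<longrightarrow> laplace_beltrami X g D \<phi> x \<ge> 0)"

end

theory Submission
  imports Defs
begin

text \<open>
  A test function \<open>\<phi>\<close> for \<open>u|\<^sub>M\<close> at \<open>x\<close> is not the restriction of a test function for \<open>u\<close> on \<open>X\<close>, so one
  penalizes the distance to \<open>M\<close>. In a chart of \<open>X\<close> in which \<open>M\<close> is the zero set of a linear map
  \<open>\<tau>\<close>, extend \<open>\<phi>\<close> constantly in the normal directions, make it strict by adding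
  \<open>\<delta> |\<cdot>|\<^sup>2\<close>, and let \<open>y\<^sub>m\<close> maximize \<open>u - \<phi> - m |\<tau>|\<^sup>2\<close> near \<open>x\<close>. Then \<open>y\<^sub>m\<close> subconverges to \<open>x\<close> and
  \<open>m |\<tau> y\<^sub>m|\<^sup>2\<close> to \<open>0\<close>, and \<open>\<phi> + m |\<tau>|\<^sup>2\<close> is, up to a constant, a test function for \<open>u\<close> at \<open>y\<^sub>m\<close>.
  Hermitian Gram-Schmidt extends the tangent planes of \<open>M\<close> to a smooth field \<open>W\<close> of Lagrangian planes
  near \<open>x\<close>. As \<open>d\<tau>|\<^sub>W\<close> vanishes along \<open>M\<close>, and the trace of \<open>Hess \<tau>\<close> over \<open>W\<close> vanishes there because
  \<open>M\<close> is minimal, the penalty contributes only \<open>O(m |\<tau>|\<^sup>2)\<close> to the trace of the Hessian. In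
  the limit the trace of \<open>Hess \<phi>\<close> over \<open>T\<^sub>xM\<close>, which is the Laplacian of \<open>\<phi>\<close> on \<open>M\<close> again by
  minimality, is at least \<open>- O(\<delta>)\<close>.
\<close>

section \<open>Calculus of smooth functions\<close>

text \<open>The obstacle is the size of the error terms. Only
  \<open>m * (\<tau> p \<bullet> \<tau> p)\<close> is known to tend to zero at the maximizers;
  nothing bounds \<open>m * norm (\<tau> p)\<close>. So no error of first order in
  \<open>\<tau>\<close> can be tolerated, and this dictates how the penalty is estimated: the
  connection term must be summed over the frame before it is bounded, because minimality controls
  the trace and not the single summands. The maximizers need not lie on \<open>M\<close>, and at
  such points the hypothesis on \<open>u\<close> speaks of Lagrangian planes only. Hence tangent
  planes of \<open>M\<close> cannot be extended arbitrarily, and the almost complex structure has to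
  take part in the construction of the frame. Tangent vectors are operators on functions and a
  connection is any operator with the right rules, so fields, connection and Hessian are first
  turned into maps on open subsets of a Euclidean space. The connections \<open>D\<close> and
  \<open>D\<^sub>M\<close> are given independently of each other; Koszul's formula is what ties them
  together.\<close>

abbreviation fderiv :: "('a::real_normed_vector \<Rightarrow> 'b::real_normed_vector) \<Rightarrow> 'a \<Rightarrow> 'a \<Rightarrow> 'b"
  where "fderiv f x \<equiv> frechet_derivative f (at x)"

abbreviation hess :: "('a::real_normed_vector \<Rightarrow> 'b::real_normed_vector) \<Rightarrow> 'a \<Rightarrow> 'a \<Rightarrow> 'a \<Rightarrow> 'b"
  where "hess f x a b \<equiv> fderiv (\<lambda>p. fderiv f p b) x a"

section \<open>Closure properties of maps that are \<open>k\<close> times continuously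
  differentiable\<close>

lemma C_k_cong:
  assumes "open S" "\<And>x. x \<in> S \<Longrightarrow> f x = g x"
  shows "C_k k f S = C_k k g S"
  using assms(2)
proof (induction k arbitrary: f g)
  case 0
  then show ?case by (simp cong: continuous_on_cong)
next
  case (Suc k)
  have imp: "f' differentiable (at x) \<Longrightarrow> g' differentiable (at x)"
    if "x \<in> S" "\<And>x. x \<in> S \<Longrightarrow> f' x = g' x" for x and f' g' :: "'a \<Rightarrow> 'b"
    using that assms(1) by (meson differentiable_def has_derivative_transform_within_open)
  have diff: "f differentiable (at x) \<longleftrightarrow> g differentiable (at x)" if "x \<in> S" for x
    using imp[OF that, of f g] imp[OF that, of g f] Suc.prems by auto
  show ?case
  \<comment> \<open>If differentiability fails somewhere, it fails for both functions and both sides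
    are false. Otherwise the derivatives agree on \<open>S\<close> and the induction hypothesis
    applies to them.\<close>
  proof (cases "\<forall>x\<in>S. f differentiable (at x)")
    case True
    have "fderiv f x = fderiv g x" if "x \<in> S" for x
      using frechet_derivative_transform_within_open[OF _ assms(1) that, of f g] True Suc.prems that
      by blast
    then have "C_k k (\<lambda>x. fderiv f x e) S =
        C_k k (\<lambda>x. fderiv g x e) S" for e
      by (intro Suc.IH) simp
    with diff show ?thesis by simp
  next
    case False
    with diff show ?thesis by auto
  qed
qed

lemma C_k_subset: "C_k k f S \<Longrightarrow> T \<subseteq> S \<Longrightarrow> C_k k f T"
proof (induction k arbitrary: f)
  case 0
  then show ?case by (auto intro: continuous_on_subset)
next
  case (Suc k)
  then show ?case by auto
qed

lemma C_k_local:
  assumes "\<And>x. x \<in> S \<Longrightarrow> \<exists>T. open T \<and> x \<in> T \<and> C_k k f T"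
  shows "C_k k f S"
  using assms
proof (induction k arbitrary: f)
  case 0
  then show ?case
    by (metis C_k.simps(1) continuous_at_imp_continuous_on continuous_on_eq_continuous_at)
next
  case (Suc k)
  have "f differentiable (at x)" if "x \<in> S" for x
    using Suc.prems[OF that] by auto
  moreover have "C_k k (\<lambda>x. fderiv f x e) S" for e
    using Suc.prems by (intro Suc.IH) force
  ultimately show ?case by simp
qed

lemma C_k_SucD: "C_k (Suc k) f S \<Longrightarrow> C_k k f S"
proof (induction k arbitrary: f)
  case 0
  then show ?case
    by (simp add: continuous_at_imp_continuous_on differentiable_imp_continuous_within)
next
  case (Suc k)
  then show ?case by (metis C_k.simps(2))
qed

lemma C_k_const: "C_k k (\<lambda>x. c) S"
  by (induction k arbitrary: c) simp_all

text \<open>\<open>C_k\<close> is phrased with the total operator \<open>fderiv\<close>; uniqueness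
  of derivatives lets any explicitly known derivative \<open>f'\<close> take its place. The product,
  chain and reciprocal rules below take their inductive step through this rule.\<close>

lemma C_k_SucI:
  assumes "open S" "\<And>x. x \<in> S \<Longrightarrow> (f has_derivative f' x) (at x)" "\<And>e. C_k k (\<lambda>x. f' x e) S"
  shows "C_k (Suc k) f S"
proof -
  have "C_k k (\<lambda>x. fderiv f x e) S" for e
    using assms(3)[of e] C_k_cong[OF assms(1), of "\<lambda>x. fderiv f x e"]
      frechet_derivative_at[OF assms(2)] by metis
  with assms(2) show ?thesis by (auto simp: differentiable_def)
qed

lemma C_k_SucD':
  assumes "C_k (Suc k) f S"
  shows "x \<in> S \<Longrightarrow> (f has_derivative fderiv f x) (at x)"
    and "C_k k (\<lambda>x. fderiv f x e) S"
  using assms by (auto simp: frechet_derivative_works)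

lemma C_k_add:
  assumes "open S" "C_k k f S" "C_k k g S"
  shows "C_k k (\<lambda>x. f x + g x) S"
  using assms(2,3)
proof (induction k arbitrary: f g)
  case 0
  then show ?case by (simp add: continuous_on_add)
next
  case (Suc k)
  show ?case
    by (rule C_k_SucI[OF assms(1) has_derivative_add[OF C_k_SucD'(1)[OF Suc.prems(1)]
          C_k_SucD'(1)[OF Suc.prems(2)]] Suc.IH[OF C_k_SucD'(2)[OF Suc.prems(1)]
          C_k_SucD'(2)[OF Suc.prems(2)]]])
qed

lemma C_k_sum:
  assumes "open S" "\<And>i. i \<in> I \<Longrightarrow> C_k k (f i) S"
  shows "C_k k (\<lambda>x. \<Sum>i\<in>I. f i x) S"
  using assms(2)
  by (induction I rule: infinite_finite_induct) (auto intro: C_k_add[OF assms(1)] C_k_const)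

lemma C_k_bounded_linear:
  assumes "open S" "bounded_linear h" "C_k k f S"
  shows "C_k k (\<lambda>x. h (f x)) S"
  using assms(3)
proof (induction k arbitrary: f)
  case 0
  then show ?case
    using bounded_linear.continuous_on[OF assms(2)] by simp
next
  case (Suc k)
  show ?case
    by (rule C_k_SucI[OF assms(1) bounded_linear.has_derivative[OF assms(2)
          C_k_SucD'(1)[OF Suc.prems]] Suc.IH[OF C_k_SucD'(2)[OF Suc.prems]]])
qed

lemma C_k_linear_arg:
  assumes "open S" "bounded_linear h"
  shows "C_k k h S"
proof (cases k)
  case 0
  then show ?thesis by (simp add: linear_continuous_on[OF assms(2)])
next
  case (Suc j)
  show ?thesis
    unfolding Suc
    by (rule C_k_SucI[OF assms(1) bounded_linear_imp_has_derivative[OF assms(2)] C_k_const])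
qed

lemma C_k_bilinear:
  assumes "open S" "bounded_bilinear h" "C_k k f S" "C_k k g S"
  shows "C_k k (\<lambda>x. h (f x) (g x)) S"
  using assms(3,4)
proof (induction k arbitrary: f g)
  case 0
  then show ?case using bounded_bilinear.continuous_on[OF assms(2)] by simp
next
  case (Suc k)
  show ?case
    by (rule C_k_SucI[OF assms(1) bounded_bilinear.FDERIV[OF assms(2)
          C_k_SucD'(1)[OF Suc.prems(1)] C_k_SucD'(1)[OF Suc.prems(2)]]
          C_k_add[OF assms(1) Suc.IH[OF C_k_SucD[OF Suc.prems(1)] C_k_SucD'(2)[OF Suc.prems(2)]]
          Suc.IH[OF C_k_SucD'(2)[OF Suc.prems(1)] C_k_SucD[OF Suc.prems(2)]]]])
qed

lemma linear_eq_sum_Basis: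
  fixes h :: "'a::euclidean_space \<Rightarrow> 'b::real_vector"
  assumes "linear h"
  shows "h x = (\<Sum>b\<in>Basis. (x \<bullet> b) *\<^sub>R h b)"
proof -
  have "h x = h (\<Sum>b\<in>Basis. (x \<bullet> b) *\<^sub>R b)" by (simp add: euclidean_representation)
  also have "\<dots> = (\<Sum>b\<in>Basis. (x \<bullet> b) *\<^sub>R h b)"
    by (simp add: linear_sum[OF assms] linear_cmul[OF assms])
  finally show ?thesis .
qed

text \<open>A field of linear maps is controlled only through its values on fixed vectors. Expanding
  \<open>w x\<close> in \<open>Basis\<close> turns the application into a finite sum of
  products.\<close>

lemma C_k_apply:
  fixes w :: "'a::real_normed_vector \<Rightarrow> 'b::euclidean_space" and h :: "'a \<Rightarrow> 'b \<Rightarrow> 'c::real_normed_vector"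
  assumes "open S" "\<And>x. x \<in> S \<Longrightarrow> linear (h x)" "\<And>e. C_k k (\<lambda>x. h x e) S" "C_k k w S"
  shows "C_k k (\<lambda>x. h x (w x)) S"
proof -
  have "C_k k (\<lambda>x. \<Sum>b\<in>Basis. (w x \<bullet> b) *\<^sub>R h x b) S"
    by (intro C_k_sum assms(1,3) C_k_bilinear[OF assms(1) bounded_bilinear_scaleR]
        C_k_bounded_linear[OF assms(1) bounded_linear_inner_left assms(4)])
  moreover have "h x (w x) = (\<Sum>b\<in>Basis. (w x \<bullet> b) *\<^sub>R h x b)" if "x \<in> S" for x
    by (rule linear_eq_sum_Basis[OF assms(2)[OF that]])
  ultimately show ?thesis
    using C_k_cong[OF assms(1), of "\<lambda>x. h x (w x)" "\<lambda>x. \<Sum>b\<in>Basis. (w x \<bullet> b) *\<^sub>R h x b"] by simp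
qed

text \<open>The induction closes because \<open>f\<close> is generalized: for fixed
  \<open>e\<close>, \<open>fderiv f (g x) e\<close> is again a composition with \<open>g\<close>,
  one order lower, and \<open>C_k_apply\<close> then inserts the varying vector
  \<open>fderiv g x e\<close>.\<close>

lemma C_k_compose:
  fixes g :: "'a::real_normed_vector \<Rightarrow> 'b::euclidean_space"
    and f :: "'b \<Rightarrow> 'c::real_normed_vector"
  assumes "open S" "open T" "g ` S \<subseteq> T" "C_k k f T" "C_k k g S"
  shows "C_k k (\<lambda>x. f (g x)) S"
  using assms(4,5)
proof (induction k arbitrary: f)
  case 0
  then show ?case using continuous_on_compose2[OF _ _ assms(3)] by simp
next
  case (Suc k)
  have T: "g x \<in> T" if "x \<in> S" for x using that assms(3) by auto
  have d: "((\<lambda>x. f (g x)) has_derivative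
      (\<lambda>e. fderiv f (g x) (fderiv g x e))) (at x)" if "x \<in> S" for x
    using has_derivative_compose[OF C_k_SucD'(1)[OF Suc.prems(2) that] C_k_SucD'(1)[OF Suc.prems(1) T[OF that]]]
    by simp
  have c: "C_k k (\<lambda>x. fderiv f (g x) (fderiv g x e)) S" for e
  proof (rule C_k_apply[OF assms(1) _ Suc.IH[OF C_k_SucD'(2)[OF Suc.prems(1)] C_k_SucD[OF Suc.prems(2)]]
        C_k_SucD'(2)[OF Suc.prems(2)]])
    show "linear (fderiv f (g x))" if "x \<in> S" for x
      using C_k_SucD'(1)[OF Suc.prems(1) T[OF that]] by (rule has_derivative_linear)
  qed
  show ?case by (rule C_k_SucI[OF assms(1) d c])
qed

lemma C_k_inverse:
  fixes f :: "'a::real_normed_vector \<Rightarrow> real"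
  assumes "open S" "\<And>x. x \<in> S \<Longrightarrow> f x \<noteq> 0" "C_k k f S"
  shows "C_k k (\<lambda>x. inverse (f x)) S"
  using assms(3)
proof (induction k)
  case 0
  then show ?case using assms(2) by (simp add: continuous_on_inverse)
next
  case (Suc k)
  have I: "C_k k (\<lambda>x. inverse (f x)) S" by (rule Suc.IH[OF C_k_SucD[OF Suc.prems]])
  have d: "((\<lambda>x. inverse (f x)) has_derivative
      (\<lambda>e. - (inverse (f x) * fderiv f x e * inverse (f x)))) (at x)"
    if "x \<in> S" for x
    by (rule Deriv.has_derivative_inverse[OF assms(2)[OF that] C_k_SucD'(1)[OF Suc.prems that]])
  have c: "C_k k (\<lambda>x. - (inverse (f x) * fderiv f x e * inverse (f x))) S" for e
    by (rule C_k_bounded_linear[OF assms(1) bounded_linear_minus[OF bounded_linear_ident]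
          C_k_bilinear[OF assms(1) bounded_bilinear_mult
            C_k_bilinear[OF assms(1) bounded_bilinear_mult I C_k_SucD'(2)[OF Suc.prems]] I]])
  show ?case by (rule C_k_SucI[OF assms(1) d c])
qed

section \<open>The same rules for smooth maps\<close>

lemma C_infinity_D: "C_infinity f S \<Longrightarrow> C_k k f S"
  by (simp add: C_infinity_def)

lemma C_infinity_I: "(\<And>k. C_k k f S) \<Longrightarrow> C_infinity f S"
  by (simp add: C_infinity_def)

lemma C_infinity_cong:
  assumes "open S" "\<And>x. x \<in> S \<Longrightarrow> f x = g x"
  shows "C_infinity f S = C_infinity g S"
proof -
  have "C_k k f S = C_k k g S" for k by (rule C_k_cong[OF assms])
  then show ?thesis by (simp only: C_infinity_def)
qed

lemma C_infinity_subset: "C_infinity f S \<Longrightarrow> T \<subseteq> S \<Longrightarrow> C_infinity f T"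
  by (rule C_infinity_I, rule C_k_subset, rule C_infinity_D)

lemma C_infinity_local:
  assumes "\<And>x. x \<in> S \<Longrightarrow> \<exists>T. open T \<and> x \<in> T \<and> C_infinity f T"
  shows "C_infinity f S"
proof (rule C_infinity_I, rule C_k_local)
  fix k x assume "x \<in> S"
  from assms[OF this] obtain T where "open T" "x \<in> T" "C_infinity f T" by blast
  then show "\<exists>T. open T \<and> x \<in> T \<and> C_k k f T" by (blast dest: C_infinity_D)
qed

lemma C_infinity_const [simp]: "C_infinity (\<lambda>x. c) S"
  by (simp add: C_infinity_def C_k_const)

lemma C_infinity_add:
  "open S \<Longrightarrow> C_infinity f S \<Longrightarrow> C_infinity g S \<Longrightarrow> C_infinity (\<lambda>x. f x + g x) S"
  by (rule C_infinity_I, rule C_k_add; (erule C_infinity_D)?)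

lemma C_infinity_sum:
  assumes "open S" "\<And>i. i \<in> I \<Longrightarrow> C_infinity (f i) S"
  shows "C_infinity (\<lambda>x. \<Sum>i\<in>I. f i x) S"
  by (rule C_infinity_I, rule C_k_sum[OF assms(1) C_infinity_D[OF assms(2)]])

lemma C_infinity_bounded_linear:
  "open S \<Longrightarrow> bounded_linear h \<Longrightarrow> C_infinity f S \<Longrightarrow> C_infinity (\<lambda>x. h (f x)) S"
  by (rule C_infinity_I, rule C_k_bounded_linear; (erule C_infinity_D)?)

lemma C_infinity_linear:
  fixes h :: "'a::euclidean_space \<Rightarrow> 'b::real_normed_vector"
  shows "open S \<Longrightarrow> linear h \<Longrightarrow> C_infinity h S"
  unfolding C_infinity_def using C_k_linear_arg[of S h] by (simp add: linear_conv_bounded_linear)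

lemma C_infinity_ident: "open S \<Longrightarrow> C_infinity (\<lambda>x. x) S"
  unfolding C_infinity_def using C_k_linear_arg[OF _ bounded_linear_ident] by blast

lemma C_infinity_uminus:
  "open S \<Longrightarrow> C_infinity f S \<Longrightarrow> C_infinity (\<lambda>x. - f x) S"
  by (rule C_infinity_bounded_linear[OF _ bounded_linear_minus[OF bounded_linear_ident]])

lemma C_infinity_diff:
  "open S \<Longrightarrow> C_infinity f S \<Longrightarrow> C_infinity g S \<Longrightarrow> C_infinity (\<lambda>x. f x - g x) S"
  using C_infinity_add[of S f "\<lambda>x. - g x"] C_infinity_uminus[of S g] by simp

lemma C_infinity_bilinear:
  "open S \<Longrightarrow> bounded_bilinear h \<Longrightarrow> C_infinity f S \<Longrightarrow> C_infinity g S
    \<Longrightarrow> C_infinity (\<lambda>x. h (f x) (g x)) S"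
  by (rule C_infinity_I, rule C_k_bilinear; (erule C_infinity_D)?)

lemmas C_infinity_scaleR = C_infinity_bilinear[OF _ bounded_bilinear_scaleR]
lemmas C_infinity_mult = C_infinity_bilinear[OF _ bounded_bilinear_mult]
lemmas C_infinity_inner = C_infinity_bilinear[OF _ bounded_bilinear_inner]

lemma C_infinity_apply:
  fixes w :: "'a::real_normed_vector \<Rightarrow> 'b::euclidean_space" and h :: "'a \<Rightarrow> 'b \<Rightarrow> 'c::real_normed_vector"
  assumes "open S" "\<And>x. x \<in> S \<Longrightarrow> linear (h x)" "\<And>e. C_infinity (\<lambda>x. h x e) S" "C_infinity w S"
  shows "C_infinity (\<lambda>x. h x (w x)) S"
  by (rule C_infinity_I, rule C_k_apply[OF assms(1,2) assms(3,4)[THEN C_infinity_D]])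

lemma C_infinity_compose:
  fixes g :: "'a::real_normed_vector \<Rightarrow> 'b::euclidean_space"
    and f :: "'b \<Rightarrow> 'c::real_normed_vector"
  shows "open S \<Longrightarrow> open T \<Longrightarrow> g ` S \<subseteq> T \<Longrightarrow> C_infinity f T \<Longrightarrow> C_infinity g S
    \<Longrightarrow> C_infinity (\<lambda>x. f (g x)) S"
  by (rule C_infinity_I, rule C_k_compose[of S T g]; (erule C_infinity_D)?)

lemma C_infinity_divide:
  fixes f g :: "'a::real_normed_vector \<Rightarrow> real"
  shows "open S \<Longrightarrow> C_infinity f S \<Longrightarrow> C_infinity g S \<Longrightarrow> (\<And>x. x \<in> S \<Longrightarrow> g x \<noteq> 0)
    \<Longrightarrow> C_infinity (\<lambda>x. f x / g x) S"
  unfolding divide_inverse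
  using C_k_inverse[of S g] by (intro C_infinity_mult) (auto simp: C_infinity_def)

lemma C_infinity_continuous_on: "C_infinity f S \<Longrightarrow> continuous_on S f"
  unfolding C_infinity_def using C_k.simps(1)[of f S] by blast

lemma C_infinity_has_derivative:
  "C_infinity f S \<Longrightarrow> x \<in> S \<Longrightarrow> (f has_derivative fderiv f x) (at x)"
  unfolding C_infinity_def using C_k_SucD'(1)[of 0 f S x] by blast

lemma C_infinity_linear_frechet:
  "C_infinity f S \<Longrightarrow> x \<in> S \<Longrightarrow> linear (fderiv f x)"
  using C_infinity_has_derivative[of f S x] has_derivative_linear by blast

lemma C_infinity_frechet:
  "C_infinity f S \<Longrightarrow> C_infinity (\<lambda>x. fderiv f x e) S"
  unfolding C_infinity_def using C_k_SucD'(2)[of _ f S e] by blast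

lemma C_infinity_frechet_apply:
  fixes f :: "'a::euclidean_space \<Rightarrow> 'b::real_normed_vector"
  assumes "open S" "C_infinity f S" "C_infinity w S"
  shows "C_infinity (\<lambda>x. fderiv f x (w x)) S"
  by (rule C_infinity_apply[OF assms(1) C_infinity_linear_frechet[OF assms(2)]
        C_infinity_frechet[OF assms(2)] assms(3)])

text \<open>On a compact ball the derivative along each basis vector is bounded; these bounds add up
  to one for the operator norm, and the ball is convex, so the mean value inequality applies. Later
  this turns vanishing on \<open>M\<close> into a bound by the distance to \<open>M\<close>.\<close>

lemma C_infinity_lipschitz:
  fixes f :: "'a::euclidean_space \<Rightarrow> 'b::real_normed_vector"
  assumes "C_infinity f S" "open S" "p \<in> S"
  obtains r L where "r > 0" "ball p r \<subseteq> S" "L \<ge> 0"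
    "\<And>x y. x \<in> ball p r \<Longrightarrow> y \<in> ball p r \<Longrightarrow> norm (f x - f y) \<le> L * norm (x - y)"
proof -
  obtain r0 where r0: "r0 > 0" "cball p r0 \<subseteq> S"
    using assms(2,3) open_contains_cball by blast
  have "bounded ((\<lambda>x. fderiv f x b) ` cball p r0)" for b
    using C_infinity_frechet[OF assms(1), THEN C_infinity_continuous_on] r0
    by (meson compact_cball compact_continuous_image compact_imp_bounded continuous_on_subset)
  then have "\<exists>B. \<forall>x\<in>cball p r0. norm (fderiv f x b) \<le> B" for b
    by (auto simp: bounded_iff)
  then obtain B where B: "\<And>x b. x \<in> cball p r0 \<Longrightarrow> norm (fderiv f x b) \<le> B b"
    by metis
  define L where "L = (\<Sum>b\<in>Basis. \<bar>B b\<bar>)"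
  have on: "onorm (fderiv f x) \<le> L" if "x \<in> cball p r0" for x
  proof (rule onorm_bound)
    show "0 \<le> L" by (simp add: L_def sum_nonneg)
    fix e
    have lin: "linear (fderiv f x)"
      using C_infinity_linear_frechet[OF assms(1)] that r0 by blast
    have "norm (fderiv f x e) \<le> (\<Sum>b\<in>Basis. norm ((e \<bullet> b) *\<^sub>R fderiv f x b))"
      by (subst linear_eq_sum_Basis[OF lin]) (rule norm_sum)
    also have "\<dots> \<le> (\<Sum>b\<in>Basis. \<bar>B b\<bar> * norm e)"
    proof (rule sum_mono)
      fix b :: 'a assume "b \<in> Basis"
      then have "\<bar>e \<bullet> b\<bar> * norm (fderiv f x b) \<le> norm e * \<bar>B b\<bar>"
        using B[OF that, of b] by (intro mult_mono Basis_le_norm) auto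
      then show "norm ((e \<bullet> b) *\<^sub>R fderiv f x b) \<le> \<bar>B b\<bar> * norm e"
        by (simp add: mult.commute)
    qed
    finally show "norm (fderiv f x e) \<le> L * norm e"
      by (simp add: L_def sum_distrib_right)
  qed
  show thesis
  proof (rule that[of r0 L])
    show "norm (f x - f y) \<le> L * norm (x - y)" if "x \<in> ball p r0" "y \<in> ball p r0" for x y
    proof (rule differentiable_bound[where S = "ball p r0" and f' = "\<lambda>x. fderiv f x"])
      show "(f has_derivative fderiv f z) (at z within ball p r0)"
        if "z \<in> ball p r0" for z
        using C_infinity_has_derivative[OF assms(1)] that r0 has_derivative_at_withinI
        by (meson ball_subset_cball subsetD)
    qed (use that on in auto)
  qed (use r0 in \<open>auto simp: L_def sum_nonneg\<close>)
qed

section \<open>Symmetry of second derivatives\<close>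

lemma has_field_derivative_along_line:
  fixes f :: "'e::euclidean_space \<Rightarrow> real"
  assumes "(f has_derivative f') (at (c + s *\<^sub>R a))"
  shows "((\<lambda>s. f (c + s *\<^sub>R a)) has_field_derivative f' a) (at s)"
proof -
  have "((\<lambda>s. f (c + s *\<^sub>R a)) has_derivative (\<lambda>t. f' (t *\<^sub>R a))) (at s)"
  proof -
    have "((\<lambda>s. c + s *\<^sub>R a) has_derivative (\<lambda>t. t *\<^sub>R a)) (at s)"
      by (auto intro!: derivative_eq_intros)
    from has_derivative_compose[OF this assms] show ?thesis .
  qed
  moreover have "f' (t *\<^sub>R a) = t * f' a" for t
    using linear_cmul[OF has_derivative_linear[OF assms]] by simp
  ultimately show ?thesis
    by (simp add: has_field_derivative_def mult_commute_abs)
qed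

text \<open>The mean value theorem is used twice: in the direction \<open>a\<close> for the
  difference of the values of \<open>f\<close> on the two sides \<open>t = h\<close> and
  \<open>t = 0\<close>, then in the direction \<open>b\<close> for the derivative so
  obtained.\<close>

lemma second_difference:
  fixes f :: "'e::euclidean_space \<Rightarrow> real"
  assumes "C_infinity f S" "h > 0" "cball x (h * (norm a + norm b)) \<subseteq> S"
  shows "\<exists>p. dist x p \<le> h * (norm a + norm b) \<and>
    f (x + h *\<^sub>R a + h *\<^sub>R b) - f (x + h *\<^sub>R a) - f (x + h *\<^sub>R b) + f x =
      h * h * hess f p b a"
proof -
  have near: "dist x (x + s *\<^sub>R a + t *\<^sub>R b) \<le> h * (norm a + norm b)"
    if "0 \<le> s" "s \<le> h" "0 \<le> t" "t \<le> h" for s t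
  proof -
    have "dist x (x + s *\<^sub>R a + t *\<^sub>R b) = norm (s *\<^sub>R a + t *\<^sub>R b)"
      by (metis add.assoc add_diff_cancel_left' dist_commute dist_norm)
    also have "\<dots> \<le> s * norm a + t * norm b"
      using norm_triangle_ineq[of "s *\<^sub>R a" "t *\<^sub>R b"] that by simp
    also have "\<dots> \<le> h * norm a + h * norm b"
      using that by (intro add_mono mult_right_mono) auto
    finally show ?thesis by (simp add: algebra_simps)
  qed
  have inS: "x + s *\<^sub>R a + t *\<^sub>R b \<in> S"
    if "0 \<le> s" "s \<le> h" "0 \<le> t" "t \<le> h" for s t
    using near[OF that] assms(3) by (auto simp: subset_iff)
  let ?Da = "\<lambda>p. fderiv f p a"
  have d1: "((\<lambda>s. f (x + s *\<^sub>R a + t *\<^sub>R b)) has_field_derivative ?Da (x + s *\<^sub>R a + t *\<^sub>R b)) (at s)"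
    if "0 \<le> s" "s \<le> h" "0 \<le> t" "t \<le> h" for s t
  proof -
    have *: "x + s *\<^sub>R a + t *\<^sub>R b = (x + t *\<^sub>R b) + s *\<^sub>R a" for s by simp
    show ?thesis
      unfolding *
      by (rule has_field_derivative_along_line[OF C_infinity_has_derivative[OF assms(1)]])
        (use inS[OF that] in \<open>simp add: *\<close>)
  qed
  have "\<exists>\<sigma>>0. \<sigma> < h \<and>
      (f (x + h *\<^sub>R a + h *\<^sub>R b) - f (x + h *\<^sub>R a + 0 *\<^sub>R b))
        - (f (x + 0 *\<^sub>R a + h *\<^sub>R b) - f (x + 0 *\<^sub>R a + 0 *\<^sub>R b))
      = (h - 0) * (?Da (x + \<sigma> *\<^sub>R a + h *\<^sub>R b) - ?Da (x + \<sigma> *\<^sub>R a + 0 *\<^sub>R b))"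
    using assms(2) by (intro MVT2 DERIV_diff d1) auto
  then obtain \<sigma> where \<sigma>: "0 < \<sigma>" "\<sigma> < h"
      "f (x + h *\<^sub>R a + h *\<^sub>R b) - f (x + h *\<^sub>R a) - f (x + h *\<^sub>R b) + f x
      = h * (?Da (x + \<sigma> *\<^sub>R a + h *\<^sub>R b) - ?Da (x + \<sigma> *\<^sub>R a + 0 *\<^sub>R b))"
    by auto
  have "\<exists>\<tau>>0. \<tau> < h \<and> ?Da (x + \<sigma> *\<^sub>R a + h *\<^sub>R b) - ?Da (x + \<sigma> *\<^sub>R a + 0 *\<^sub>R b)
      = (h - 0) * frechet_derivative ?Da (at (x + \<sigma> *\<^sub>R a + \<tau> *\<^sub>R b)) b"
    using assms(2) \<sigma> 
    by (intro MVT2 has_field_derivative_along_line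
        C_infinity_has_derivative[OF C_infinity_frechet[OF assms(1)]] inS) auto
  then obtain \<tau> where "0 < \<tau>" "\<tau> < h" "?Da (x + \<sigma> *\<^sub>R a + h *\<^sub>R b) - ?Da (x + \<sigma> *\<^sub>R a + 0 *\<^sub>R b)
      = h * frechet_derivative ?Da (at (x + \<sigma> *\<^sub>R a + \<tau> *\<^sub>R b)) b"
    by auto
  with \<sigma> near[of \<sigma> \<tau>] show ?thesis
    by (intro exI[of _ "x + \<sigma> *\<^sub>R a + \<tau> *\<^sub>R b"]) auto
qed

text \<open>The second difference does not change when \<open>a\<close> and \<open>b\<close> are
  exchanged. So in every small ball around \<open>x\<close> the two mixed derivatives take a common
  value, possibly at different points, and continuity carries the equality to
  \<open>x\<close>.\<close>

lemma second_derivative_symmetric: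
  fixes f :: "'e::euclidean_space \<Rightarrow> real"
  assumes "open S" "C_infinity f S" "x \<in> S"
  shows "hess f x b a = hess f x a b"
proof -
  define A where "A = (\<lambda>p. hess f p b a)"
  define B where "B = (\<lambda>p. hess f p a b)"
  have cont: "isCont A x" "isCont B x"
    unfolding A_def B_def
    using C_infinity_frechet[OF C_infinity_frechet[OF assms(2)], THEN C_infinity_continuous_on]
      assms(1,3) continuous_on_eq_continuous_at by blast+
  obtain r where r: "r > 0" "cball x r \<subseteq> S"
    using assms(1,3) open_contains_cball by blast
  \<comment> \<open>The summand \<open>1\<close> keeps the divisor in \<open>h\<close> positive when
    both directions are zero. With this scaling the parallelogram of the second difference stays
    within \<open>r / real (Suc n)\<close> of \<open>x\<close>.\<close>
  define K where "K = norm a + norm b + 1"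
  have K: "K \<ge> 1" "norm a + norm b \<le> K" by (auto simp: K_def)
  define h where "h = (\<lambda>n. r / (K * real (Suc n)))"
  have hpos: "h n > 0" for n using r K by (simp add: h_def)
  have hr: "h n * (norm a + norm b) \<le> r / real (Suc n)" for n
  proof -
    have "h n * (norm a + norm b) \<le> h n * K"
      using K hpos[of n] by (intro mult_left_mono) auto
    also have "\<dots> = r / real (Suc n)" using K by (simp add: h_def)
    finally show ?thesis .
  qed
  have rn: "r / real (Suc n) \<le> r" for n using r by (simp add: field_simps)
  have sub: "cball x (h n * (norm a + norm b)) \<subseteq> S" for n
    using r hr[of n] rn[of n] by force
  have "\<exists>p q. dist x p \<le> r / real (Suc n) \<and> dist x q \<le> r / real (Suc n) \<and> A p = B q" for n
  proof -
    obtain p where p: "dist x p \<le> h n * (norm a + norm b)"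
      "f (x + h n *\<^sub>R a + h n *\<^sub>R b) - f (x + h n *\<^sub>R a) - f (x + h n *\<^sub>R b) + f x = h n * h n * A p"
      using second_difference[OF assms(2) hpos sub] unfolding A_def by blast
    obtain q where q: "dist x q \<le> h n * (norm b + norm a)"
      "f (x + h n *\<^sub>R b + h n *\<^sub>R a) - f (x + h n *\<^sub>R b) - f (x + h n *\<^sub>R a) + f x = h n * h n * B q"
      using second_difference[OF assms(2) hpos, of x n b a] sub[of n]
      unfolding B_def by (auto simp: add.commute)
    have "x + h n *\<^sub>R b + h n *\<^sub>R a = x + h n *\<^sub>R a + h n *\<^sub>R b" by simp
    then have fe: "f (x + h n *\<^sub>R b + h n *\<^sub>R a) = f (x + h n *\<^sub>R a + h n *\<^sub>R b)" by (rule arg_cong)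
    have "h n * h n * A p = h n * h n * B q" using p(2) q(2) unfolding fe by linarith
    then have "A p = B q" using hpos[of n] by simp
    with p(1) q(1) hr[of n] show ?thesis by (metis add.commute order_trans)
  qed
  then obtain p q where pq: "\<And>n. dist x (p n) \<le> r / real (Suc n)"
    "\<And>n. dist x (q n) \<le> r / real (Suc n)" "\<And>n. A (p n) = B (q n)"
    by metis
  have lim0: "(\<lambda>n. r / real (Suc n)) \<longlonglongrightarrow> 0"
    using lim_const_over_n LIMSEQ_Suc by blast
  have "p \<longlonglongrightarrow> x" "q \<longlonglongrightarrow> x"
    using pq(1,2) r(1)
    by (auto intro!: metric_tendsto_imp_tendsto[OF lim0] always_eventually simp: dist_commute)
  then have "(\<lambda>n. A (p n)) \<longlonglongrightarrow> A x" "(\<lambda>n. B (q n)) \<longlonglongrightarrow> B x"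
    using cont isCont_tendsto_compose by blast+
  then have "A x = B x" using pq(3) LIMSEQ_unique by simp
  then show ?thesis by (simp add: A_def B_def)
qed

text \<open>A product rule in which one factor is merely continuous. As \<open>f\<close> vanishes at
  \<open>x\<close>, it grows at most linearly there, so \<open>f y *\<^sub>R (h y - h x)\<close> is
  of smaller order than \<open>y - x\<close>. It serves for the derivative of an inverse map, whose
  differentiability is still open at that stage.\<close>

lemma has_derivative_scaleR_at_zero:
  fixes f :: "'a::real_normed_vector \<Rightarrow> real" and h :: "'a \<Rightarrow> 'b::real_normed_vector"
  assumes "(f has_derivative f') (at x)" "f x = 0" "isCont h x"
  shows "((\<lambda>y. f y *\<^sub>R h y) has_derivative (\<lambda>v. f' v *\<^sub>R h x)) (at x)"
proof -
  have bl: "bounded_linear f'" using assms(1) by (rule has_derivative_bounded_linear)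
  have "((\<lambda>y. f y *\<^sub>R (h y - h x)) has_derivative (\<lambda>v. 0)) (at x)"
    unfolding has_derivative_iff_norm
  proof (intro conjI)
    obtain e where e: "(\<lambda>y. norm (f y - f x - f' (y - x)) / norm (y - x)) \<midarrow>x\<rightarrow> 0"
      using assms(1) by (auto simp: has_derivative_iff_norm)
    obtain K where K: "\<And>v. norm (f' v) \<le> norm v * K"
      using bounded_linear.bounded[OF bl] by blast
    have l: "((\<lambda>y. (norm (f y - f x - f' (y - x)) / norm (y - x) + K) * norm (h y - h x)) \<longlongrightarrow> (0 + K) * norm (h x - h x)) (at x)"
      by (intro tendsto_intros e assms(3)[unfolded isCont_def])
    show "((\<lambda>y. norm (f y *\<^sub>R (h y - h x) - f x *\<^sub>R (h x - h x) - 0) / norm (y - x)) \<longlongrightarrow> 0) (at x)"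
    proof (rule tendsto_sandwich[OF _ _ tendsto_const])
      show "\<forall>\<^sub>F y in at x. norm (f y *\<^sub>R (h y - h x) - f x *\<^sub>R (h x - h x) - 0) / norm (y - x)
          \<le> (norm (f y - f x - f' (y - x)) / norm (y - x) + K) * norm (h y - h x)"
      proof (rule eventually_at_topological[THEN iffD2], intro exI[of _ UNIV] conjI ballI impI)
        fix y assume "y \<noteq> x"
        have "\<bar>f y\<bar> \<le> norm (f y - f x - f' (y - x)) + norm (y - x) * K"
          using K[of "y - x"] assms(2) by (simp add: abs_if split: if_splits)
        then have "\<bar>f y\<bar> / norm (y - x) \<le> norm (f y - f x - f' (y - x)) / norm (y - x) + K"
          using \<open>y \<noteq> x\<close> by (simp add: field_simps)
        then have "\<bar>f y\<bar> / norm (y - x) * norm (h y - h x)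
            \<le> (norm (f y - f x - f' (y - x)) / norm (y - x) + K) * norm (h y - h x)"
          by (rule mult_right_mono) simp
        then show "norm (f y *\<^sub>R (h y - h x) - f x *\<^sub>R (h x - h x) - 0) / norm (y - x)
          \<le> (norm (f y - f x - f' (y - x)) / norm (y - x) + K) * norm (h y - h x)"
          using assms(2) by simp
      qed auto
      show "\<forall>\<^sub>F y in at x. 0 \<le> norm (f y *\<^sub>R (h y - h x) - f x *\<^sub>R (h x - h x) - 0) / norm (y - x)"
        by simp
    qed (use l in simp)
  qed (rule bounded_linear_zero)
  moreover have "((\<lambda>y. f y *\<^sub>R h x) has_derivative (\<lambda>v. f' v *\<^sub>R h x)) (at x)"
    by (rule bounded_linear.has_derivative[OF bounded_linear_scaleR_left assms(1)])
  ultimately have "((\<lambda>y. f y *\<^sub>R (h y - h x) + f y *\<^sub>R h x) has_derivative (\<lambda>v. 0 + f' v *\<^sub>R h x)) (at x)"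
    by (rule has_derivative_add)
  then show ?thesis by (simp add: scaleR_right_diff_distrib)
qed

text \<open>Differentiating \<open>A(y) B(y) e = e\<close>, where \<open>A(y) = DF(g y)\<close> and \<open>B(y) = Dg(y)\<close>, expresses the
  derivative of \<open>B e\<close> through \<open>B\<close> and \<open>D\<^sup>2F \<circ> g\<close>; smoothness follows by bootstrapping.\<close>

lemma C_infinity_inverse_map:
  fixes F g :: "'e::euclidean_space \<Rightarrow> 'e"
  assumes "open U" "C_infinity F U" "open V" "g ` V \<subseteq> U"
    and B: "\<And>y. y \<in> V \<Longrightarrow> (g has_derivative B y) (at y)"
    and BA: "\<And>y e. y \<in> V \<Longrightarrow> B y (fderiv F (g y) e) = e"
    and AB: "\<And>y e. y \<in> V \<Longrightarrow> fderiv F (g y) (B y e) = e"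
    and cont: "\<And>e. continuous_on V (\<lambda>y. B y e)"
  shows "C_infinity g V"
proof -
  define A where "A = (\<lambda>p. fderiv F p)"
  define A2 where "A2 = (\<lambda>e p. fderiv (\<lambda>p. A p e) p)"
  have gV: "g y \<in> U" if "y \<in> V" for y using that assms(4) by auto
  have linB: "linear (B y)" if "y \<in> V" for y by (rule has_derivative_linear[OF B[OF that]])
  have smA: "C_infinity (\<lambda>p. A p e) U" for e
    unfolding A_def by (rule C_infinity_frechet[OF assms(2)])
  have linA: "linear (A p)" if "p \<in> U" for p
    unfolding A_def by (rule C_infinity_linear_frechet[OF assms(2) that])
  have smA2: "C_infinity (\<lambda>p. A2 e p v) U" for e v
    unfolding A2_def by (rule C_infinity_frechet[OF smA])
  have linA2: "linear (A2 e p)" if "p \<in> U" for e p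
    unfolding A2_def by (rule C_infinity_linear_frechet[OF smA that])
  have linA2': "linear (\<lambda>e. A2 e p v)" if "p \<in> U" for p v
  proof (rule linearI)
    have d: "((\<lambda>p. A p e) has_derivative A2 e p) (at p)" for e
      unfolding A2_def by (rule C_infinity_has_derivative[OF smA that])
    show "A2 (e + e') p v = A2 e p v + A2 e' p v" for e e'
    proof -
      have "((\<lambda>p. A p (e + e')) has_derivative (\<lambda>v. A2 e p v + A2 e' p v)) (at p)"
        by (rule has_derivative_transform_within_open[OF has_derivative_add[OF d[of e] d[of e']] assms(1) that])
          (simp add: linear_add[OF linA])
      with d[of "e + e'"] show ?thesis by (metis has_derivative_unique)
    qed
    show "A2 (c *\<^sub>R e) p v = c *\<^sub>R A2 e p v" for c e
    proof -
      have "((\<lambda>p. A p (c *\<^sub>R e)) has_derivative (\<lambda>v. c *\<^sub>R A2 e p v)) (at p)"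
        by (rule has_derivative_transform_within_open[OF has_derivative_scaleR_right[OF d[of e]] assms(1) that])
          (simp add: linear_cmul[OF linA])
      with d[of "c *\<^sub>R e"] show ?thesis by (metis has_derivative_unique)
    qed
  qed
  have dB: "((\<lambda>y. B y e) has_derivative (\<lambda>v. - B x (A2 (B x e) (g x) (B x v)))) (at x)"
    if x: "x \<in> V" for x e
  proof -
    \<comment> \<open>The error of \<open>B x e\<close> as a solution of the linear equation at
      \<open>y\<close>. It is zero for \<open>y = x\<close>, and
      \<open>B y (r y) = B y e - B x e\<close>; so the increment of \<open>B\<close> is a
      differentiable factor that vanishes at \<open>x\<close>, acted on by a continuous one.\<close>
    define r where "r = (\<lambda>y. e - A (g y) (B x e))"
    have dr: "(r has_derivative (\<lambda>v. - A2 (B x e) (g x) (B x v))) (at x)"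
    proof -
      have "((\<lambda>p. A p (B x e)) has_derivative A2 (B x e) (g x)) (at (g x))"
        unfolding A2_def by (rule C_infinity_has_derivative[OF smA gV[OF x]])
      then have "((\<lambda>y. A (g y) (B x e)) has_derivative (\<lambda>v. A2 (B x e) (g x) (B x v))) (at x)"
        by (rule has_derivative_compose[OF B[OF x]])
      from has_derivative_diff[OF has_derivative_const this] show ?thesis
        unfolding r_def by simp
    qed
    have r0: "r x = 0" using AB[OF x] by (simp add: r_def A_def)
    have "((\<lambda>y. \<Sum>b\<in>Basis. (r y \<bullet> b) *\<^sub>R B y b) has_derivative
        (\<lambda>v. \<Sum>b\<in>Basis. (- A2 (B x e) (g x) (B x v) \<bullet> b) *\<^sub>R B x b)) (at x)"
    proof (intro has_derivative_sum has_derivative_scaleR_at_zero)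
      show "((\<lambda>y. r y \<bullet> b) has_derivative (\<lambda>v. - A2 (B x e) (g x) (B x v) \<bullet> b)) (at x)" for b
        by (rule bounded_linear.has_derivative[OF bounded_linear_inner_left dr])
      show "isCont (\<lambda>y. B y b) x" for b
        using cont[of b] x assms(3) continuous_on_eq_continuous_at by blast
    qed (use r0 in simp)
    moreover have "(\<Sum>b\<in>Basis. (w \<bullet> b) *\<^sub>R B x b) = B x w" for w
      by (rule linear_eq_sum_Basis[OF linB[OF x], symmetric])
    ultimately have "((\<lambda>y. \<Sum>b\<in>Basis. (r y \<bullet> b) *\<^sub>R B y b) has_derivative
        (\<lambda>v. B x (- A2 (B x e) (g x) (B x v)))) (at x)"
      by (simp only:)
    then have "((\<lambda>y. B x e + (\<Sum>b\<in>Basis. (r y \<bullet> b) *\<^sub>R B y b)) has_derivative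
        (\<lambda>v. 0 + B x (- A2 (B x e) (g x) (B x v)))) (at x)"
      by (rule has_derivative_add[OF has_derivative_const])
    moreover have "B x e + (\<Sum>b\<in>Basis. (r y \<bullet> b) *\<^sub>R B y b) = B y e" if "y \<in> V" for y
    proof -
      have "(\<Sum>b\<in>Basis. (r y \<bullet> b) *\<^sub>R B y b) = B y (r y)"
        by (rule linear_eq_sum_Basis[OF linB[OF that], symmetric])
      also have "\<dots> = B y e - B x e"
        using BA[OF that] by (simp add: r_def A_def linear_diff[OF linB[OF that]])
      finally show ?thesis by simp
    qed
    ultimately have "((\<lambda>y. B y e) has_derivative (\<lambda>v. 0 + B x (- A2 (B x e) (g x) (B x v)))) (at x)"
      using has_derivative_transform_within_open[OF _ assms(3) x] by fastforce
    then show ?thesis by (simp add: linear_neg[OF linB[OF x]])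
  qed
  \<comment> \<open>The orders of \<open>g\<close> and \<open>B\<close> are raised together: the
    derivative of \<open>g\<close> is \<open>B\<close>, and that of \<open>B\<close> is an
    expression in \<open>B\<close>, \<open>g\<close> and the smooth map \<open>A2\<close>.\<close>
  have "C_k k g V \<and> (\<forall>e. C_k k (\<lambda>y. B y e) V)" for k
  proof (induction k)
    case 0
    have "continuous_on V g"
      using B by (meson continuous_at_imp_continuous_on has_derivative_continuous)
    then show ?case using cont by simp
  next
    case (Suc k)
    then have g: "C_k k g V" and b: "\<And>e. C_k k (\<lambda>y. B y e) V" by auto
    have A2g: "C_k k (\<lambda>y. A2 e (g y) v) V" for e v
      using smA2 by (intro C_k_compose[OF assms(3,1,4) _ g]) (simp add: C_infinity_def)
    have A2B: "C_k k (\<lambda>y. A2 e (g y) (B y v)) V" for e v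
      by (rule C_k_apply[OF assms(3) linA2[OF gV] A2g b])
    have *: "C_k k (\<lambda>y. A2 (B y e) (g y) (B y v)) V" for e v
    proof (rule C_k_apply[where h = "\<lambda>y e. A2 e (g y) (B y v)" and w = "\<lambda>y. B y e", OF assms(3)])
      show "linear (\<lambda>e. A2 e (g y) (B y v))" if "y \<in> V" for y
        by (rule linA2'[OF gV[OF that]])
      show "C_k k (\<lambda>y. A2 e' (g y) (B y v)) V" for e' by (rule A2B)
      show "C_k k (\<lambda>y. B y e) V" by (rule b)
    qed
    have "C_k k (\<lambda>y. B y (A2 (B y e) (g y) (B y v))) V" for e v
      by (rule C_k_apply[OF assms(3) linB b *])
    then have "C_k k (\<lambda>y. - B y (A2 (B y e) (g y) (B y v))) V" for e v
      by (rule C_k_bounded_linear[OF assms(3) bounded_linear_minus[OF bounded_linear_ident]])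
    then have "C_k (Suc k) (\<lambda>y. B y e) V" for e
      by (intro C_k_SucI[OF assms(3) dB])
    moreover have "C_k (Suc k) g V"
      by (rule C_k_SucI[OF assms(3) B b])
    ultimately show ?case by blast
  qed
  then show ?thesis by (simp add: C_infinity_def)
qed

text \<open>The normalization of the derivative to the identity fits the map from which adapted
  charts are built. \<open>inverse_function_theorem\<close> gives an inverse with derivative
  \<open>B y\<close> at each point; the work here is the continuity of \<open>B\<close> on fixed
  vectors, after which \<open>C_infinity_inverse_map\<close> takes over.\<close>

lemma smooth_inverse_function:
  fixes F :: "'e::euclidean_space \<Rightarrow> 'e"
  assumes "open U" "C_infinity F U" "p \<in> U" "\<And>e. fderiv F p e = e"
  obtains U' V g where "open U'" "U' \<subseteq> U" "p \<in> U'" "open V" "homeomorphism U' V F g" "C_infinity g V"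
proof -
  define F' where "F' = (\<lambda>p. Blinfun (fderiv F p))"
  have F': "blinfun_apply (F' q) = fderiv F q" if "q \<in> U" for q
    unfolding F'_def
    by (rule bounded_linear_Blinfun_apply[OF has_derivative_bounded_linear[OF C_infinity_has_derivative[OF assms(2) that]]])
  have "continuous_on U F'"
  proof (rule continuous_on_blinfun_componentwise)
    show "continuous_on U (\<lambda>q. blinfun_apply (F' q) i)" for i
      using C_infinity_continuous_on[OF C_infinity_frechet[OF assms(2)]] F'
      by (simp cong: continuous_on_cong)
  qed
  moreover have "id_blinfun o\<^sub>L F' p = id_blinfun"
    by (rule blinfun_eqI) (simp add: F'[OF assms(3)] assms(4))
  ultimately obtain U' V g B where *: "open U'" "U' \<subseteq> U" "p \<in> U'" "open V" "F p \<in> V" "homeomorphism U' V F g"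
    "\<And>y. y \<in> V \<Longrightarrow> (g has_derivative (B y)) (at y)"
    "\<And>y. y \<in> V \<Longrightarrow> B y = inv (blinfun_apply (F' (g y)))"
    "\<And>y. y \<in> V \<Longrightarrow> bij (blinfun_apply (F' (g y)))"
    using inverse_function_theorem[OF assms(1) _ _ assms(3), of F F' id_blinfun] F'
      C_infinity_has_derivative[OF assms(2)] by metis
  have gV: "g y \<in> U" if "y \<in> V" for y
    using that *(2,6) by (auto simp: homeomorphism_def)
  have BA: "B y (fderiv F (g y) e) = e"
    and AB: "fderiv F (g y) (B y e) = e" if "y \<in> V" for y e
    using *(8,9)[OF that] F'[OF gV[OF that]]
    by (simp_all add: bij_is_inj bij_is_surj surj_f_inv_f)
  have gc: "continuous_on V g" using *(6) by (simp add: homeomorphism_def)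
  have F'c: "isCont F' q" if "q \<in> U" for q
    using \<open>continuous_on U F'\<close> assms(1) that continuous_on_eq_continuous_at by blast
  have "continuous_on V (\<lambda>y. B y e)" for e
  proof (rule continuous_at_imp_continuous_on, rule ballI)
    fix x assume x: "x \<in> V"
    have linA: "linear (blinfun_apply (F' (g x)))"
      by (rule blinfun.bounded_linear_right[THEN bounded_linear.linear])
    \<comment> \<open>Once \<open>F' (g y)\<close> is within \<open>c / 2\<close> of
      \<open>F' (g x)\<close>, it is itself bounded below by \<open>c / 2\<close>. This bounds
      \<open>B y e - B x e\<close> by the distance of the two operators.\<close>
    obtain c where c: "c > 0" "\<And>v. c * norm v \<le> norm (F' (g x) v)"
      using linear_inj_bounded_below_pos[OF linA bij_is_inj[OF *(9)[OF x]]] by blast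
    have "isCont (\<lambda>y. F' (g y)) x"
      using continuous_at_compose[of x g F'] F'c[OF gV[OF x]] gc x *(4)
      by (auto simp: continuous_on_eq_continuous_at o_def)
    then have lim: "((\<lambda>y. F' (g y)) \<longlongrightarrow> F' (g x)) (at x)" by (simp add: isCont_def)
    have "\<forall>\<^sub>F y in at x. y \<in> V"
      using *(4) x eventually_at_topological by blast
    moreover have "\<forall>\<^sub>F y in at x. dist (F' (g y)) (F' (g x)) < c / 2"
      using tendstoD[OF lim, of "c / 2"] c(1) by simp
    ultimately have "\<forall>\<^sub>F y in at x.
        norm (B y e - B x e) \<le> 2 / c * (norm (F' (g y) - F' (g x)) * norm (B x e))"
    proof eventually_elim
      case (elim y)
      define w where "w = B y e - B x e"
      have "F' (g y) w = F' (g x) (B x e) - F' (g y) (B x e)"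
        using AB[OF elim(1), of e] AB[OF x, of e] F'[OF gV[OF elim(1)]] F'[OF gV[OF x]]
        by (simp add: w_def linear_diff[OF C_infinity_linear_frechet[OF assms(2) gV[OF elim(1)]]])
      also have "\<dots> = - ((F' (g y) - F' (g x)) (B x e))" by (simp add: blinfun.diff_left)
      finally have 1: "norm (F' (g y) w) \<le> norm (F' (g y) - F' (g x)) * norm (B x e)"
        by (metis norm_blinfun norm_minus_cancel)
      have "norm ((F' (g y) - F' (g x)) w) \<le> c / 2 * norm w"
        using elim(2) by (intro order_trans[OF norm_blinfun] mult_right_mono) (auto simp: dist_norm)
      moreover have "c * norm w \<le> norm (F' (g y) w) + norm ((F' (g y) - F' (g x)) w)"
        using c(2)[of w] norm_triangle_ineq4[of "F' (g y) w" "(F' (g y) - F' (g x)) w"]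
        by (simp add: blinfun.diff_left)
      ultimately have "c / 2 * norm w \<le> norm (F' (g y) w)" by linarith
      with 1 have "c / 2 * norm w \<le> norm (F' (g y) - F' (g x)) * norm (B x e)" by linarith
      then show ?case using c(1) by (simp add: w_def field_simps)
    qed
    moreover
    have "((\<lambda>y. 2 / c * (norm (F' (g y) - F' (g x)) * norm (B x e))) \<longlongrightarrow>
        2 / c * (norm (F' (g x) - F' (g x)) * norm (B x e))) (at x)"
      by (intro tendsto_intros lim)
    then have "((\<lambda>y. 2 / c * (norm (F' (g y) - F' (g x)) * norm (B x e))) \<longlongrightarrow> 0) (at x)"
      by simp
    ultimately have "((\<lambda>y. B y e - B x e) \<longlongrightarrow> 0) (at x)"
      by (rule Lim_null_comparison)
    then show "isCont (\<lambda>y. B y e) x" by (simp add: isCont_def LIM_zero_iff)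
  qed
  then have "C_infinity g V"
    using C_infinity_inverse_map[OF assms(1,2) *(4) _ *(7) BA AB] gV by blast
  then show thesis using that * by blast
qed

text \<open>Product rule for the derivative along a varying direction: one term with the direction
  frozen, one from the variation of \<open>a\<close>. Expanding in \<open>Basis\<close> avoids
  operator-valued maps.\<close>

lemma frechet_derivative_apply_field:
  fixes F :: "'e::euclidean_space \<Rightarrow> 'b::real_normed_vector" and a :: "'e \<Rightarrow> 'e"
  assumes "open S" "C_infinity F S" "C_infinity a S" "p \<in> S"
  shows "fderiv (\<lambda>q. fderiv F q (a q)) p e =
    hess F p e (a p)
    + fderiv F p (fderiv a p e)"
proof -
  have lin: "linear (fderiv F q)" if "q \<in> S" for q
    by (rule C_infinity_linear_frechet[OF assms(2) that])
  have da: "((\<lambda>q. a q \<bullet> b) has_derivative (\<lambda>e. fderiv a p e \<bullet> b)) (at p)" for b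
    by (rule bounded_linear.has_derivative[OF bounded_linear_inner_left C_infinity_has_derivative[OF assms(3,4)]])
  have dF: "((\<lambda>q. fderiv F q b) has_derivative
      fderiv (\<lambda>q. fderiv F q b) p) (at p)" for b
    by (rule C_infinity_has_derivative[OF C_infinity_frechet[OF assms(2)] assms(4)])
  let ?D2 = "\<lambda>b. fderiv (\<lambda>q. fderiv F q b) p"
  have "((\<lambda>q. \<Sum>b\<in>Basis. (a q \<bullet> b) *\<^sub>R fderiv F q b) has_derivative
      (\<lambda>e. \<Sum>b\<in>Basis. (a p \<bullet> b) *\<^sub>R ?D2 b e
        + (fderiv a p e \<bullet> b) *\<^sub>R fderiv F p b)) (at p)"
    by (rule has_derivative_sum, rule has_derivative_scaleR[OF da dF])
  then have 1: "((\<lambda>q. fderiv F q (a q)) has_derivative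
      (\<lambda>e. \<Sum>b\<in>Basis. (a p \<bullet> b) *\<^sub>R ?D2 b e
        + (fderiv a p e \<bullet> b) *\<^sub>R fderiv F p b)) (at p)"
    by (rule has_derivative_transform_within_open[OF _ assms(1,4)])
      (rule linear_eq_sum_Basis[OF lin, symmetric])
  have "((\<lambda>q. \<Sum>b\<in>Basis. (a p \<bullet> b) *\<^sub>R fderiv F q b) has_derivative
      (\<lambda>e. \<Sum>b\<in>Basis. (a p \<bullet> b) *\<^sub>R ?D2 b e)) (at p)"
    by (rule has_derivative_sum, rule bounded_linear.has_derivative[OF bounded_linear_scaleR_right dF])
  then have 2: "((\<lambda>q. fderiv F q (a p)) has_derivative
      (\<lambda>e. \<Sum>b\<in>Basis. (a p \<bullet> b) *\<^sub>R ?D2 b e)) (at p)"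
    by (rule has_derivative_transform_within_open[OF _ assms(1,4)])
      (rule linear_eq_sum_Basis[OF lin, symmetric])
  have "(\<Sum>b\<in>Basis. (fderiv a p e \<bullet> b) *\<^sub>R fderiv F p b)
      = fderiv F p (fderiv a p e)"
    by (rule linear_eq_sum_Basis[OF lin[OF assms(4)], symmetric])
  then show ?thesis
    unfolding frechet_derivative_at[OF 1, symmetric] frechet_derivative_at[OF 2, symmetric]
    by (simp add: sum.distrib)
qed

text \<open>Functions that agree near \<open>x\<close> have the same derivatives there, and
  \<open>frechet_derivative\<close> is a choice governed by that predicate alone. The equality
  therefore covers functions without a derivative as well.\<close>

lemma frechet_derivative_eq_on_open:
  assumes "open S" "x \<in> S" "\<And>y. y \<in> S \<Longrightarrow> f y = g y"
  shows "fderiv f x = fderiv g x"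
proof -
  have "(f has_derivative f') (at x) \<longleftrightarrow> (g has_derivative f') (at x)" for f'
    using has_derivative_transform_within_open[OF _ assms(1,2)] assms(3) by metis
  then show ?thesis by (simp add: frechet_derivative_def)
qed

section \<open>Charts and tangent vectors\<close>

text \<open>Membership in the maximal atlas. Adapted charts are constructed and need not belong to
  \<open>atlas X\<close>, so all work in coordinates is done in this larger class.\<close>

definition compatible_chart :: "('a, 'e::euclidean_space) mfd \<Rightarrow> 'a set \<Rightarrow> ('a \<Rightarrow> 'e) \<Rightarrow> bool"
  where "compatible_chart X U \<psi> \<longleftrightarrow>
    opens X U \<and> open (\<psi> ` U) \<and>
    homeomorphic_map (subtopology (mtop X) U) (top_of_set (\<psi> ` U)) \<psi> \<and>
    (\<forall>(U', \<phi>')\<in>atlas X. C_infinity (\<phi>' \<circ> inv_into U \<psi>) (\<psi> ` (U \<inter> U')) \<and>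
        C_infinity (\<psi> \<circ> inv_into U' \<phi>') (\<phi>' ` (U \<inter> U')))"

lemma atlas_compatible_chart:
  assumes "smooth_manifold X" "(U, \<phi>) \<in> atlas X"
  shows "compatible_chart X U \<phi>"
proof -
  have tr: "C_infinity (\<phi>2 \<circ> inv_into U1 \<phi>1) (\<phi>1 ` (U1 \<inter> U2))"
    if "(U1, \<phi>1) \<in> atlas X" "(U2, \<phi>2) \<in> atlas X" for U1 \<phi>1 U2 \<phi>2
    using assms(1) that unfolding smooth_manifold_def by fast
  have "opens X U \<and> open (\<phi> ` U) \<and> homeomorphic_map (subtopology (mtop X) U) (top_of_set (\<phi> ` U)) \<phi>"
    using assms unfolding smooth_manifold_def by fast
  moreover have "C_infinity (\<phi>' \<circ> inv_into U \<phi>) (\<phi> ` (U \<inter> U')) \<and>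
        C_infinity (\<phi> \<circ> inv_into U' \<phi>') (\<phi>' ` (U \<inter> U'))" if "(U', \<phi>') \<in> atlas X" for U' \<phi>'
    using tr[OF assms(2) that] tr[OF that assms(2)] by (simp add: Int_commute)
  ultimately show ?thesis unfolding compatible_chart_def by blast
qed

lemma smooth_manifold_chart_at:
  assumes "smooth_manifold X" "x \<in> pts X"
  obtains U \<phi> where "(U, \<phi>) \<in> atlas X" "x \<in> U"
  using assms unfolding smooth_manifold_def by blast

lemma smooth_on_subset: "smooth_on X N f \<Longrightarrow> N' \<subseteq> N \<Longrightarrow> smooth_on X N' f"
  unfolding smooth_on_def by (force intro: C_infinity_subset)

locale chart =
  fixes X :: "('a, 'e::euclidean_space) mfd" and U :: "'a set" and \<psi> :: "'a \<Rightarrow> 'e"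
  assumes manifold: "smooth_manifold X" and compatible: "compatible_chart X U \<psi>"
begin

abbreviation \<xi> :: "'e \<Rightarrow> 'a" where "\<xi> \<equiv> inv_into U \<psi>"

lemma opens_U: "opens X U"
  and open_range: "open (\<psi> ` U)"
  and homeo: "homeomorphic_map (subtopology (mtop X) U) (top_of_set (\<psi> ` U)) \<psi>"
  using compatible by (auto simp: compatible_chart_def)

lemma transition:
  assumes "(U', \<phi>') \<in> atlas X"
  shows "C_infinity (\<phi>' \<circ> \<xi>) (\<psi> ` (U \<inter> U'))" "C_infinity (\<psi> \<circ> inv_into U' \<phi>') (\<phi>' ` (U \<inter> U'))"
  using compatible assms by (auto simp: compatible_chart_def)

lemma U_subset: "U \<subseteq> pts X"
  by (rule openin_subset[OF opens_U])

lemma inj: "inj_on \<psi> U"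
  using homeomorphic_imp_injective_map[OF homeo] U_subset by (simp add: Int_absorb1)

lemma \<xi>_\<psi> [simp]: "y \<in> U \<Longrightarrow> \<xi> (\<psi> y) = y"
  by (rule inv_into_f_f[OF inj])

lemma \<psi>_\<xi> [simp]: "p \<in> \<psi> ` U \<Longrightarrow> \<psi> (\<xi> p) = p"
  by (rule f_inv_into_f)

lemma \<xi>_in [simp]: "p \<in> \<psi> ` U \<Longrightarrow> \<xi> p \<in> U"
  by (rule inv_into_into)

lemma open_image: "opens X N \<Longrightarrow> open (\<psi> ` (U \<inter> N))"
proof -
  assume N: "opens X N"
  have "openin (subtopology (mtop X) U) (U \<inter> N)"
    using N by (auto simp: openin_subtopology)
  then have "openin (top_of_set (\<psi> ` U)) (\<psi> ` (U \<inter> N))"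
    using homeomorphic_imp_open_map[OF homeo] by (auto simp: open_map_def)
  then show ?thesis using open_range openin_open_eq by blast
qed

lemma open_image': "opens X N \<Longrightarrow> N \<subseteq> U \<Longrightarrow> open (\<psi> ` N)"
  using open_image[of N] by (simp add: Int_absorb1)

lemma open_preimage: "open S \<Longrightarrow> opens X {y \<in> U. \<psi> y \<in> S}"
proof -
  assume S: "open S"
  have "continuous_map (subtopology (mtop X) U) (top_of_set (\<psi> ` U)) \<psi>"
    by (rule homeomorphic_imp_continuous_map[OF homeo])
  then have "openin (subtopology (mtop X) U) {y \<in> topspace (subtopology (mtop X) U). \<psi> y \<in> \<psi> ` U \<inter> S}"
    using S open_range by (intro openin_continuous_map_preimage) (auto simp: openin_open)
  moreover have "{y \<in> topspace (subtopology (mtop X) U). \<psi> y \<in> \<psi> ` U \<inter> S} = {y \<in> U. \<psi> y \<in> S}"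
    using U_subset by auto
  ultimately show ?thesis
    using opens_U openin_trans_full by metis
qed

lemma smooth_on_chart:
  assumes "opens X N" "smooth_on X N f"
  shows "C_infinity (f \<circ> \<xi>) (\<psi> ` (U \<inter> N))"
proof (rule C_infinity_local)
  fix p assume "p \<in> \<psi> ` (U \<inter> N)"
  then obtain y where y: "y \<in> U" "y \<in> N" "p = \<psi> y" by blast
  obtain U' \<phi>' where c: "(U', \<phi>') \<in> atlas X" "y \<in> U'"
    using smooth_manifold_chart_at[OF manifold] y U_subset by blast
  interpret c: chart X U' \<phi>'
    by unfold_locales (rule manifold, rule atlas_compatible_chart[OF manifold c(1)])
  let ?T = "\<psi> ` (U \<inter> (U' \<inter> N))"
  have T: "open ?T" by (intro open_image openin_Int c.opens_U assms(1))
  have "C_infinity (\<lambda>p. (f \<circ> c.\<xi>) ((\<phi>' \<circ> \<xi>) p)) ?T"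
  proof (rule C_infinity_compose[OF T c.open_image[OF assms(1)]])
    show "C_infinity (f \<circ> c.\<xi>) (\<phi>' ` (U' \<inter> N))"
      using assms(2) c(1) by (auto simp: smooth_on_def)
    show "C_infinity (\<phi>' \<circ> \<xi>) ?T"
      by (rule C_infinity_subset[OF transition(1)[OF c(1)]]) auto
  qed auto
  then have "C_infinity (f \<circ> \<xi>) ?T"
    by (subst C_infinity_cong[OF T]) auto
  with T y c(2) show "\<exists>T. open T \<and> p \<in> T \<and> C_infinity (f \<circ> \<xi>) T"
    by (intro exI[of _ ?T]) auto
qed

lemma smooth_onI:
  assumes "opens X N" "N \<subseteq> U" "C_infinity h (\<psi> ` N)" "\<And>y. y \<in> N \<Longrightarrow> f y = h (\<psi> y)"
  shows "smooth_on X N f"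
  unfolding smooth_on_def
proof clarify
  fix U' \<phi>' assume c: "(U', \<phi>') \<in> atlas X"
  interpret c: chart X U' \<phi>'
    by unfold_locales (rule manifold, rule atlas_compatible_chart[OF manifold c])
  have "C_infinity (\<lambda>p. h ((\<psi> \<circ> c.\<xi>) p)) (\<phi>' ` (U' \<inter> N))"
  proof (rule C_infinity_compose[OF c.open_image[OF assms(1)] open_image'[OF assms(1,2)] _ assms(3)])
    show "C_infinity (\<psi> \<circ> c.\<xi>) (\<phi>' ` (U' \<inter> N))"
      by (rule C_infinity_subset[OF transition(2)[OF c]]) (use assms(2) in auto)
  qed auto
  then show "C_infinity (f \<circ> c.\<xi>) (\<phi>' ` (U' \<inter> N))"
    by (subst C_infinity_cong[OF c.open_image[OF assms(1)]]) (use assms(4) in auto)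
qed

lemma smooth_on_iff:
  assumes "opens X N" "N \<subseteq> U"
  shows "smooth_on X N f \<longleftrightarrow> C_infinity (f \<circ> \<xi>) (\<psi> ` N)"
proof
  show "smooth_on X N f \<Longrightarrow> C_infinity (f \<circ> \<xi>) (\<psi> ` N)"
    using smooth_on_chart[OF assms(1)] assms(2) by (simp add: Int_absorb1)
  show "C_infinity (f \<circ> \<xi>) (\<psi> ` N) \<Longrightarrow> smooth_on X N f"
    by (rule smooth_onI[OF assms]) (use assms(2) in auto)
qed

lemma smooth_near_chart:
  assumes "smooth_near X x f" "x \<in> U"
  obtains N where "opens X N" "x \<in> N" "N \<subseteq> U" "smooth_on X N f" "open (\<psi> ` N)"
    "C_infinity (f \<circ> \<xi>) (\<psi> ` N)"
proof -
  obtain N where N: "opens X N" "x \<in> N" "smooth_on X N f"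
    using assms(1) by (auto simp: smooth_near_def)
  have N': "opens X (U \<inter> N)" by (intro openin_Int opens_U N(1))
  show thesis
    by (rule that[OF N'])
      (use assms(2) N smooth_on_chart[OF N(1,3)] open_image[OF N(1)] in
        \<open>auto intro: smooth_on_subset\<close>)
qed

lemma smooth_nearI:
  assumes "opens X N" "x \<in> N" "N \<subseteq> U" "C_infinity h (\<psi> ` N)" "\<And>y. y \<in> N \<Longrightarrow> f y = h (\<psi> y)"
  shows "smooth_near X x f"
  using smooth_onI[OF assms(1,3,4,5)] assms(1,2) unfolding smooth_near_def by blast

lemma smooth_near_comp:
  assumes "open S" "C_infinity h S" "x \<in> U" "\<psi> x \<in> S"
  shows "smooth_near X x (\<lambda>y. h (\<psi> y))"
  by (rule smooth_nearI[OF open_preimage[OF assms(1)], where h = h])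
    (use assms in \<open>auto intro: C_infinity_subset\<close>)

lemma smooth_near_germ:
  assumes "opens X N" "x \<in> N" "x \<in> U" "\<And>y. y \<in> N \<Longrightarrow> f y = g y" "smooth_near X x f"
  shows "smooth_near X x g"
proof -
  obtain N' where N': "opens X N'" "x \<in> N'" "N' \<subseteq> U" "C_infinity (f \<circ> \<xi>) (\<psi> ` N')"
    using smooth_near_chart[OF assms(5,3)] by metis
  show ?thesis
    by (rule smooth_nearI[OF openin_Int[OF assms(1) N'(1)], where h = "f \<circ> \<xi>"])
      (use assms N' in \<open>auto intro: C_infinity_subset\<close>)
qed

section \<open>Tangent vectors and vector fields in coordinates\<close>

abbreviation cv :: "'a \<Rightarrow> 'e \<Rightarrow> 'a tvec" where "cv \<equiv> chart_vec X (U, \<psi>)"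

lemma cv_smooth: "smooth_near X y f \<Longrightarrow> cv y e f = fderiv (f \<circ> \<xi>) (\<psi> y) e"
  by (simp add: chart_vec_def)

lemma cv_germ:
  assumes "opens X N" "y \<in> N" "y \<in> U" "\<And>z. z \<in> N \<Longrightarrow> f z = g z"
  shows "cv y e f = cv y e g"
proof -
  have "smooth_near X y f \<longleftrightarrow> smooth_near X y g"
    using smooth_near_germ[OF assms(1-3), of f g] smooth_near_germ[OF assms(1-3), of g f] assms(4)
    by auto
  moreover have "fderiv (f \<circ> \<xi>) (\<psi> y) = fderiv (g \<circ> \<xi>) (\<psi> y)"
    by (rule frechet_derivative_eq_on_open[OF open_image[OF assms(1)]]) (use assms in auto)
  ultimately show ?thesis by (simp add: chart_vec_def)
qed

lemma cv_comp:
  assumes "open S" "C_infinity h S" "y \<in> U" "\<psi> y \<in> S"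
  shows "cv y e (\<lambda>z. h (\<psi> z)) = fderiv h (\<psi> y) e"
proof -
  have "fderiv ((\<lambda>z. h (\<psi> z)) \<circ> \<xi>) (\<psi> y) = fderiv h (\<psi> y)"
    by (rule frechet_derivative_eq_on_open[OF open_range]) (use assms in auto)
  then show ?thesis
    using cv_smooth[OF smooth_near_comp[OF assms]] by simp
qed

lemma has_derivative_chart:
  assumes "smooth_near X y f" "y \<in> U"
  shows "((f \<circ> \<xi>) has_derivative fderiv (f \<circ> \<xi>) (\<psi> y)) (at (\<psi> y))"
proof -
  obtain N where N: "opens X N" "y \<in> N" "N \<subseteq> U" "C_infinity (f \<circ> \<xi>) (\<psi> ` N)"
    using smooth_near_chart[OF assms] by metis
  then show ?thesis by (intro C_infinity_has_derivative) auto
qed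

lemma linear_cv: "y \<in> U \<Longrightarrow> linear (cv y)"
proof (rule linearI)
  assume y: "y \<in> U"
  have lin: "linear (fderiv (f \<circ> \<xi>) (\<psi> y))" if "smooth_near X y f" for f
    by (rule has_derivative_linear[OF has_derivative_chart[OF that y]])
  show "cv y (a + b) = cv y a + cv y b" for a b
    by (rule ext) (simp add: chart_vec_def linear_add[OF lin])
  show "cv y (r *\<^sub>R a) = r *\<^sub>R cv y a" for a r
    by (rule ext) (simp add: chart_vec_def scaleR_fun_def linear_cmul[OF lin])
qed

lemma cv_linear_functional: "y \<in> U \<Longrightarrow> linear l \<Longrightarrow> cv y e (\<lambda>z. l (\<psi> z)) = l e" for l :: "'e \<Rightarrow> real"
  using cv_comp[OF open_UNIV C_infinity_linear[OF open_UNIV], of l y e]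
    frechet_derivative_at[OF linear_imp_has_derivative, of l] by simp

text \<open>The inverse of \<open>cv y\<close> on the tangent space. Applying the vector to the
  coordinate functions yields its components without reference to the base point.\<close>

definition coord :: "'a tvec \<Rightarrow> 'e"
  where "coord v = (\<Sum>b\<in>Basis. v (\<lambda>z. \<psi> z \<bullet> b) *\<^sub>R b)"

lemma coord_cv [simp]: "y \<in> U \<Longrightarrow> coord (cv y e) = e"
proof -
  assume y: "y \<in> U"
  have "cv y e (\<lambda>z. \<psi> z \<bullet> b) = e \<bullet> b" for b
    using cv_linear_functional[OF y, of "\<lambda>p. p \<bullet> b" e] by (simp add: bounded_linear.linear bounded_linear_inner_left)
  then show ?thesis by (simp add: coord_def euclidean_representation)
qed

lemma cv_inj: "y \<in> U \<Longrightarrow> cv y a = cv y b \<Longrightarrow> a = b"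
  using coord_cv by metis

text \<open>The chain rule through the transition maps. Since \<open>tangent_space\<close> ranges
  over charts of the atlas, this is what lets a compatible chart describe the same vectors.\<close>

lemma cv_change:
  assumes "(U', \<phi>') \<in> atlas X" "y \<in> U" "y \<in> U'"
  shows "cv y e = chart_vec X (U', \<phi>') y (fderiv (\<phi>' \<circ> \<xi>) (\<psi> y) e)"
    and "chart_vec X (U', \<phi>') y e' = cv y (fderiv (\<psi> \<circ> inv_into U' \<phi>') (\<phi>' y) e')"
proof -
  interpret c: chart X U' \<phi>'
    by unfold_locales (rule manifold, rule atlas_compatible_chart[OF manifold assms(1)])
  have UU: "opens X (U \<inter> U')" by (intro openin_Int opens_U c.opens_U)
  have yy: "\<psi> y \<in> \<psi> ` (U \<inter> U')" "\<phi>' y \<in> \<phi>' ` (U \<inter> U')" using assms by auto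
  have "fderiv (f \<circ> \<xi>) (\<psi> y) e =
      fderiv (f \<circ> c.\<xi>) (\<phi>' y) (fderiv (\<phi>' \<circ> \<xi>) (\<psi> y) e)"
    if f: "smooth_near X y f" for f e
  proof -
    have "((\<lambda>p. (f \<circ> c.\<xi>) ((\<phi>' \<circ> \<xi>) p)) has_derivative (\<lambda>e. fderiv (f \<circ> c.\<xi>) (\<phi>' y)
        (fderiv (\<phi>' \<circ> \<xi>) (\<psi> y) e))) (at (\<psi> y))"
      using has_derivative_compose[OF C_infinity_has_derivative[OF transition(1)[OF assms(1)] yy(1)],
          of "f \<circ> c.\<xi>"] c.has_derivative_chart[OF f assms(3)] assms by simp
    moreover have "fderiv (f \<circ> \<xi>) (\<psi> y) =
        fderiv (\<lambda>p. (f \<circ> c.\<xi>) ((\<phi>' \<circ> \<xi>) p)) (\<psi> y)"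
      by (rule frechet_derivative_eq_on_open[OF open_image[OF c.opens_U] yy(1)]) auto
    ultimately show ?thesis using frechet_derivative_at by metis
  qed
  then show "cv y e = chart_vec X (U', \<phi>') y (fderiv (\<phi>' \<circ> \<xi>) (\<psi> y) e)"
    by (intro ext) (simp add: chart_vec_def)
  have "fderiv (f \<circ> c.\<xi>) (\<phi>' y) e =
      fderiv (f \<circ> \<xi>) (\<psi> y) (fderiv (\<psi> \<circ> c.\<xi>) (\<phi>' y) e)"
    if f: "smooth_near X y f" for f e
  proof -
    have "((\<lambda>p. (f \<circ> \<xi>) ((\<psi> \<circ> c.\<xi>) p)) has_derivative (\<lambda>e. fderiv (f \<circ> \<xi>) (\<psi> y)
        (fderiv (\<psi> \<circ> c.\<xi>) (\<phi>' y) e))) (at (\<phi>' y))"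
      using has_derivative_compose[OF C_infinity_has_derivative[OF transition(2)[OF assms(1)] yy(2)],
          of "f \<circ> \<xi>"] has_derivative_chart[OF f assms(2)] assms by simp
    moreover have "fderiv (f \<circ> c.\<xi>) (\<phi>' y) =
        fderiv (\<lambda>p. (f \<circ> \<xi>) ((\<psi> \<circ> c.\<xi>) p)) (\<phi>' y)"
      by (rule frechet_derivative_eq_on_open[OF c.open_image[OF opens_U]]) (use assms in auto)
    ultimately show ?thesis using frechet_derivative_at by metis
  qed
  then show "chart_vec X (U', \<phi>') y e' = cv y (fderiv (\<psi> \<circ> inv_into U' \<phi>') (\<phi>' y) e')"
    by (intro ext) (simp add: chart_vec_def)
qed

lemma tangent_space_eq: "y \<in> U \<Longrightarrow> tangent_space X y = range (cv y)"
proof -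
  assume y: "y \<in> U"
  obtain U' \<phi>' where c: "(U', \<phi>') \<in> atlas X" "y \<in> U'"
    using smooth_manifold_chart_at[OF manifold] y U_subset by blast
  have "cv y e \<in> tangent_space X y" for e
    unfolding tangent_space_def using cv_change(1)[OF c(1) y c(2), of e] c by force
  moreover have "v \<in> range (cv y)" if "v \<in> tangent_space X y" for v
    using that cv_change(2)[OF _ y] unfolding tangent_space_def by force
  ultimately show ?thesis by blast
qed

lemma cv_tangent [simp]: "y \<in> U \<Longrightarrow> cv y e \<in> tangent_space X y"
  by (simp add: tangent_space_eq)

lemma cv_coord: "y \<in> U \<Longrightarrow> v \<in> tangent_space X y \<Longrightarrow> cv y (coord v) = v"
  by (auto simp: tangent_space_eq)

lemma subspace_tangent_space: "y \<in> U \<Longrightarrow> subspace (tangent_space X y)"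
  using linear_subspace_image[OF linear_cv subspace_UNIV] by (simp add: tangent_space_eq)

lemma smooth_on_cv_field:
  assumes "opens X N" "N \<subseteq> U" "smooth_on X N f" "C_infinity a (\<psi> ` N)"
  shows "smooth_on X N (\<lambda>y. cv y (a (\<psi> y)) f)"
    and "\<And>y. y \<in> N \<Longrightarrow> cv y (a (\<psi> y)) f = fderiv (f \<circ> \<xi>) (\<psi> y) (a (\<psi> y))"
    and "C_infinity (\<lambda>p. fderiv (f \<circ> \<xi>) p (a p)) (\<psi> ` N)"
proof -
  show 1: "cv y (a (\<psi> y)) f = fderiv (f \<circ> \<xi>) (\<psi> y) (a (\<psi> y))" if "y \<in> N" for y
    by (rule cv_smooth) (use assms that in \<open>auto simp: smooth_near_def\<close>)
  show 2: "C_infinity (\<lambda>p. fderiv (f \<circ> \<xi>) p (a p)) (\<psi> ` N)"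
    using assms smooth_on_iff[OF assms(1,2)]
    by (intro C_infinity_frechet_apply open_image') auto
  show "smooth_on X N (\<lambda>y. cv y (a (\<psi> y)) f)"
    by (rule smooth_onI[OF assms(1,2) 2 1])
qed

lemma smooth_vf_cv:
  assumes "opens X N" "N \<subseteq> U" "C_infinity a (\<psi> ` N)" "\<And>y. y \<in> N \<Longrightarrow> V y = cv y (a (\<psi> y))"
  shows "smooth_vf X N V"
  unfolding smooth_vf_def
proof (intro conjI ballI allI impI)
  show "V y \<in> tangent_space X y" if "y \<in> N" for y using that assms(2,4) by auto
  show "smooth_on X N' (\<lambda>y. V y f)" if *: "opens X N' \<and> N' \<subseteq> N \<and> smooth_on X N' f" for N' f
  proof -
    have a: "C_infinity a (\<psi> ` N')" using * assms(3) by (auto intro: C_infinity_subset)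
    have N': "opens X N'" "N' \<subseteq> U" "smooth_on X N' f" using * assms by auto
    show ?thesis
      by (rule smooth_onI[OF N'(1,2) smooth_on_cv_field(3)[OF N' a]])
        (use * assms(4) smooth_on_cv_field(2)[OF N' a] in auto)
  qed
qed

lemma smooth_vf_near_cv:
  assumes "opens X N" "x \<in> N" "N \<subseteq> U" "C_infinity a (\<psi> ` N)" "\<And>y. y \<in> N \<Longrightarrow> V y = cv y (a (\<psi> y))"
  shows "smooth_vf_near X x V"
  unfolding smooth_vf_near_def using smooth_vf_cv[OF assms(1,3,4,5)] assms(1,2) by blast

lemma smooth_vf_const: "smooth_vf X U (\<lambda>y. cv y a)"
  by (rule smooth_vf_cv[where a = "\<lambda>p. a"]) (auto simp: opens_U)

lemma smooth_vf_near_const: "x \<in> U \<Longrightarrow> smooth_vf_near X x (\<lambda>y. cv y a)"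
  unfolding smooth_vf_near_def using smooth_vf_const opens_U by blast

text \<open>Smoothness of a field is tested on functions, and the coordinate functions are among
  them; they deliver the components.\<close>

lemma smooth_vf_coord:
  assumes "opens X N" "N \<subseteq> U" "smooth_vf X N V"
  shows "C_infinity (\<lambda>p. coord (V (\<xi> p))) (\<psi> ` N)"
    and "\<And>y. y \<in> N \<Longrightarrow> V y = cv y (coord (V (\<xi> (\<psi> y))))"
proof -
  have "smooth_on X N (\<lambda>y. V y (\<lambda>z. \<psi> z \<bullet> b))" for b
  proof -
    have "C_infinity (\<lambda>p. p \<bullet> b) (\<psi> ` N)"
      by (rule C_infinity_linear[OF open_image'[OF assms(1,2)]])
        (simp add: bounded_linear.linear bounded_linear_inner_left)
    then have "smooth_on X N (\<lambda>z. \<psi> z \<bullet> b)" by (rule smooth_onI[OF assms(1,2)]) simp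
    then show ?thesis using assms(1,3) by (simp add: smooth_vf_def)
  qed
  then have *: "C_infinity (\<lambda>p. V (\<xi> p) (\<lambda>z. \<psi> z \<bullet> b)) (\<psi> ` N)" for b
    using smooth_on_iff[OF assms(1,2)] by (simp add: o_def)
  show "C_infinity (\<lambda>p. coord (V (\<xi> p))) (\<psi> ` N)"
    unfolding coord_def
    by (rule C_infinity_sum[OF open_image'[OF assms(1,2)]],
        rule C_infinity_scaleR[OF open_image'[OF assms(1,2)] * C_infinity_const])
  show "V y = cv y (coord (V (\<xi> (\<psi> y))))" if "y \<in> N" for y
    using that assms cv_coord[of y "V y"] by (auto simp: smooth_vf_def)
qed

lemma smooth_vf_near_coord:
  assumes "smooth_vf_near X x V" "x \<in> U"
  obtains N a where "opens X N" "x \<in> N" "N \<subseteq> U" "C_infinity a (\<psi> ` N)" "open (\<psi> ` N)"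
    "\<And>y. y \<in> N \<Longrightarrow> V y = cv y (a (\<psi> y))" "smooth_vf X N V"
proof -
  obtain N where N: "opens X N" "x \<in> N" "smooth_vf X N V"
    using assms(1) by (auto simp: smooth_vf_near_def)
  have 1: "opens X (U \<inter> N)" "U \<inter> N \<subseteq> U" by (auto intro: openin_Int opens_U N(1))
  have 2: "smooth_vf X (U \<inter> N) V" using N(3) unfolding smooth_vf_def by blast
  show thesis
    by (rule that[OF 1(1) _ 1(2) smooth_vf_coord(1)[OF 1 2] open_image[OF N(1)] smooth_vf_coord(2)[OF 1 2] 2])
      (use assms N in auto)
qed

text \<open>The second term comes from the variation of the field and is the one that the covariant
  derivative cancels in the Hessian.\<close>

lemma cv_cv_field:
  assumes "opens X N" "x \<in> N" "N \<subseteq> U" "C_infinity a (\<psi> ` N)" "smooth_near X x f"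
    "\<And>y. y \<in> N \<Longrightarrow> W y = cv y (a (\<psi> y))"
  shows "cv x e (\<lambda>y. W y f) =
    hess (f \<circ> \<xi>) (\<psi> x) e (a (\<psi> x))
    + fderiv (f \<circ> \<xi>) (\<psi> x) (fderiv a (\<psi> x) e)"
proof -
  have x: "x \<in> U" using assms by auto
  obtain N' where N': "opens X N'" "x \<in> N'" "N' \<subseteq> U" "smooth_on X N' f"
    using smooth_near_chart[OF assms(5) x] by metis
  define K where "K = N \<inter> N'"
  have K: "opens X K" "x \<in> K" "K \<subseteq> U" "smooth_on X K f" "C_infinity a (\<psi> ` K)"
    using assms N' by (auto simp: K_def intro: openin_Int smooth_on_subset C_infinity_subset)
  note s = smooth_on_cv_field[OF K(1,3,4,5)]
  have "cv x e (\<lambda>y. W y f) = cv x e (\<lambda>y. fderiv (f \<circ> \<xi>) (\<psi> y) (a (\<psi> y)))"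
    by (rule cv_germ[OF K(1,2) x]) (use s(2) assms(6) in \<open>simp add: K_def\<close>)
  also have "\<dots> = fderiv (\<lambda>p. fderiv (f \<circ> \<xi>) p (a p)) (\<psi> x) e"
    using cv_comp[OF open_image'[OF K(1,3)] s(3) x] K(2) by simp
  finally show ?thesis
    using frechet_derivative_apply_field[OF open_image'[OF K(1,3)], of "f \<circ> \<xi>" a "\<psi> x" e]
      K smooth_on_iff[OF K(1,3)] by simp
qed

lemma cv_cv_const:
  assumes "x \<in> U" "smooth_near X x f"
  shows "cv x a (\<lambda>y. cv y b f) =
    hess (f \<circ> \<xi>) (\<psi> x) a b"
  using cv_cv_field[OF opens_U assms(1) order_refl C_infinity_const assms(2), of "\<lambda>y. cv y b" b a]
    linear_0[OF has_derivative_linear[OF has_derivative_chart[OF assms(2,1)]]] by simp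

end

section \<open>Connections in coordinates\<close>

locale connection_chart = chart X U \<psi>
  for X :: "('a, 'e::euclidean_space) mfd" and U \<psi> +
  fixes D :: "'a conn"
  assumes connection: "affine_connection X D"
begin

lemmas connection_clauses = connection[unfolded affine_connection_def]

lemma D_tangent: "x \<in> U \<Longrightarrow> smooth_vf_near X x W \<Longrightarrow> D x (cv x e) W \<in> tangent_space X x"
  using connection_clauses[THEN conjunct1, rule_format, of x "cv x e" W] U_subset by auto

lemma D_add_left: "x \<in> U \<Longrightarrow> smooth_vf_near X x W \<Longrightarrow>
    D x (r *\<^sub>R cv x e + s *\<^sub>R cv x e') W = r *\<^sub>R D x (cv x e) W + s *\<^sub>R D x (cv x e') W"
  using connection_clauses[THEN conjunct2, THEN conjunct1, rule_format, of x "cv x e" "cv x e'" W r s]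
    U_subset by auto

lemma D_add: "x \<in> U \<Longrightarrow> smooth_vf_near X x V \<Longrightarrow> smooth_vf_near X x W \<Longrightarrow>
    D x (cv x e) (\<lambda>y. V y + W y) = D x (cv x e) V + D x (cv x e) W"
  by (rule connection_clauses[THEN conjunct2, THEN conjunct2, THEN conjunct1, rule_format])
    (use U_subset in auto)

lemma D_Leibniz: "x \<in> U \<Longrightarrow> smooth_near X x f \<Longrightarrow> smooth_vf_near X x W \<Longrightarrow>
    D x (cv x e) (\<lambda>y. f y *\<^sub>R W y) = cv x e f *\<^sub>R W x + f x *\<^sub>R D x (cv x e) W"
  by (rule connection_clauses[THEN conjunct2, THEN conjunct2, THEN conjunct2, THEN conjunct1, rule_format])
    (use U_subset in auto)

lemma D_smooth: "opens X N \<Longrightarrow> smooth_vf X N V \<Longrightarrow> smooth_vf X N W \<Longrightarrow> smooth_vf X N (\<lambda>y. D y (V y) W)"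
  by (rule connection_clauses[THEN conjunct2, THEN conjunct2, THEN conjunct2, THEN conjunct2, rule_format])
    auto

text \<open>Multiplying by the indicator function of \<open>N\<close>, which is smooth near \<open>x\<close>, makes the two
  fields equal everywhere.\<close>

lemma D_germ:
  assumes "opens X N" "x \<in> N" "x \<in> U" "smooth_vf_near X x V" "smooth_vf_near X x W"
    "\<And>y. y \<in> N \<Longrightarrow> V y = W y"
  shows "D x (cv x e) V = D x (cv x e) W"
proof -
  define f :: "'a \<Rightarrow> real" where "f = (\<lambda>y. if y \<in> N then 1 else 0)"
  have f: "smooth_near X x f"
    by (rule smooth_nearI[OF openin_Int[OF assms(1) opens_U], where h = "\<lambda>_. 1"])
      (use assms in \<open>auto simp: f_def\<close>)
  have "(\<lambda>y. f y *\<^sub>R V y) = (\<lambda>y. f y *\<^sub>R W y)"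
    using assms(6) by (auto simp: f_def)
  then have "cv x e f *\<^sub>R V x + f x *\<^sub>R D x (cv x e) V = cv x e f *\<^sub>R W x + f x *\<^sub>R D x (cv x e) W"
    using D_Leibniz[OF assms(3) f assms(4)] D_Leibniz[OF assms(3) f assms(5)] by metis
  then show ?thesis using assms(2,6) by (simp add: f_def)
qed

text \<open>Additivity and the Leibniz rule, one summand at a time; the set \<open>B\<close> is
  arbitrary so that the induction can run, and \<open>Basis\<close> is the case of interest.\<close>

lemma D_basis_sum:
  assumes N: "opens X N" "x \<in> N" "N \<subseteq> U" and a: "C_infinity a (\<psi> ` N)" and "finite B"
  shows "D x (cv x e) (\<lambda>y. \<Sum>b\<in>B. (a (\<psi> y) \<bullet> b) *\<^sub>R cv y b) =
    (\<Sum>b\<in>B. (fderiv a (\<psi> x) e \<bullet> b) *\<^sub>R cv x b + (a (\<psi> x) \<bullet> b) *\<^sub>R D x (cv x e) (\<lambda>y. cv y b))"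
  using \<open>finite B\<close>
proof (induction B)
  case empty
  have x: "x \<in> U" using N by auto
  have z: "smooth_near X x (\<lambda>y. 0)"
    by (rule smooth_near_comp[where h = "\<lambda>_. 0", OF open_UNIV _ x]) auto
  \<comment> \<open>The zero field is written with the multiplier \<open>0\<close>, so that the
    Leibniz rule gives its covariant derivative.\<close>
  have "D x (cv x e) (\<lambda>y. 0 *\<^sub>R cv y 0) = cv x e (\<lambda>y. 0) *\<^sub>R cv x 0 + 0 *\<^sub>R D x (cv x e) (\<lambda>y. cv y 0)"
    by (rule D_Leibniz[OF x z smooth_vf_near_const[OF x]])
  then have "D x (cv x e) (\<lambda>y. 0) = 0"
    using linear_0[OF linear_cv[OF x]] by simp
  then show ?case by (simp add: zero_fun_def)
next
  case (insert b B)
  have x: "x \<in> U" using N by auto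
  note oN = open_image'[OF N(1,3)]
  have aC: "C_infinity (\<lambda>p. a p \<bullet> b) (\<psi> ` N)" for b
    by (rule C_infinity_inner[OF oN a C_infinity_const])
  have f: "smooth_near X x (\<lambda>y. a (\<psi> y) \<bullet> b)"
    by (rule smooth_nearI[OF N aC]) simp
  have vb: "smooth_vf_near X x (\<lambda>y. (a (\<psi> y) \<bullet> b) *\<^sub>R cv y b)"
    by (rule smooth_vf_near_cv[OF N, where a = "\<lambda>p. (a p \<bullet> b) *\<^sub>R b"])
      (use C_infinity_scaleR[OF oN aC C_infinity_const] N in \<open>auto simp: linear_cmul[OF linear_cv]\<close>)
  have vB: "smooth_vf_near X x (\<lambda>y. \<Sum>b\<in>B. (a (\<psi> y) \<bullet> b) *\<^sub>R cv y b)"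
  proof (rule smooth_vf_near_cv[OF N, where a = "\<lambda>p. \<Sum>b\<in>B. (a p \<bullet> b) *\<^sub>R b"])
    show "C_infinity (\<lambda>p. \<Sum>b\<in>B. (a p \<bullet> b) *\<^sub>R b) (\<psi> ` N)"
      by (rule C_infinity_sum[OF oN], rule C_infinity_scaleR[OF oN aC C_infinity_const])
    show "(\<Sum>b\<in>B. (a (\<psi> y) \<bullet> b) *\<^sub>R cv y b) = cv y (\<Sum>b\<in>B. (a (\<psi> y) \<bullet> b) *\<^sub>R b)" if "y \<in> N" for y
      using that N(3) by (auto simp: linear_sum[OF linear_cv] linear_cmul[OF linear_cv])
  qed
  have d: "cv x e (\<lambda>y. a (\<psi> y) \<bullet> b) = fderiv a (\<psi> x) e \<bullet> b"
  proof -
    have "((\<lambda>p. a p \<bullet> b) has_derivative (\<lambda>e. fderiv a (\<psi> x) e \<bullet> b)) (at (\<psi> x))"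
      using N(2) by (intro bounded_linear.has_derivative[OF bounded_linear_inner_left
          C_infinity_has_derivative[OF a]]) auto
    from frechet_derivative_at[OF this] show ?thesis
      using cv_comp[OF oN aC x] N(2) by (metis imageI)
  qed
  have "(\<lambda>y. \<Sum>b\<in>insert b B. (a (\<psi> y) \<bullet> b) *\<^sub>R cv y b) =
      (\<lambda>y. (a (\<psi> y) \<bullet> b) *\<^sub>R cv y b + (\<Sum>b\<in>B. (a (\<psi> y) \<bullet> b) *\<^sub>R cv y b))"
    using insert.hyps by (intro ext, subst sum.insert) auto
  then have "D x (cv x e) (\<lambda>y. \<Sum>b\<in>insert b B. (a (\<psi> y) \<bullet> b) *\<^sub>R cv y b) =
      D x (cv x e) (\<lambda>y. (a (\<psi> y) \<bullet> b) *\<^sub>R cv y b) + D x (cv x e) (\<lambda>y. \<Sum>b\<in>B. (a (\<psi> y) \<bullet> b) *\<^sub>R cv y b)"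
    using D_add[OF x vb vB] by simp
  also have "\<dots> = (fderiv a (\<psi> x) e \<bullet> b) *\<^sub>R cv x b + (a (\<psi> x) \<bullet> b) *\<^sub>R D x (cv x e) (\<lambda>y. cv y b)
      + (\<Sum>b\<in>B. (fderiv a (\<psi> x) e \<bullet> b) *\<^sub>R cv x b + (a (\<psi> x) \<bullet> b) *\<^sub>R D x (cv x e) (\<lambda>y. cv y b))"
    by (simp only: D_Leibniz[OF x f smooth_vf_near_const[OF x]] d insert.IH)
  finally show ?case by (simp only: sum.insert[OF insert.hyps])
qed

text \<open>The Christoffel symbols of the chart, as a map on coordinate vectors.\<close>

definition \<Gamma> :: "'a \<Rightarrow> 'e \<Rightarrow> 'e \<Rightarrow> 'e"
  where "\<Gamma> x a b = coord (D x (cv x a) (\<lambda>y. cv y b))"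

lemma cv_\<Gamma>: "x \<in> U \<Longrightarrow> cv x (\<Gamma> x a b) = D x (cv x a) (\<lambda>y. cv y b)"
  unfolding \<Gamma>_def by (intro cv_coord D_tangent smooth_vf_near_const)

lemma D_field:
  assumes N: "opens X N" "x \<in> N" "N \<subseteq> U" and a: "C_infinity a (\<psi> ` N)"
    and W: "\<And>y. y \<in> N \<Longrightarrow> W y = cv y (a (\<psi> y))"
  shows "D x (cv x e) W = cv x (fderiv a (\<psi> x) e + \<Gamma> x e (a (\<psi> x)))"
proof -
  have x: "x \<in> U" using N by auto
  \<comment> \<open>Used twice: for \<open>W\<close> itself, and for the field with constant
    coordinates \<open>a (\<psi> x)\<close>, which identifies the sum on the right as the
    Christoffel term.\<close>
  have expand: "D x (cv x e) V = cv x (fderiv c (\<psi> x) e)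
      + (\<Sum>b\<in>Basis. (c (\<psi> x) \<bullet> b) *\<^sub>R D x (cv x e) (\<lambda>y. cv y b))"
    if c: "C_infinity c (\<psi> ` N)" and V: "\<And>y. y \<in> N \<Longrightarrow> V y = cv y (c (\<psi> y))" for c V
  proof -
    have VS: "V y = (\<Sum>b\<in>Basis. (c (\<psi> y) \<bullet> b) *\<^sub>R cv y b)" if "y \<in> N" for y
      unfolding V[OF that] using that N(3) by (intro linear_eq_sum_Basis linear_cv) auto
    have s: "smooth_vf_near X x (\<lambda>y. \<Sum>b\<in>Basis. (c (\<psi> y) \<bullet> b) *\<^sub>R cv y b)"
      by (rule smooth_vf_near_cv[OF N c]) (use VS V in metis)
    have "D x (cv x e) V = D x (cv x e) (\<lambda>y. \<Sum>b\<in>Basis. (c (\<psi> y) \<bullet> b) *\<^sub>R cv y b)"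
      by (rule D_germ[OF N(1,2) x smooth_vf_near_cv[OF N c V] s VS])
    also have "\<dots> = (\<Sum>b\<in>Basis. (fderiv c (\<psi> x) e \<bullet> b) *\<^sub>R cv x b)
        + (\<Sum>b\<in>Basis. (c (\<psi> x) \<bullet> b) *\<^sub>R D x (cv x e) (\<lambda>y. cv y b))"
      by (subst D_basis_sum[OF N c]) (auto simp: sum.distrib)
    finally show ?thesis by (simp only: linear_eq_sum_Basis[OF linear_cv[OF x], symmetric])
  qed
  have "cv x (\<Gamma> x e (a (\<psi> x))) = (\<Sum>b\<in>Basis. (a (\<psi> x) \<bullet> b) *\<^sub>R D x (cv x e) (\<lambda>y. cv y b))"
    using expand[OF C_infinity_const refl, of "a (\<psi> x)"] linear_0[OF linear_cv[OF x]]
    by (simp add: cv_\<Gamma>[OF x])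
  then show ?thesis
    using expand[OF a W] by (simp add: linear_add[OF linear_cv[OF x]])
qed

lemma linear_\<Gamma>_right: "x \<in> U \<Longrightarrow> linear (\<Gamma> x e)"
proof -
  assume x: "x \<in> U"
  have *: "\<Gamma> x e a = (\<Sum>b\<in>Basis. (a \<bullet> b) *\<^sub>R \<Gamma> x e b)" for a
  proof -
    have "(\<lambda>y. \<Sum>b\<in>Basis. (a \<bullet> b) *\<^sub>R cv y b) y = cv y a" if "y \<in> U" for y
      using linear_eq_sum_Basis[OF linear_cv[OF that], of a] by simp
    then have s: "smooth_vf_near X x (\<lambda>y. \<Sum>b\<in>Basis. (a \<bullet> b) *\<^sub>R cv y b)"
      by (intro smooth_vf_near_cv[OF opens_U x order_refl, where a = "\<lambda>_. a"]) auto
    have "D x (cv x e) (\<lambda>y. cv y a) = D x (cv x e) (\<lambda>y. \<Sum>b\<in>Basis. (a \<bullet> b) *\<^sub>R cv y b)"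
      using linear_eq_sum_Basis[OF linear_cv, of _ a] 
      by (intro D_germ[OF opens_U x x smooth_vf_near_const[OF x] s]) auto
    also have "\<dots> = (\<Sum>b\<in>Basis. (a \<bullet> b) *\<^sub>R D x (cv x e) (\<lambda>y. cv y b))"
      using D_basis_sum[OF opens_U x order_refl C_infinity_const finite_Basis, of e a] by simp
    finally have "cv x (\<Gamma> x e a) = cv x (\<Sum>b\<in>Basis. (a \<bullet> b) *\<^sub>R \<Gamma> x e b)"
      using x by (simp add: cv_\<Gamma> linear_sum[OF linear_cv] linear_cmul[OF linear_cv])
    then show ?thesis by (rule cv_inj[OF x])
  qed
  show ?thesis
  proof (rule linearI)
    show "\<Gamma> x e (a + b) = \<Gamma> x e a + \<Gamma> x e b" for a b
      using *[of a] *[of b] *[of "a + b"] by (simp add: inner_add_left scaleR_left_distrib sum.distrib)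
    show "\<Gamma> x e (r *\<^sub>R a) = r *\<^sub>R \<Gamma> x e a" for r a
      using *[of a] *[of "r *\<^sub>R a"] by (simp add: scaleR_sum_right)
  qed
qed

lemma linear_\<Gamma>_left: "x \<in> U \<Longrightarrow> linear (\<lambda>e. \<Gamma> x e b)"
proof -
  assume x: "x \<in> U"
  have *: "\<Gamma> x (r *\<^sub>R e + s *\<^sub>R e') b = r *\<^sub>R \<Gamma> x e b + s *\<^sub>R \<Gamma> x e' b" for r s e e'
  proof (rule cv_inj[OF x])
    show "cv x (\<Gamma> x (r *\<^sub>R e + s *\<^sub>R e') b) = cv x (r *\<^sub>R \<Gamma> x e b + s *\<^sub>R \<Gamma> x e' b)"
      using D_add_left[OF x smooth_vf_near_const[OF x]] x
      by (simp add: cv_\<Gamma> linear_add[OF linear_cv] linear_cmul[OF linear_cv])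
  qed
  show ?thesis
    by (rule linearI) (use *[of 1 _ 1] *[of _ _ 0] in auto)
qed

lemma smooth_\<Gamma>: "C_infinity (\<lambda>p. \<Gamma> (\<xi> p) a b) (\<psi> ` U)"
  using smooth_vf_coord(1)[OF opens_U order_refl D_smooth[OF opens_U smooth_vf_const smooth_vf_const]]
  by (simp add: \<Gamma>_def)

text \<open>Whatever extension \<open>W\<close> the choice operator picks, the derivative of its
  coordinates occurs in both terms of the Hessian and cancels. Only the value at \<open>x\<close>
  survives, so the result does not depend on the extension.\<close>

lemma hessian_cv:
  assumes "x \<in> U" "smooth_near X x f"
  shows "hessian X D f x (cv x a) (cv x b) =
    hess (f \<circ> \<xi>) (\<psi> x) a b
    - fderiv (f \<circ> \<xi>) (\<psi> x) (\<Gamma> x a b)"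
proof -
  define W where "W = (SOME W. smooth_vf_near X x W \<and> W x = cv x b)"
  have "smooth_vf_near X x W \<and> W x = cv x b"
    unfolding W_def
    \<comment> \<open>The coordinate field with constant components \<open>b\<close> witnesses that
      the choice is not empty.\<close>
    by (rule someI[of "\<lambda>W. smooth_vf_near X x W \<and> W x = cv x b" "\<lambda>y. cv y b"])
      (simp add: smooth_vf_near_const[OF assms(1)])
  then have W: "smooth_vf_near X x W" "W x = cv x b" by auto
  obtain N c where N: "opens X N" "x \<in> N" "N \<subseteq> U" "C_infinity c (\<psi> ` N)" "open (\<psi> ` N)"
    "\<And>y. y \<in> N \<Longrightarrow> W y = cv y (c (\<psi> y))"
    using smooth_vf_near_coord[OF W(1) assms(1)] by metis
  have cb: "c (\<psi> x) = b"
    using cv_inj[OF assms(1)] W(2) N(2,6) by metis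
  have "cv x a (\<lambda>y. W y f) = hess (f \<circ> \<xi>) (\<psi> x) a b
      + fderiv (f \<circ> \<xi>) (\<psi> x) (fderiv c (\<psi> x) a)"
    using cv_cv_field[OF N(1-4) assms(2) N(6), where e = a] cb by simp
  moreover have "D x (cv x a) W f = fderiv (f \<circ> \<xi>) (\<psi> x) (fderiv c (\<psi> x) a)
      + fderiv (f \<circ> \<xi>) (\<psi> x) (\<Gamma> x a b)"
    using D_field[OF N(1-4,6)] cb linear_add[OF has_derivative_linear[OF has_derivative_chart[OF assms(2,1)]]]
    by (simp add: cv_smooth[OF assms(2)])
  ultimately show ?thesis by (simp add: hessian_def W_def Let_def)
qed

end

locale levi_civita_chart = chart X U \<psi>
  for X :: "('a, 'e::euclidean_space) mfd" and U \<psi> +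
  fixes g :: "'a form2" and D :: "'a conn"
  assumes levi_civita: "levi_civita X g D"
begin

sublocale connection_chart X U \<psi> D
  using levi_civita by unfold_locales (simp add: levi_civita_def)

lemma lie_bracket_coordinate_fields:
  assumes "x \<in> U"
  shows "lie_bracket X (\<lambda>y. cv y a) (\<lambda>y. cv y b) x = 0"
proof (rule ext)
  fix f
  show "lie_bracket X (\<lambda>y. cv y a) (\<lambda>y. cv y b) x f = 0 f"
  proof (cases "smooth_near X x f")
    case True
    obtain N where "opens X N" "x \<in> N" "open (\<psi> ` N)" "C_infinity (f \<circ> \<xi>) (\<psi> ` N)"
      using smooth_near_chart[OF True assms] by metis
    then show ?thesis
      using second_derivative_symmetric[of "\<psi> ` N" "f \<circ> \<xi>" "\<psi> x" b a] True
      by (simp add: lie_bracket_def cv_cv_const[OF assms True])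
  qed (simp add: lie_bracket_def)
qed

lemma \<Gamma>_symmetric: "x \<in> U \<Longrightarrow> \<Gamma> x a b = \<Gamma> x b a"
proof -
  assume x: "x \<in> U"
  have "D x (cv x a) (\<lambda>y. cv y b) - D x (cv x b) (\<lambda>y. cv y a) = 0"
    using levi_civita x U_subset smooth_vf_near_const[OF x] lie_bracket_coordinate_fields[OF x, of a b]
    unfolding levi_civita_def by (metis subsetD)
  then have "cv x (\<Gamma> x a b) = cv x (\<Gamma> x b a)"
    using x by (simp add: cv_\<Gamma>)
  then show ?thesis by (rule cv_inj[OF x])
qed

lemma metric_compatible:
  assumes "x \<in> U"
  shows "cv x a (\<lambda>y. g y (cv y b) (cv y c)) = g x (cv x (\<Gamma> x a b)) (cv x c) + g x (cv x b) (cv x (\<Gamma> x a c))"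
proof -
  have "cv x a (\<lambda>y. g y (cv y b) (cv y c)) =
      g x (D x (cv x a) (\<lambda>y. cv y b)) (cv x c) + g x (cv x b) (D x (cv x a) (\<lambda>y. cv y c))"
    using levi_civita assms U_subset smooth_vf_near_const[OF assms] cv_tangent[OF assms]
    unfolding levi_civita_def by blast
  then show ?thesis using assms by (simp add: cv_\<Gamma>)
qed

text \<open>For coordinate fields the brackets vanish, so three uses of metric compatibility and the
  symmetry of \<open>\<Gamma>\<close> leave derivatives of metric coefficients only. The connection
  is thus determined by the metric, which allows comparing \<open>X\<close> with
  \<open>M\<close>.\<close>

lemma Koszul:
  assumes "x \<in> U" "\<And>v w. v \<in> tangent_space X x \<Longrightarrow> w \<in> tangent_space X x \<Longrightarrow> g x v w = g x w v"
  shows "2 * g x (cv x (\<Gamma> x a b)) (cv x c) = cv x a (\<lambda>y. g y (cv y b) (cv y c))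
    + cv x b (\<lambda>y. g y (cv y c) (cv y a)) - cv x c (\<lambda>y. g y (cv y a) (cv y b))"
proof -
  have s: "g x (cv x p) (cv x q) = g x (cv x q) (cv x p)" for p q
    using assms by simp
  show ?thesis
    unfolding metric_compatible[OF assms(1)]
    using \<Gamma>_symmetric[OF assms(1)] s
    by (simp add: s[of "\<Gamma> x _ _"] \<Gamma>_symmetric[OF assms(1), of c a] \<Gamma>_symmetric[OF assms(1), of c b] \<Gamma>_symmetric[OF assms(1), of b a])
qed

end

section \<open>Submanifolds and adapted charts\<close>

lemma opens_submanifold:
  assumes "submanifold X M" "opens X N"
  shows "opens M (N \<inter> pts M)"
proof -
  have "mtop M = subtopology (mtop X) (pts M)" using assms(1) by (simp add: submanifold_def)
  then show ?thesis using assms(2) openin_subtopology by metis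
qed

lemma opens_submanifoldE:
  assumes "submanifold X M" "opens M K"
  obtains N where "opens X N" "K = N \<inter> pts M"
proof -
  have "mtop M = subtopology (mtop X) (pts M)" using assms(1) by (simp add: submanifold_def)
  then show ?thesis using assms(2) openin_subtopology that by metis
qed

lemma submanifold_transition:
  assumes "submanifold X M" "(U, \<phi>) \<in> atlas M" "(U', \<phi>') \<in> atlas X"
  shows "C_infinity (\<phi>' \<circ> inv_into U \<phi>) (\<phi> ` (U \<inter> U'))"
  using assms unfolding submanifold_def by fast

lemma smooth_near_submanifold:
  assumes X: "smooth_manifold X" and M: "submanifold X M" and "x \<in> pts M" "smooth_near X x f"
  shows "smooth_near M x f"
proof -
  have mM: "smooth_manifold M" and sub: "pts M \<subseteq> pts X" using M by (auto simp: submanifold_def)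
  obtain U \<phi> where m: "(U, \<phi>) \<in> atlas M" "x \<in> U" using smooth_manifold_chart_at[OF mM assms(3)] .
  obtain U' \<phi>' where c: "(U', \<phi>') \<in> atlas X" "x \<in> U'"
    using smooth_manifold_chart_at[OF X] assms(3) sub by blast
  interpret m: chart M U \<phi> by unfold_locales (rule mM, rule atlas_compatible_chart[OF mM m(1)])
  interpret c: chart X U' \<phi>' by unfold_locales (rule X, rule atlas_compatible_chart[OF X c(1)])
  obtain N where N: "opens X N" "x \<in> N" "N \<subseteq> U'" "open (\<phi>' ` N)" "C_infinity (f \<circ> c.\<xi>) (\<phi>' ` N)"
    using c.smooth_near_chart[OF assms(4) c(2)] by metis
  define K where "K = U \<inter> (N \<inter> pts M)"
  have K: "opens M K" "x \<in> K" "K \<subseteq> U"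
    unfolding K_def using m N assms(3) m.opens_U opens_submanifold[OF M N(1)] by auto
  have "C_infinity (\<lambda>p. (f \<circ> c.\<xi>) ((\<phi>' \<circ> m.\<xi>) p)) (\<phi> ` K)"
  proof (rule C_infinity_compose[OF m.open_image'[OF K(1,3)] N(4) _ N(5)])
    show "C_infinity (\<phi>' \<circ> m.\<xi>) (\<phi> ` K)"
      by (rule C_infinity_subset[OF submanifold_transition[OF M m(1) c(1)]])
        (use N(3) in \<open>auto simp: K_def\<close>)
  qed (auto simp: K_def)
  then show ?thesis
    by (rule m.smooth_nearI[OF K]) (use N(3) in \<open>auto simp: K_def\<close>)
qed

text \<open>\<open>push\<close> retains just the functions that are smooth near \<open>x\<close> in
  \<open>X\<close>, and for these the chain rule through the chart of \<open>X\<close> applies; on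
  all others both sides are zero.\<close>

lemma push_chart_vec:
  assumes M: "submanifold X M" and X: "chart X V \<psi>" and m: "chart M U \<phi>"
    and x: "x \<in> U" "x \<in> V"
    and B: "((\<psi> \<circ> inv_into U \<phi>) has_derivative B) (at (\<phi> x))"
  shows "push X x (chart_vec M (U, \<phi>) x a) = chart_vec X (V, \<psi>) x (B a)"
proof (rule ext)
  fix f
  interpret c: chart X V \<psi> by (rule X)
  interpret m: chart M U \<phi> by (rule m)
  have xM: "x \<in> pts M" using x m.U_subset by auto
  show "push X x (m.cv x a) f = c.cv x (B a) f"
  proof (cases "smooth_near X x f")
    case True
    have "m.cv x a f = fderiv (f \<circ> m.\<xi>) (\<phi> x) a"
      by (rule m.cv_smooth[OF smooth_near_submanifold[OF c.manifold M xM True]])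
    also have "fderiv (f \<circ> m.\<xi>) (\<phi> x) =
        fderiv (\<lambda>p. (f \<circ> c.\<xi>) ((\<psi> \<circ> m.\<xi>) p)) (\<phi> x)"
      by (rule frechet_derivative_eq_on_open[OF m.open_image[OF opens_submanifold[OF M c.opens_U]]])
        (use x xM in auto)
    also have "\<dots> = (\<lambda>a. fderiv (f \<circ> c.\<xi>) (\<psi> x) (B a))"
    proof (rule frechet_derivative_at[symmetric])
      have "((f \<circ> c.\<xi>) has_derivative fderiv (f \<circ> c.\<xi>) (\<psi> x)) (at ((\<psi> \<circ> m.\<xi>) (\<phi> x)))"
        using c.has_derivative_chart[OF True x(2)] x by simp
      from has_derivative_compose[OF B this]
      show "((\<lambda>p. (f \<circ> c.\<xi>) ((\<psi> \<circ> m.\<xi>) p)) has_derivative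
          (\<lambda>a. fderiv (f \<circ> c.\<xi>) (\<psi> x) (B a))) (at (\<phi> x))" .
    qed
    finally show ?thesis using True by (simp add: push_def c.cv_smooth)
  qed (simp add: push_def chart_vec_def)
qed

text \<open>The local normal form of an immersion. \<open>A\<close> is the derivative at
  \<open>x\<close> of the inclusion \<open>\<Psi>\<close> in coordinates and \<open>P\<close> a left
  inverse of it; the new chart undoes a local diffeomorphism \<open>F\<close> that maps
  \<open>A s\<close> to \<open>\<Psi> s\<close>, so \<open>M\<close> becomes the fixed set of the
  projection \<open>p \<mapsto> A (P p)\<close>.\<close>

lemma adapted_chart_exists:
  fixes X :: "('a, 'e::euclidean_space) mfd" and M :: "('a, 'f::euclidean_space) mfd"
  assumes X: "smooth_manifold X" and M: "submanifold X M" and x: "x \<in> pts M"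
  obtains V \<psi> U \<phi> A P where
    "(U, \<phi>) \<in> atlas M" "x \<in> U" "compatible_chart X V \<psi>" "x \<in> V" "linear A" "linear P" "\<And>s. P (A s) = s"
    "\<And>y. y \<in> V \<Longrightarrow> y \<in> pts M \<longleftrightarrow> \<psi> y = A (P (\<psi> y))"
    "\<And>y. y \<in> V \<Longrightarrow> y \<in> pts M \<Longrightarrow> y \<in> U \<and> \<phi> y = P (\<psi> y)"
proof -
  have mM: "smooth_manifold M" and sub: "pts M \<subseteq> pts X" using M by (auto simp: submanifold_def)
  obtain U \<phi> where m: "(U, \<phi>) \<in> atlas M" "x \<in> U" using smooth_manifold_chart_at[OF mM x] .
  obtain U0 \<phi>0 where c: "(U0, \<phi>0) \<in> atlas X" "x \<in> U0"
    using smooth_manifold_chart_at[OF X] x sub by blast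
  interpret m: chart M U \<phi> by unfold_locales (rule mM, rule atlas_compatible_chart[OF mM m(1)])
  interpret c: chart X U0 \<phi>0 by unfold_locales (rule X, rule atlas_compatible_chart[OF X c(1)])
  define \<Psi> where "\<Psi> = \<phi>0 \<circ> m.\<xi>"
  define S where "S = \<phi> ` (U \<inter> U0)"
  have "S = \<phi> ` (U \<inter> (U0 \<inter> pts M))" using m.U_subset by (auto simp: S_def)
  then have S: "open S" using m.open_image[OF opens_submanifold[OF M c.opens_U]] by simp
  have s0: "\<phi> x \<in> S" using m c by (auto simp: S_def)
  have \<Psi>: "C_infinity \<Psi> S"
    unfolding \<Psi>_def S_def by (rule submanifold_transition[OF M m(1) c(1)])
  define A where "A = fderiv \<Psi> (\<phi> x)"
  have dA: "(\<Psi> has_derivative A) (at (\<phi> x))"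
    unfolding A_def by (rule C_infinity_has_derivative[OF \<Psi> s0])
  have A: "linear A" by (rule has_derivative_linear[OF dA])
  \<comment> \<open>In coordinates \<open>push X x\<close> is the linear map \<open>A\<close>, so
    the immersion condition is its injectivity.\<close>
  have "inj A"
  proof (rule injI)
    fix a b assume "A a = A b"
    then have "push X x (m.cv x a) = push X x (m.cv x b)"
      using push_chart_vec[OF M c.chart_axioms m.chart_axioms m(2) c(2) dA[unfolded \<Psi>_def]] by simp
    moreover have "inj_on (push X x) (tangent_space M x)" using M x by (simp add: submanifold_def)
    ultimately have "m.cv x a = m.cv x b" using m(2) by (auto dest: inj_onD)
    then show "a = b" by (rule m.cv_inj[OF m(2)])
  qed
  then obtain P where P: "linear P" "P \<circ> A = id"
    using linear_injective_left_inverse[OF A] by blast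
  then have PA [simp]: "P (A s) = s" for s by (metis comp_apply id_apply)
  \<comment> \<open>On \<open>range A\<close> the map parametrizes \<open>M\<close>; across it, it
    is a translation by the complementary part \<open>p - A (P p)\<close>. This makes its derivative
    at \<open>A (\<phi> x)\<close> the identity.\<close>
  define F where "F = (\<lambda>p. \<Psi> (P p) + (p - A (P p)))"
  have contP: "continuous_on UNIV P" using P(1) by (simp add: linear_continuous_on linear_conv_bounded_linear)
  define O1 where "O1 = P -` S"
  have O1: "open O1" unfolding O1_def by (rule open_vimage[OF S contP])
  have F: "C_infinity F O1"
    unfolding F_def
  proof (intro C_infinity_add[OF O1] C_infinity_diff[OF O1] C_infinity_ident[OF O1])
    show "C_infinity (\<lambda>p. \<Psi> (P p)) O1"
      by (rule C_infinity_compose[OF O1 S _ \<Psi> C_infinity_linear[OF O1 P(1)]]) (auto simp: O1_def)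
    show "C_infinity (\<lambda>p. A (P p)) O1"
      using C_infinity_linear[OF O1 linear_compose[OF P(1) A]] by (simp add: o_def)
  qed
  have p0: "A (\<phi> x) \<in> O1" using s0 by (simp add: O1_def)
  have dF: "fderiv F (A (\<phi> x)) e = e" for e
  proof -
    have dP: "(P has_derivative P) (at q)" "(A has_derivative A) (at s)" for q s
      by (rule linear_imp_has_derivative, fact)+
    have "(\<Psi> has_derivative A) (at (P (A (\<phi> x))))" using dA by simp
    from has_derivative_add[OF has_derivative_compose[OF dP(1) this]
        has_derivative_diff[OF has_derivative_ident has_derivative_compose[OF dP]]]
    have "(F has_derivative (\<lambda>e. A (P e) + (e - A (P e)))) (at (A (\<phi> x)))"
      unfolding F_def .
    from frechet_derivative_at[OF this, symmetric] show ?thesis by simp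
  qed
  obtain W1 W2 g where W: "open W1" "W1 \<subseteq> O1" "A (\<phi> x) \<in> W1" "open W2" "homeomorphism W1 W2 F g" "C_infinity g W2"
    using smooth_inverse_function[OF O1 F p0 dF] by metis
  have gF: "g (F p) = p" if "p \<in> W1" for p using W(5) that by (auto simp: homeomorphism_def)
  have Fg: "F (g q) = q" "g q \<in> W1" if "q \<in> W2" for q using W(5) that by (auto simp: homeomorphism_def)
  have FW: "F p \<in> W2" if "p \<in> W1" for p using W(5) that by (auto simp: homeomorphism_def)
  have FA: "F (A s) = \<Psi> s" for s by (simp add: F_def)
  have contA: "continuous_on UNIV A" using A by (simp add: linear_continuous_on linear_conv_bounded_linear)
  \<comment> \<open>Here the subspace topology of \<open>M\<close> is used: within \<open>N\<close>,
    the set \<open>M\<close> consists only of points that \<open>\<phi>\<close> parametrizes near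
    \<open>x\<close>, so no other sheet of \<open>M\<close> returns to the chart.\<close>
  obtain N where N: "opens X N" "{y \<in> U. \<phi> y \<in> A -` W1} = N \<inter> pts M"
    using opens_submanifoldE[OF M m.open_preimage[OF open_vimage[OF W(1) contA]]] by metis
  define V where "V = {y \<in> U0. \<phi>0 y \<in> W2} \<inter> N"
  define \<psi> where "\<psi> = g \<circ> \<phi>0"
  have V: "opens X V" unfolding V_def by (intro openin_Int c.open_preimage W(4) N(1))
  have VU0: "V \<subseteq> U0" by (auto simp: V_def)
  have F\<psi>: "F (\<psi> y) = \<phi>0 y" "\<psi> y \<in> W1" if "y \<in> V" for y
    using that Fg by (auto simp: \<psi>_def V_def)
  have inj\<psi>: "inj_on \<psi> V"
    by (rule inj_onI) (metis F\<psi>(1) VU0 c.inj inj_onD subsetD)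
  have img: "open (\<psi> ` K)" if K: "opens X K" "K \<subseteq> V" for K
  proof -
    have "\<psi> ` K = W1 \<inter> F -` (\<phi>0 ` K)"
    proof (intro equalityI subsetI)
      fix p assume "p \<in> W1 \<inter> F -` (\<phi>0 ` K)"
      then obtain y where y: "p \<in> W1" "y \<in> K" "F p = \<phi>0 y" by auto
      then have "\<psi> y = p" using gF by (metis \<psi>_def comp_apply)
      then show "p \<in> \<psi> ` K" using y by auto
    qed (use F\<psi> K in auto)
    moreover have "open (W1 \<inter> F -` (\<phi>0 ` K))"
      using W(5) by (intro continuous_open_preimage W(1) c.open_image' K(1)) (use K VU0 in \<open>auto simp: homeomorphism_def\<close>)
    ultimately show ?thesis by simp
  qed
  have compat: "compatible_chart X V \<psi>"
    unfolding compatible_chart_def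
  proof (intro conjI V img[OF V order_refl])
    have h1: "homeomorphic_map (subtopology (mtop X) V) (top_of_set (\<phi>0 ` V)) \<phi>0"
    proof -
      have "\<phi>0 ` (topspace (subtopology (mtop X) U0) \<inter> V) = topspace (top_of_set (\<phi>0 ` U0)) \<inter> \<phi>0 ` V"
        using VU0 c.U_subset by auto
      from homeomorphic_map_subtopologies[OF c.homeo this] show ?thesis
        using VU0 by (simp add: subtopology_subtopology Int_absorb1 image_mono)
    qed
    have "homeomorphism (\<phi>0 ` V) (\<psi> ` V) g F"
      by (rule homeomorphism_of_subsets[OF homeomorphism_symD[OF W(5)]])
        (auto simp: V_def \<psi>_def image_comp)
    then have h2: "homeomorphic_map (top_of_set (\<phi>0 ` V)) (top_of_set (\<psi> ` V)) g"
      unfolding homeomorphic_map_maps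
      by (intro exI[of _ F]) (auto simp: homeomorphic_maps_def homeomorphism_def)
    show "homeomorphic_map (subtopology (mtop X) V) (top_of_set (\<psi> ` V)) \<psi>"
      unfolding \<psi>_def by (rule homeomorphic_map_compose[OF h1 h2[unfolded \<psi>_def]])
    have "C_infinity (\<phi>' \<circ> inv_into V \<psi>) (\<psi> ` (V \<inter> U'))" and
      "C_infinity (\<psi> \<circ> inv_into U' \<phi>') (\<phi>' ` (V \<inter> U'))" if a: "(U', \<phi>') \<in> atlas X" for U' \<phi>'
    proof -
      interpret d: chart X U' \<phi>' by unfold_locales (rule X, rule atlas_compatible_chart[OF X a])
      have VU': "opens X (V \<inter> U')" by (intro openin_Int V d.opens_U)
      have o1: "open (\<psi> ` (V \<inter> U'))" by (rule img[OF VU']) auto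
      have "C_infinity (\<lambda>p. (\<phi>' \<circ> c.\<xi>) (F p)) (\<psi> ` (V \<inter> U'))"
        by (rule C_infinity_compose[OF o1 c.open_image[OF d.opens_U] _ c.transition(1)[OF a] C_infinity_subset[OF F]])
          (use VU0 F\<psi> W(2) in auto)
      moreover have "(\<phi>' \<circ> inv_into V \<psi>) p = (\<phi>' \<circ> c.\<xi>) (F p)" if "p \<in> \<psi> ` (V \<inter> U')" for p
        using that F\<psi> VU0 by (auto simp: inv_into_f_f[OF inj\<psi>])
      ultimately show "C_infinity (\<phi>' \<circ> inv_into V \<psi>) (\<psi> ` (V \<inter> U'))"
        using C_infinity_cong[OF o1] by metis
      have o2: "open (\<phi>' ` (V \<inter> U'))" by (rule d.open_image'[OF VU']) auto
      have "C_infinity (\<lambda>p. g ((\<phi>0 \<circ> d.\<xi>) p)) (\<phi>' ` (V \<inter> U'))"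
        by (rule C_infinity_compose[OF o2 W(4) _ W(6) C_infinity_subset[OF c.transition(2)[OF a]]])
          (auto simp: V_def)
      then show "C_infinity (\<psi> \<circ> inv_into U' \<phi>') (\<phi>' ` (V \<inter> U'))"
        by (simp add: \<psi>_def o_def)
    qed
    then show "\<forall>(U', \<phi>')\<in>atlas X. C_infinity (\<phi>' \<circ> inv_into V \<psi>) (\<psi> ` (V \<inter> U')) \<and>
        C_infinity (\<psi> \<circ> inv_into U' \<phi>') (\<phi>' ` (V \<inter> U'))"
      by blast
  qed
  have onM: "y \<in> U \<and> \<psi> y = A (\<phi> y)" if y: "y \<in> V" "y \<in> pts M" for y
  proof -
    have "y \<in> {y \<in> U. \<phi> y \<in> A -` W1}" using y unfolding N(2) by (auto simp: V_def)
    then have *: "y \<in> U" "A (\<phi> y) \<in> W1" by auto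
    have "\<psi> y = g (F (A (\<phi> y)))" using *(1) by (simp add: \<psi>_def FA \<Psi>_def)
    then show ?thesis using * gF by simp
  qed
  show thesis
  proof (rule that[OF m compat _ A P(1) PA])
    have "x \<in> {y \<in> U. \<phi> y \<in> A -` W1}" using m W(3) by auto
    moreover have "\<phi>0 x = F (A (\<phi> x))" using m(2) by (simp add: FA \<Psi>_def)
    ultimately show "x \<in> V" using c(2) FW[OF W(3)] unfolding N(2) by (simp add: V_def)
    show "y \<in> pts M \<longleftrightarrow> \<psi> y = A (P (\<psi> y))" if y: "y \<in> V" for y
    proof
      \<comment> \<open>Such a \<open>y\<close> has the same image under \<open>\<phi>0\<close> as
        the point \<open>z\<close> of \<open>M\<close> with coordinate \<open>P (\<psi> y)\<close>,
        and \<open>\<phi>0\<close> is injective.\<close>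
      assume *: "\<psi> y = A (P (\<psi> y))"
      have "P (\<psi> y) \<in> S" using F\<psi>(2)[OF y] W(2) by (auto simp: O1_def)
      then obtain z where z: "P (\<psi> y) = \<phi> z" "z \<in> U" "z \<in> U0" by (auto simp: S_def)
      have "\<phi>0 y = F (A (\<phi> z))" using F\<psi>(1)[OF y] * z(1) by simp
      also have "\<dots> = \<phi>0 z" using z by (simp add: FA \<Psi>_def)
      finally have "y = z" using c.inj z VU0 y by (auto dest: inj_onD)
      then show "y \<in> pts M" using z m.U_subset by auto
    qed (use onM[OF y] in simp)
    show "y \<in> U \<and> \<phi> y = P (\<psi> y)" if "y \<in> V" "y \<in> pts M" for y
      using onM[OF that] by simp
  qed
qed

section \<open>Traces\<close>

text \<open>The vector-valued counterpart of \<open>bilinear_on\<close>; the second fundamental form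
  requires it.\<close>

definition bilinear_map_on :: "'v::real_vector set \<Rightarrow> ('v \<Rightarrow> 'v \<Rightarrow> 'b::real_vector) \<Rightarrow> bool"
  where "bilinear_map_on W B \<longleftrightarrow>
    (\<forall>u\<in>W. \<forall>v\<in>W. \<forall>x\<in>W. \<forall>a b.
      B (a *\<^sub>R u + b *\<^sub>R v) x = a *\<^sub>R B u x + b *\<^sub>R B v x \<and>
      B x (a *\<^sub>R u + b *\<^sub>R v) = a *\<^sub>R B x u + b *\<^sub>R B x v)"

lemma bilinear_on_iff: "bilinear_on W B \<longleftrightarrow> bilinear_map_on W B"
  by (simp add: bilinear_on_def bilinear_map_on_def)

lemma bilinear_map_on_subset: "bilinear_map_on W B \<Longrightarrow> W' \<subseteq> W \<Longrightarrow> bilinear_map_on W' B"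
  unfolding bilinear_map_on_def by blast

lemma linear_on_sum:
  fixes f :: "'v::real_vector \<Rightarrow> 'b::real_vector"
  assumes W: "subspace W"
    and f: "\<And>u v a b. u \<in> W \<Longrightarrow> v \<in> W \<Longrightarrow> f (a *\<^sub>R u + b *\<^sub>R v) = a *\<^sub>R f u + b *\<^sub>R f v"
    and v: "\<And>i. i \<in> I \<Longrightarrow> v i \<in> W"
  shows "f (\<Sum>i\<in>I. a i *\<^sub>R v i) = (\<Sum>i\<in>I. a i *\<^sub>R f (v i))"
proof -
  have z: "f 0 = 0" using f[of 0 0 0 0] subspace_0[OF W] by simp
  show ?thesis
    using v
  proof (induction I rule: infinite_finite_induct)
    case (insert i I)
    have "(\<Sum>i\<in>I. a i *\<^sub>R v i) \<in> W"
      using insert.prems by (intro subspace_sum[OF W] subspace_scale[OF W]) auto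
    then have "f (a i *\<^sub>R v i + 1 *\<^sub>R (\<Sum>i\<in>I. a i *\<^sub>R v i)) = a i *\<^sub>R f (v i) + 1 *\<^sub>R f (\<Sum>i\<in>I. a i *\<^sub>R v i)"
      using insert.prems by (intro f) auto
    then show ?case using insert by simp
  qed (simp_all add: z)
qed

lemma bilinear_map_on_sum_left:
  assumes "subspace W" "bilinear_map_on W B" "\<And>i. i \<in> I \<Longrightarrow> v i \<in> W" "x \<in> W"
  shows "B (\<Sum>i\<in>I. a i *\<^sub>R v i) x = (\<Sum>i\<in>I. a i *\<^sub>R B (v i) x)"
  using assms by (intro linear_on_sum[where f = "\<lambda>u. B u x" and W = W]) (auto simp: bilinear_map_on_def)

lemma bilinear_map_on_sum_right:
  assumes "subspace W" "bilinear_map_on W B" "\<And>i. i \<in> I \<Longrightarrow> v i \<in> W" "x \<in> W"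
  shows "B x (\<Sum>i\<in>I. a i *\<^sub>R v i) = (\<Sum>i\<in>I. a i *\<^sub>R B x (v i))"
  using assms by (intro linear_on_sum[where f = "\<lambda>u. B x u" and W = W]) (auto simp: bilinear_map_on_def)

text \<open>The vectors that satisfy the expansion form a subspace containing every
  \<open>w i\<close>, hence all of the span.\<close>

lemma orthogonal_expansion:
  fixes g :: "'v::real_vector \<Rightarrow> 'v \<Rightarrow> real"
  assumes g: "bilinear_map_on (span (w ` I)) g" and I: "finite I"
    and orth: "\<And>i j. i \<in> I \<Longrightarrow> j \<in> I \<Longrightarrow> i \<noteq> j \<Longrightarrow> g (w i) (w j) = 0"
    and nz: "\<And>i. i \<in> I \<Longrightarrow> g (w i) (w i) \<noteq> 0"
    and v: "v \<in> span (w ` I)"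
  shows "v = (\<Sum>i\<in>I. (g v (w i) / g (w i) (w i)) *\<^sub>R w i)"
proof -
  let ?W = "span (w ` I)"
  have W: "subspace ?W" by (rule subspace_span)
  have wW: "w i \<in> ?W" if "i \<in> I" for i using that by (auto intro: span_base)
  define T where "T = {v \<in> ?W. v = (\<Sum>i\<in>I. (g v (w i) / g (w i) (w i)) *\<^sub>R w i)}"
  have comb: "a *\<^sub>R u + b *\<^sub>R v \<in> T" if "u \<in> T" "v \<in> T" for a b u v
  proof -
    have uv: "u \<in> ?W" "v \<in> ?W" using that by (auto simp: T_def)
    have "(\<Sum>i\<in>I. (g (a *\<^sub>R u + b *\<^sub>R v) (w i) / g (w i) (w i)) *\<^sub>R w i)
        = (\<Sum>i\<in>I. a *\<^sub>R ((g u (w i) / g (w i) (w i)) *\<^sub>R w i) + b *\<^sub>R ((g v (w i) / g (w i) (w i)) *\<^sub>R w i))"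
    proof (rule sum.cong[OF refl])
      fix i assume "i \<in> I"
      then have "g (a *\<^sub>R u + b *\<^sub>R v) (w i) = a *\<^sub>R g u (w i) + b *\<^sub>R g v (w i)"
        using g uv wW unfolding bilinear_map_on_def by blast
      then show "(g (a *\<^sub>R u + b *\<^sub>R v) (w i) / g (w i) (w i)) *\<^sub>R w i = 
          a *\<^sub>R ((g u (w i) / g (w i) (w i)) *\<^sub>R w i) + b *\<^sub>R ((g v (w i) / g (w i) (w i)) *\<^sub>R w i)"
        by (simp add: add_divide_distrib scaleR_left_distrib)
    qed
    also have "\<dots> = a *\<^sub>R u + b *\<^sub>R v"
    proof -
      have "(\<Sum>i\<in>I. (g u (w i) / g (w i) (w i)) *\<^sub>R w i) = u"
        "(\<Sum>i\<in>I. (g v (w i) / g (w i) (w i)) *\<^sub>R w i) = v"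
        using that by (auto simp: T_def)
      then show ?thesis by (simp only: sum.distrib scaleR_sum_right[symmetric])
    qed
    finally show ?thesis using uv by (auto simp: T_def intro: span_add span_scale)
  qed
  have base: "w i \<in> T" if i: "i \<in> I" for i
  proof -
    have "(\<Sum>j\<in>I. (g (w i) (w j) / g (w j) (w j)) *\<^sub>R w j) = (\<Sum>j\<in>I. if j = i then w i else 0)"
      using orth nz i by (intro sum.cong) auto
    also have "\<dots> = w i" using i I by simp
    finally show ?thesis using wW[OF i] by (simp add: T_def)
  qed
  have z: "0 \<in> T"
  proof -
    have "g 0 (w i) = 0" if "i \<in> I" for i
      using g wW[OF that] span_zero[of "w ` I"] unfolding bilinear_map_on_def by (metis scaleR_zero_left add_0)
    then show ?thesis by (auto simp: T_def span_zero)
  qed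
  have "subspace T"
    using comb[of _ _ 1 1] comb[of _ _ _ 0] z by (auto simp: subspace_def)
  then have "?W \<subseteq> T" using base by (intro span_minimal) auto
  then show ?thesis using v by (auto simp: T_def)
qed

text \<open>Frees the trace from the basis chosen in its definition. The frame is orthogonal but not
  normalized, so that smooth frames can be built without square roots; the factor
  \<open>1 / g (w i) (w i)\<close> makes up for that.\<close>

lemma trace_on_orthogonal:
  fixes g :: "'v::real_vector \<Rightarrow> 'v \<Rightarrow> real" and B :: "'v \<Rightarrow> 'v \<Rightarrow> 'b::real_vector"
  assumes g: "bilinear_map_on W g" and B: "bilinear_map_on W B" and I: "finite I"
    and W: "W = span (w ` I)"
    and sym: "\<And>u v. u \<in> W \<Longrightarrow> v \<in> W \<Longrightarrow> g u v = g v u"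
    and orth: "\<And>i j. i \<in> I \<Longrightarrow> j \<in> I \<Longrightarrow> i \<noteq> j \<Longrightarrow> g (w i) (w j) = 0"
    and pos: "\<And>i. i \<in> I \<Longrightarrow> g (w i) (w i) > 0"
  shows "trace_on g W B = (\<Sum>i\<in>I. (1 / g (w i) (w i)) *\<^sub>R B (w i) (w i))"
proof -
  have sW: "subspace W" unfolding W by (rule subspace_span)
  have wW: "w i \<in> W" if "i \<in> I" for i using that unfolding W by (auto intro: span_base)
  have gs: "g (a *\<^sub>R u) (b *\<^sub>R v) = a * b * g u v" if "u \<in> W" "v \<in> W" for a b u v
  proof -
    have z: "0 \<in> W" by (rule subspace_0[OF sW])
    have av: "b *\<^sub>R v \<in> W" by (rule subspace_scale[OF sW that(2)])
    have "g (a *\<^sub>R u + 0 *\<^sub>R u) (b *\<^sub>R v) = a *\<^sub>R g u (b *\<^sub>R v) + 0 *\<^sub>R g u (b *\<^sub>R v)"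
      using g that(1) av unfolding bilinear_map_on_def by blast
    moreover have "g u (b *\<^sub>R v + 0 *\<^sub>R v) = b *\<^sub>R g u v + 0 *\<^sub>R g u v"
      using g that unfolding bilinear_map_on_def by blast
    ultimately show ?thesis by simp
  qed
  \<comment> \<open>Normalizing the frame shows that an orthonormal basis exists, so that the choice
    in \<open>trace_on\<close> yields one.\<close>
  define e where "e = (\<lambda>i. (1 / sqrt (g (w i) (w i))) *\<^sub>R w i)"
  have ge: "g (e i) (e j) = (if i = j then 1 else 0)" if "i \<in> I" "j \<in> I" for i j
    using that orth[OF that] pos[OF that(1)]
    by (auto simp: e_def gs wW simp flip: real_sqrt_mult)
  have "orthonormal_basis g W (e ` I)"
    unfolding orthonormal_basis_def
  proof (intro conjI ballI)
    show "e ` I \<subseteq> W" using wW by (auto simp: e_def intro: subspace_scale[OF sW])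
    moreover have "w i \<in> span (e ` I)" if "i \<in> I" for i
    proof -
      have "w i = sqrt (g (w i) (w i)) *\<^sub>R e i" using pos[OF that] by (simp add: e_def)
      then show ?thesis using that by (metis imageI span_base span_scale)
    qed
    ultimately show "span (e ` I) = W"
      unfolding W by (metis W image_subsetI span_minimal subset_antisym subspace_span)
    show "g a b = (if a = b then 1 else 0)" if "a \<in> e ` I" "b \<in> e ` I" for a b
      using that ge by (auto split: if_splits)
  qed (use I in simp)
  then have ob: "orthonormal_basis g W (SOME E. orthonormal_basis g W E)"
    by (rule someI)
  define E where "E = (SOME E. orthonormal_basis g W E)"
  have E: "finite E" "E \<subseteq> W" "span E = W" "\<And>e e'. e \<in> E \<Longrightarrow> e' \<in> E \<Longrightarrow> g e e' = (if e = e' then 1 else 0)"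
    using ob[folded E_def, unfolded orthonormal_basis_def] by blast+
  have exE: "v = (\<Sum>e\<in>E. g v e *\<^sub>R e)" if "v \<in> W" for v
    using orthogonal_expansion[of "\<lambda>e. e" E g v] g E that by simp
  have exw: "v = (\<Sum>i\<in>I. (g v (w i) / g (w i) (w i)) *\<^sub>R w i)" if "v \<in> W" for v
    using that orth pos g
    by (intro orthogonal_expansion) (auto simp: W I less_imp_neq[THEN not_sym])
  have "trace_on g W B = (\<Sum>e\<in>E. B e e)" by (simp add: trace_on_def E_def)
  \<comment> \<open>One argument of \<open>B e e\<close> is expanded in the frame. After exchanging
    the sums, the expansion of \<open>w i\<close> in the orthonormal basis \<open>E\<close> collects
    the other argument.\<close>
  also have "\<dots> = (\<Sum>e\<in>E. \<Sum>i\<in>I. (g e (w i) / g (w i) (w i)) *\<^sub>R B (w i) e)"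
  proof (rule sum.cong[OF refl])
    fix e assume "e \<in> E"
    then have eW: "e \<in> W" using E by auto
    show "B e e = (\<Sum>i\<in>I. (g e (w i) / g (w i) (w i)) *\<^sub>R B (w i) e)"
      using bilinear_map_on_sum_left[where v = w and I = I and a = "\<lambda>i. g e (w i) / g (w i) (w i)", OF sW B wW eW]
      by (simp only: exw[OF eW, symmetric])
  qed
  also have "\<dots> = (\<Sum>i\<in>I. \<Sum>e\<in>E. (g e (w i) / g (w i) (w i)) *\<^sub>R B (w i) e)"
    by (rule sum.swap)
  also have "\<dots> = (\<Sum>i\<in>I. (1 / g (w i) (w i)) *\<^sub>R B (w i) (w i))"
  proof (rule sum.cong[OF refl])
    fix i assume i: "i \<in> I"
    have "B (w i) (w i) = (\<Sum>e\<in>E. g (w i) e *\<^sub>R B (w i) e)"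
      using bilinear_map_on_sum_right[where I = E and v = "\<lambda>e. e" and a = "g (w i)", OF sW B subsetD[OF E(2)] wW[OF i]]
      by (simp only: exE[OF wW[OF i], symmetric])
    also have "\<dots> = (\<Sum>e\<in>E. g e (w i) *\<^sub>R B (w i) e)"
      using sym[OF _ wW[OF i]] E(2) by (intro sum.cong) auto
    finally show "(\<Sum>e\<in>E. (g e (w i) / g (w i) (w i)) *\<^sub>R B (w i) e) = (1 / g (w i) (w i)) *\<^sub>R B (w i) (w i)"
      by (simp add: scaleR_sum_right)
  qed
  finally show ?thesis .
qed

section \<open>Unitary frames\<close>

text \<open>The span is unchanged by a Gram-Schmidt step: the correction \<open>z\<close> already
  lies in the old span.\<close>

lemma span_insert_cong:
  assumes "span S = span S'" "z \<in> span S'"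
  shows "span (insert (a - z) S) = span (insert a S')"
proof -
  have "x - k *\<^sub>R (a - z) \<in> span S' \<longleftrightarrow> x - k *\<^sub>R a \<in> span S'" for x k
  proof -
    have kz: "k *\<^sub>R z \<in> span S'" by (rule span_scale[OF assms(2)])
    have "x - k *\<^sub>R (a - z) = (x - k *\<^sub>R a) + k *\<^sub>R z" by (simp add: scaleR_diff_right)
    then show ?thesis by (simp only: span_add_eq2[OF kz])
  qed
  then show ?thesis by (simp add: span_insert assms(1))
qed

text \<open>Gram-Schmidt against the \<open>w i\<close> and the \<open>K p (w i)\<close> at once,
  starting from the constant vectors \<open>A b\<close>. Orthogonality to the
  \<open>K p (w i)\<close> is the Lagrangian condition, as \<open>G p a (K p b)\<close> will be the
  symplectic form. Along \<open>R\<close> the vectors \<open>A b\<close> are Lagrangian already, so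
  the corrections stay in their span.\<close>

lemma unitary_frame:
  fixes G :: "'e::euclidean_space \<Rightarrow> 'e \<Rightarrow> 'e \<Rightarrow> real" and K :: "'e \<Rightarrow> 'e \<Rightarrow> 'e"
    and A :: "'f::euclidean_space \<Rightarrow> 'e"
  assumes S: "open S" "p0 \<in> S" "p0 \<in> R" and A: "linear A" "inj A"
    and bil: "\<And>p. p \<in> S \<Longrightarrow> bilinear (G p)"
    and sym: "\<And>p a b. p \<in> S \<Longrightarrow> G p a b = G p b a"
    and pos: "\<And>p a. p \<in> S \<Longrightarrow> a \<noteq> 0 \<Longrightarrow> G p a a > 0"
    and K: "\<And>p. p \<in> S \<Longrightarrow> linear (K p)" "\<And>p a. p \<in> S \<Longrightarrow> K p (K p a) = - a"
      "\<And>p a b. p \<in> S \<Longrightarrow> G p (K p a) (K p b) = G p a b"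
    and smG: "\<And>a b. C_infinity (\<lambda>p. G p a b) S" and smK: "\<And>a. C_infinity (\<lambda>p. K p a) S"
    and lag: "\<And>p a b. p \<in> S \<Longrightarrow> p \<in> R \<Longrightarrow> G p (A a) (K p (A b)) = 0"
    and B: "finite B" "independent B"
  shows "\<exists>N w. open N \<and> p0 \<in> N \<and> N \<subseteq> S \<and> (\<forall>b\<in>B. C_infinity (w b) N) \<and>
    (\<forall>p\<in>N. (\<forall>b\<in>B. w b p \<noteq> 0) \<and> (\<forall>b\<in>B. \<forall>b'\<in>B. b \<noteq> b' \<longrightarrow> G p (w b p) (w b' p) = 0) \<and>
      (\<forall>b\<in>B. \<forall>b'\<in>B. G p (w b p) (K p (w b' p)) = 0) \<and>
      (p \<in> R \<longrightarrow> span ((\<lambda>b. w b p) ` B) = span (A ` B)))"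
  using B
proof (induction B)
  case empty
  show ?case by (intro exI[of _ S]) (use S in auto)
next
  case (insert b B)
  have indB: "independent B" "b \<notin> span B"
    using insert.prems insert.hyps by (auto simp: independent_insert)
  obtain N w where N: "open N" "p0 \<in> N" "N \<subseteq> S" and wB: "\<forall>b\<in>B. C_infinity (w b) N"
    and H: "\<forall>p\<in>N. (\<forall>b\<in>B. w b p \<noteq> 0) \<and> (\<forall>b\<in>B. \<forall>b'\<in>B. b \<noteq> b' \<longrightarrow> G p (w b p) (w b' p) = 0) \<and>
      (\<forall>b\<in>B. \<forall>b'\<in>B. G p (w b p) (K p (w b' p)) = 0) \<and>
      (p \<in> R \<longrightarrow> span ((\<lambda>b. w b p) ` B) = span (A ` B))"
    using insert.IH[OF indB(1)] by (elim exE conjE) (rule that)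
  have w: "C_infinity (w b) N" if "b \<in> B" for b using wB that by blast
  have nz: "w b p \<noteq> 0" if "p \<in> N" "b \<in> B" for p b using H that by blast
  have orth: "G p (w b p) (w b' p) = 0" if "p \<in> N" "b \<in> B" "b' \<in> B" "b \<noteq> b'" for p b b'
    using H that by blast
  have korth: "G p (w b p) (K p (w b' p)) = 0" if "p \<in> N" "b \<in> B" "b' \<in> B" for p b b'
    using H that by blast
  have sp: "span ((\<lambda>b. w b p) ` B) = span (A ` B)" if "p \<in> N" "p \<in> R" for p
    using H that by blast
  have NS: "p \<in> S" if "p \<in> N" for p using that N by auto
  note linG = bil[OF NS, unfolded bilinear_def]
  have linl: "linear (\<lambda>x. G p x y)" and linr: "linear (G p x)" if "p \<in> N" for p x y
    using linG[OF that] by auto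
  have smG2: "C_infinity (\<lambda>p. G p (u p) (v p)) N" if "C_infinity u N" "C_infinity v N" for u v
  proof (rule C_infinity_apply[where h = "\<lambda>p. G p (u p)", OF N(1) linr _ that(2)])
    show "C_infinity (\<lambda>p. G p (u p) e) N" for e
      by (rule C_infinity_apply[where h = "\<lambda>p x. G p x e", OF N(1) linl C_infinity_subset[OF smG N(3)] that(1)])
  qed
  have smK2: "C_infinity (\<lambda>p. K p (u p)) N" if "C_infinity u N" for u
    by (rule C_infinity_apply[OF N(1) K(1)[OF NS] C_infinity_subset[OF smK N(3)] that])
  have KG: "G p (K p x) y = - G p x (K p y)" if "p \<in> N" for p x y
    using K(3)[OF NS[OF that], of x "K p y"] K(2)[OF NS[OF that]] linear_neg[OF linr[OF that]] by simp
  have GK0: "G p x (K p x) = 0" if "p \<in> N" for p x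
    using KG[OF that, of x x] sym[OF NS[OF that], of x "K p x"] by simp
  define c where "c = (\<lambda>i p. G p (w i p) (w i p))"
  have c: "c i p > 0" if "p \<in> N" "i \<in> B" for i p
    unfolding c_def by (rule pos[OF NS[OF that(1)] nz[OF that]])
  \<comment> \<open>The projection of \<open>A b\<close> to the span of all \<open>w i\<close> and
    \<open>K p (w i)\<close>. The same divisor \<open>c i p\<close> serves both sums because
    \<open>K p\<close> is an isometry.\<close>
  define z where "z = (\<lambda>p. (\<Sum>i\<in>B. (G p (A b) (w i p) / c i p) *\<^sub>R w i p)
      + (\<Sum>i\<in>B. (G p (A b) (K p (w i p)) / c i p) *\<^sub>R K p (w i p)))"
  define v where "v = (\<lambda>p. A b - z p)"
  have smv: "C_infinity v N"
    unfolding v_def z_def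
  proof (intro C_infinity_diff[OF N(1)] C_infinity_add[OF N(1)] C_infinity_sum[OF N(1)] C_infinity_const)
    fix i assume i: "i \<in> B"
    have ci: "C_infinity (c i) N" unfolding c_def by (rule smG2[OF w[OF i] w[OF i]])
    have cne: "c i p \<noteq> 0" if "p \<in> N" for p using c[OF that i] by simp
    show "C_infinity (\<lambda>p. (G p (A b) (w i p) / c i p) *\<^sub>R w i p) N"
      by (rule C_infinity_scaleR[OF N(1) C_infinity_divide[OF N(1) smG2[OF C_infinity_const w[OF i]] ci cne] w[OF i]])
    show "C_infinity (\<lambda>p. (G p (A b) (K p (w i p)) / c i p) *\<^sub>R K p (w i p)) N"
      by (rule C_infinity_scaleR[OF N(1) C_infinity_divide[OF N(1) smG2[OF C_infinity_const smK2[OF w[OF i]]] ci cne] smK2[OF w[OF i]]])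
  qed
  have Gv: "G p (v p) (w j p) = 0" "G p (v p) (K p (w j p)) = 0" if p: "p \<in> N" and j: "j \<in> B" for p j
  proof -
    have *: "G p (v p) x = G p (A b) x - ((\<Sum>i\<in>B. (G p (A b) (w i p) / c i p) * G p (w i p) x)
      + (\<Sum>i\<in>B. (G p (A b) (K p (w i p)) / c i p) * G p (K p (w i p)) x))" for x
      unfolding v_def z_def
      by (simp add: linear_diff[OF linl[OF p]] linear_add[OF linl[OF p]] linear_sum[OF linl[OF p]] linear_cmul[OF linl[OF p]])
    have "(\<Sum>i\<in>B. (G p (A b) (w i p) / c i p) * G p (w i p) (w j p)) = (\<Sum>i\<in>B. if i = j then G p (A b) (w j p) else 0)"
      using orth[OF p _ j] c[OF p j] by (intro sum.cong) (auto simp: c_def)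
    moreover have "(\<Sum>i\<in>B. (G p (A b) (K p (w i p)) / c i p) * G p (K p (w i p)) (w j p)) = 0"
      using korth[OF p _ j] KG[OF p] by (intro sum.neutral) auto
    ultimately show "G p (v p) (w j p) = 0"
      unfolding * using j insert.hyps(1) by simp
    have "(\<Sum>i\<in>B. (G p (A b) (K p (w i p)) / c i p) * G p (K p (w i p)) (K p (w j p)))
        = (\<Sum>i\<in>B. if i = j then G p (A b) (K p (w j p)) else 0)"
      using orth[OF p _ j] c[OF p j] K(3)[OF NS[OF p]] by (intro sum.cong) (auto simp: c_def)
    moreover have "(\<Sum>i\<in>B. (G p (A b) (w i p) / c i p) * G p (w i p) (K p (w j p))) = 0"
      using korth[OF p _ j] by (intro sum.neutral) auto
    ultimately show "G p (v p) (K p (w j p)) = 0"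
      unfolding * using j insert.hyps(1) by simp
  qed
  text \<open>On \<open>R\<close> the vectors \<open>A b\<close> and \<open>w\<^sub>i\<close> lie in the Lagrangian plane \<open>range A\<close>, so the components
    along \<open>K w\<^sub>i\<close> vanish.\<close>
  have zsp: "z p \<in> span (A ` B)" if p: "p \<in> N" "p \<in> R" for p
  proof -
    have wi: "w i p \<in> span (A ` B)" if "i \<in> B" for i
      using that unfolding sp[OF p, symmetric] by (intro span_base) auto
    have "G p (A b) (K p (w i p)) = 0" if i: "i \<in> B" for i
    proof -
      obtain s where "w i p = A s" using wi[OF i] by (auto simp: linear_span_image[OF A(1)])
      then show ?thesis using lag[OF NS[OF p(1)] p(2)] by simp
    qed
    then have "z p = (\<Sum>i\<in>B. (G p (A b) (w i p) / c i p) *\<^sub>R w i p)" by (simp add: z_def)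
    then show ?thesis using wi by (auto intro: span_sum span_scale)
  qed
  have v0: "v p0 \<noteq> 0"
  proof
    assume "v p0 = 0"
    then have "A b \<in> A ` span B"
      using zsp[OF N(2) S(3)] by (simp add: v_def linear_span_image[OF A(1)])
    then show False using A(2) indB(2) by (auto dest: injD)
  qed
  \<comment> \<open>The new vector is known to be nonzero only at \<open>p0\<close>, by injectivity
    of \<open>A\<close> and independence; continuity extends this to a neighbourhood.\<close>
  define N' where "N' = N \<inter> (\<lambda>p. G p (v p) (v p)) -` {0<..}"
  have N': "open N'" unfolding N'_def
    by (rule continuous_open_preimage[OF C_infinity_continuous_on[OF smG2[OF smv smv]] N(1)]) simp
  have N'N: "p \<in> N" "v p \<noteq> 0" if "p \<in> N'" for p
    using that linear_0[OF linr] by (auto simp: N'_def)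
  define w' where "w' = w(b := v)"
  have w': "w' b = v" "\<And>i. i \<in> B \<Longrightarrow> w' i = w i"
    using insert.hyps by (auto simp: w'_def)
  show ?case
  proof (intro exI[of _ N'] exI[of _ w'] conjI ballI)
    show "p0 \<in> N'" using pos[OF S(2) v0] N(2) by (simp add: N'_def)
    show "N' \<subseteq> S" using N(3) by (auto simp: N'_def)
    show "C_infinity (w' i) N'" if "i \<in> insert b B" for i
    proof (rule C_infinity_subset)
      show "C_infinity (w' i) N"
        using that w' smv w by (cases "i = b") auto
      show "N' \<subseteq> N" by (auto simp: N'_def)
    qed
    fix p assume p: "p \<in> N'"
    note pN = N'N(1)[OF p]
    show "w' i p \<noteq> 0" if "i \<in> insert b B" for i
      using that w' nz[OF pN] N'N(2)[OF p] by auto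
    show "i \<noteq> j \<longrightarrow> G p (w' i p) (w' j p) = 0" if "i \<in> insert b B" "j \<in> insert b B" for i j
      using that w' orth[OF pN] Gv(1)[OF pN] sym[OF NS[OF pN]] by auto
    show "G p (w' i p) (K p (w' j p)) = 0" if "i \<in> insert b B" "j \<in> insert b B" for i j
    proof -
      have "G p (w i p) (K p (v p)) = 0" if "i \<in> B" for i
        using Gv(2)[OF pN that] KG[OF pN, of "w i p" "v p"] sym[OF NS[OF pN], of "K p (w i p)" "v p"] by simp
      then show ?thesis
        using that w' korth[OF pN] Gv(2)[OF pN] GK0[OF pN] by auto
    qed
    show "p \<in> R \<longrightarrow> span ((\<lambda>i. w' i p) ` insert b B) = span (A ` insert b B)"
    proof
      assume R: "p \<in> R"
      have "(\<lambda>i. w' i p) ` insert b B = insert (A b - z p) ((\<lambda>i. w i p) ` B)"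
        using w' by (auto simp: v_def)
      then show "span ((\<lambda>i. w' i p) ` insert b B) = span (A ` insert b B)"
        using span_insert_cong[OF sp[OF pN R] zsp[OF pN R]] by simp
    qed
  qed (rule N')
qed

section \<open>Geometry of a submanifold in an adapted chart\<close>

lemma linear_comp: "linear f \<Longrightarrow> linear g \<Longrightarrow> linear (\<lambda>x. g (f x))"
  using linear_compose[of f g] by (simp add: o_def)

text \<open>Linearity in the outer slot \<open>a\<close> is that of a derivative; symmetry transfers
  it to the inner slot \<open>b\<close>.\<close>

lemma second_derivative_linear:
  fixes f :: "'e::euclidean_space \<Rightarrow> real"
  assumes "open S" "C_infinity f S" "x \<in> S"
  shows "linear (\<lambda>b. hess f x a b)"
proof -
  have "linear (fderiv (\<lambda>p. fderiv f p a) x)"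
    by (rule C_infinity_linear_frechet[OF C_infinity_frechet[OF assms(2)] assms(3)])
  moreover have "fderiv (\<lambda>p. fderiv f p a) x =
      (\<lambda>b. hess f x a b)"
    by (rule ext) (rule second_derivative_symmetric[OF assms])
  ultimately show ?thesis by simp
qed

lemma (in chart) span_cv: "x \<in> U \<Longrightarrow> span ((\<lambda>i. cv x (w i)) ` I) = cv x ` span (w ` I)"
  using linear_span_image[OF linear_cv, of x "w ` I"] by (simp add: image_image)

lemma (in chart) bilinear_map_on_tangent_space:
  assumes "x \<in> U" "\<And>b. linear (\<lambda>a. B (cv x a) (cv x b))" "\<And>a. linear (\<lambda>b. B (cv x a) (cv x b))"
  shows "bilinear_map_on (tangent_space X x) B"
  unfolding bilinear_map_on_def tangent_space_eq[OF assms(1)]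
  using linear_add[OF assms(2)] linear_add[OF assms(3)] linear_cmul[OF assms(2)] linear_cmul[OF assms(3)]
  by (auto simp flip: linear_add[OF linear_cv[OF assms(1)]] linear_cmul[OF linear_cv[OF assms(1)]])

lemma (in connection_chart) bilinear_hessian:
  assumes "x \<in> U" "smooth_near X x f"
  shows "bilinear_map_on (tangent_space X x) (hessian X D f x)"
proof (rule bilinear_map_on_tangent_space[OF assms(1)])
  obtain N where N: "open (\<psi> ` N)" "C_infinity (f \<circ> \<xi>) (\<psi> ` N)" "\<psi> x \<in> \<psi> ` N"
    using smooth_near_chart[OF assms(2,1)] by (metis imageI)
  have lin: "linear (fderiv (f \<circ> \<xi>) (\<psi> x))"
    by (rule C_infinity_linear_frechet[OF N(2,3)])
  show "linear (\<lambda>a. hessian X D f x (cv x a) (cv x b))" for b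
    unfolding hessian_cv[OF assms]
    by (intro linear_compose_sub C_infinity_linear_frechet[OF C_infinity_frechet[OF N(2)] N(3)]
        linear_comp[OF linear_\<Gamma>_left[OF assms(1)] lin])
  show "linear (\<lambda>b. hessian X D f x (cv x a) (cv x b))" for a
    unfolding hessian_cv[OF assms]
    by (intro linear_compose_sub second_derivative_linear[OF N]
        linear_comp[OF linear_\<Gamma>_right[OF assms(1)] lin])
qed

lemma (in connection_chart) trace_hessian:
  assumes x: "x \<in> U" "smooth_near X x f" and I: "finite I"
    and h: "bilinear_map_on (tangent_space X x) h" "\<And>a b. h (cv x a) (cv x b) = h (cv x b) (cv x a)"
    and orth: "\<And>i j. i \<in> I \<Longrightarrow> j \<in> I \<Longrightarrow> i \<noteq> j \<Longrightarrow> h (cv x (w i)) (cv x (w j)) = 0"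
    and pos: "\<And>i. i \<in> I \<Longrightarrow> h (cv x (w i)) (cv x (w i)) > 0"
  shows "trace_on h (cv x ` span (w ` I)) (hessian X D f x) =
    (\<Sum>i\<in>I. (hess (f \<circ> \<xi>) (\<psi> x) (w i) (w i)
      - fderiv (f \<circ> \<xi>) (\<psi> x) (\<Gamma> x (w i) (w i))) / h (cv x (w i)) (cv x (w i)))"
proof -
  have sub: "span ((\<lambda>i. cv x (w i)) ` I) \<subseteq> tangent_space X x"
    unfolding span_cv[OF x(1)] using x(1) by auto
  have "trace_on h (span ((\<lambda>i. cv x (w i)) ` I)) (hessian X D f x) =
    (\<Sum>i\<in>I. (1 / h (cv x (w i)) (cv x (w i))) *\<^sub>R hessian X D f x (cv x (w i)) (cv x (w i)))"
  proof (rule trace_on_orthogonal[where w = "\<lambda>i. cv x (w i)", OF bilinear_map_on_subset[OF h(1) sub]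
      bilinear_map_on_subset[OF bilinear_hessian[OF x] sub] I refl _ orth pos])
    show "h u v = h v u" if "u \<in> span ((\<lambda>i. cv x (w i)) ` I)" "v \<in> span ((\<lambda>i. cv x (w i)) ` I)" for u v
      using that h(2) unfolding span_cv[OF x(1)] by auto
  qed
  then show ?thesis by (simp add: span_cv[OF x(1)] hessian_cv[OF x])
qed

text \<open>In the chart \<open>M\<close> is a piece of the linear subspace \<open>range A\<close>,
  the map \<open>p \<mapsto> A (P p)\<close> is a projection onto it, and \<open>P\<close> returns
  the coordinates \<open>\<phi>\<close> on \<open>M\<close>.\<close>

locale adapted_chart = chart X V \<psi> + m: chart M U \<phi>
  for X :: "('a, 'e::euclidean_space) mfd" and V \<psi> and M :: "('a, 'f::euclidean_space) mfd" and U \<phi> +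
  fixes A :: "'f \<Rightarrow> 'e" and P :: "'e \<Rightarrow> 'f"
  assumes submanifold: "submanifold X M" and linear_A: "linear A" and linear_P: "linear P"
    and P_A [simp]: "P (A s) = s"
    and mem_iff: "y \<in> V \<Longrightarrow> y \<in> pts M \<longleftrightarrow> \<psi> y = A (P (\<psi> y))"
    and coordinates: "y \<in> V \<Longrightarrow> y \<in> pts M \<Longrightarrow> y \<in> U \<and> \<phi> y = P (\<psi> y)"
begin

lemma in_U: "y \<in> V \<Longrightarrow> y \<in> pts M \<Longrightarrow> y \<in> U"
  using coordinates by blast

lemma \<psi>_eq: "y \<in> V \<Longrightarrow> y \<in> pts M \<Longrightarrow> \<psi> y = A (\<phi> y)"
  using coordinates mem_iff by metis

lemma opens_M: "opens X N \<Longrightarrow> opens M (N \<inter> pts M)"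
  by (rule opens_submanifold[OF submanifold])

text \<open>Along \<open>M\<close> the charts satisfy \<open>\<psi> y = A (\<phi> y)\<close>, so the
  inclusion is linear in coordinates and equals its differential.\<close>

lemma push_cv:
  assumes "y \<in> V" "y \<in> pts M"
  shows "push X y (m.cv y a) = cv y (A a)"
proof (rule push_chart_vec[OF submanifold chart_axioms m.chart_axioms in_U[OF assms] assms(1)])
  show "((\<psi> \<circ> m.\<xi>) has_derivative A) (at (\<phi> y))"
  proof (rule has_derivative_transform_within_open[OF linear_imp_has_derivative[OF linear_A]
        m.open_image[OF opens_M[OF opens_U]]])
    show "\<phi> y \<in> \<phi> ` (U \<inter> (V \<inter> pts M))" using assms in_U by auto
    show "A p = (\<psi> \<circ> m.\<xi>) p" if "p \<in> \<phi> ` (U \<inter> (V \<inter> pts M))" for p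
      using that \<psi>_eq by auto
  qed
qed

lemma tangent_in_eq: "y \<in> V \<Longrightarrow> y \<in> pts M \<Longrightarrow> tangent_in X M y = range (\<lambda>a. cv y (A a))"
  unfolding tangent_in_def m.tangent_space_eq[OF in_U] by (simp add: image_image push_cv)

lemma cv_restrict: "y \<in> V \<Longrightarrow> y \<in> pts M \<Longrightarrow> smooth_near X y f \<Longrightarrow> m.cv y a f = cv y (A a) f"
  using push_cv[of y a] by (metis push_def)

end

locale adapted_riemannian_chart = adapted_chart X V \<psi> M U \<phi> A P +
    levi_civita_chart X V \<psi> g D + m: levi_civita_chart M U \<phi> "induced_metric X g" D\<^sub>M
  for X :: "('a, 'e::euclidean_space) mfd" and V \<psi> and M :: "('a, 'f::euclidean_space) mfd" and U \<phi> A P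
    and g D D\<^sub>M +
  assumes bilinear_g: "y \<in> V \<Longrightarrow> bilinear_map_on (tangent_space X y) (g y)"
    and sym_g: "y \<in> V \<Longrightarrow> v \<in> tangent_space X y \<Longrightarrow> w \<in> tangent_space X y \<Longrightarrow> g y v w = g y w v"
    and pos_g: "y \<in> V \<Longrightarrow> v \<in> tangent_space X y \<Longrightarrow> v \<noteq> 0 \<Longrightarrow> g y v v > 0"
    and smooth_g: "y \<in> V \<Longrightarrow> smooth_near X y (\<lambda>z. g z (cv z a) (cv z b))"
begin

definition G :: "'a \<Rightarrow> 'e \<Rightarrow> 'e \<Rightarrow> real" where "G y a b = g y (cv y a) (cv y b)"

lemma G_sym: "y \<in> V \<Longrightarrow> G y a b = G y b a"
  by (simp add: G_def sym_g)

lemma G_pos: "y \<in> V \<Longrightarrow> a \<noteq> 0 \<Longrightarrow> G y a a > 0"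
  unfolding G_def using pos_g cv_tangent cv_inj[of y a 0] linear_0[OF linear_cv] by metis

lemma linear_G_right: "y \<in> V \<Longrightarrow> linear (G y a)"
  and linear_G_left: "y \<in> V \<Longrightarrow> linear (\<lambda>a. G y a b)"
proof -
  assume y: "y \<in> V"
  have 1: "G y c (r *\<^sub>R a + s *\<^sub>R b) = r * G y c a + s * G y c b" for a b c r s
    using bilinear_g[OF y] cv_tangent[OF y]
    by (simp add: G_def bilinear_map_on_def linear_add[OF linear_cv[OF y]] linear_cmul[OF linear_cv[OF y]])
  show "linear (G y a)" for a
    by (rule linearI) (use 1[of a 1 _ 1] 1[of a _ _ 0] in auto)
  then show "linear (\<lambda>a. G y a b)" for b by (simp add: G_sym[OF y, of _ b])
qed

lemma induced_metric_cv:
  assumes "y \<in> V" "y \<in> pts M"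
  shows "induced_metric X g y (m.cv y a) (m.cv y b) = G y (A a) (A b)"
  by (simp add: induced_metric_def push_cv[OF assms] G_def)

text \<open>The tangential part of the connection of \<open>X\<close> is the connection of \<open>M\<close>, since both are
  given by Koszul's formula with the same data.\<close>

lemma tangential_part:
  assumes y: "y \<in> V" "y \<in> pts M"
  shows "G y (\<Gamma> y (A a) (A b) - A (m.\<Gamma> y a b)) (A c) = 0"
proof -
  note yU = in_U[OF y]
  \<comment> \<open>The two functions agree on \<open>M\<close>, and a vector tangent to
    \<open>M\<close> sees only the restriction. So the right-hand sides of the two Koszul formulas
    coincide term by term.\<close>
  have restrict: "m.cv y a (\<lambda>z. induced_metric X g z (m.cv z b) (m.cv z c)) =
      cv y (A a) (\<lambda>z. g z (cv z (A b)) (cv z (A c)))" for a b c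
  proof -
    have "m.cv y a (\<lambda>z. induced_metric X g z (m.cv z b) (m.cv z c)) = m.cv y a (\<lambda>z. g z (cv z (A b)) (cv z (A c)))"
      by (rule m.cv_germ[OF opens_M[OF opens_U] _ yU])
        (use y in \<open>auto simp: induced_metric_cv G_def\<close>)
    then show ?thesis using cv_restrict[OF y smooth_g[OF y(1)]] by simp
  qed
  have symM: "induced_metric X g y v w = induced_metric X g y w v"
    if "v \<in> tangent_space M y" "w \<in> tangent_space M y" for v w
    using that G_sym[OF y(1)] by (auto simp: m.tangent_space_eq[OF yU] induced_metric_cv[OF y])
  have "2 * g y (cv y (\<Gamma> y (A a) (A b))) (cv y (A c)) =
      2 * induced_metric X g y (m.cv y (m.\<Gamma> y a b)) (m.cv y c)"
  proof -
    have KX: "2 * g y (cv y (\<Gamma> y (A a) (A b))) (cv y (A c)) = cv y (A a) (\<lambda>z. g z (cv z (A b)) (cv z (A c)))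
        + cv y (A b) (\<lambda>z. g z (cv z (A c)) (cv z (A a))) - cv y (A c) (\<lambda>z. g z (cv z (A a)) (cv z (A b)))"
      by (rule Koszul[OF y(1)]) (rule sym_g[OF y(1)])
    show ?thesis
      unfolding KX restrict[symmetric] by (rule m.Koszul[OF yU, symmetric]) (rule symM)
  qed
  then show ?thesis
    by (simp add: induced_metric_cv[OF y] linear_diff[OF linear_G_left[OF y(1)]]) (simp add: G_def)
qed

text \<open>Two candidates for the normal part differ by a tangential vector that is orthogonal to
  all tangential ones, hence to itself; positivity makes it zero.\<close>

lemma normal_part_cv:
  assumes y: "y \<in> V" "y \<in> pts M" and orth: "\<And>c. G y \<zeta> (A c) = 0" and d: "\<beta> - \<zeta> = A s"
  shows "normal_part (g y) (tangent_space X y) (tangent_in X M y) (cv y \<beta>) = cv y \<zeta>"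
  unfolding normal_part_def tangent_in_eq[OF y]
proof (rule the_equality)
  have cvd: "cv y a - cv y b = cv y (a - b)" for a b
    by (simp add: linear_diff[OF linear_cv[OF y(1)]])
  show "cv y \<zeta> \<in> tangent_space X y \<and> (\<forall>w\<in>range (\<lambda>a. cv y (A a)). g y (cv y \<zeta>) w = 0) \<and>
      cv y \<beta> - cv y \<zeta> \<in> range (\<lambda>a. cv y (A a))"
    using y orth d by (auto simp: cvd G_def)
  fix z assume z: "z \<in> tangent_space X y \<and> (\<forall>w\<in>range (\<lambda>a. cv y (A a)). g y z w = 0) \<and>
      cv y \<beta> - z \<in> range (\<lambda>a. cv y (A a))"
  then obtain \<eta> where \<eta>: "z = cv y \<eta>" by (auto simp: tangent_space_eq[OF y(1)])
  with z obtain s' where "cv y (\<beta> - \<eta>) = cv y (A s')" by (auto simp: cvd)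
  then have "\<beta> - \<eta> = A s'" by (rule cv_inj[OF y(1)])
  moreover have "\<zeta> - \<eta> = (\<beta> - \<eta>) - (\<beta> - \<zeta>)" by simp
  ultimately have diff: "\<zeta> - \<eta> = A (s' - s)" using d by (simp only: linear_diff[OF linear_A])
  have "G y \<eta> (A c) = 0" for c using z by (auto simp: \<eta> G_def)
  then have "G y (\<zeta> - \<eta>) (\<zeta> - \<eta>) = 0"
    unfolding linear_diff[OF linear_G_left[OF y(1)]] unfolding diff using orth by simp
  then have "\<zeta> - \<eta> = 0" using G_pos[OF y(1), of "\<zeta> - \<eta>"] by fastforce
  then show "z = cv y \<zeta>" by (simp add: \<eta>)
qed

text \<open>The Gauss formula in coordinates. The chosen extension is tangent along
  \<open>M\<close>, so differentiating its components along \<open>M\<close> gives a tangential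
  vector, which the normal part discards; \<open>tangential_part\<close> identifies what remains as
  normal.\<close>

lemma second_fundamental_form_cv:
  assumes y: "y \<in> V" "y \<in> pts M"
  shows "second_fundamental_form X g D M y (cv y (A a)) (cv y (A b)) =
    cv y (\<Gamma> y (A a) (A b) - A (m.\<Gamma> y a b))"
proof -
  let ?Q = "\<lambda>W. W y = cv y (A b) \<and>
    (\<exists>N. opens X N \<and> y \<in> N \<and> smooth_vf X N W \<and> (\<forall>z\<in>N \<inter> pts M. W z \<in> tangent_in X M z))"
  define W where "W = (SOME W. ?Q W)"
  have "?Q W"
    unfolding W_def
  proof (rule someI[of ?Q])
    show "?Q (\<lambda>z. cv z (A b))"
      by (intro conjI refl exI[of _ V]) (auto simp: opens_U y smooth_vf_const tangent_in_eq)
  qed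
  then obtain N where N: "W y = cv y (A b)" "opens X N" "y \<in> N" "smooth_vf X N W"
    "\<And>z. z \<in> N \<Longrightarrow> z \<in> pts M \<Longrightarrow> W z \<in> tangent_in X M z" by blast
  define K where "K = V \<inter> N"
  have K: "opens X K" "y \<in> K" "K \<subseteq> V" using y N opens_U by (auto simp: K_def)
  have WK: "smooth_vf X K W" using N(4) unfolding smooth_vf_def K_def by blast
  define c where "c = (\<lambda>p. coord (W (\<xi> p)))"
  have c: "C_infinity c (\<psi> ` K)" unfolding c_def by (rule smooth_vf_coord(1)[OF K(1,3) WK])
  have Wc: "W z = cv z (c (\<psi> z))" if "z \<in> K" for z
    using smooth_vf_coord(2)[OF K(1,3) WK that] by (simp add: c_def)
  have cy: "c (\<psi> y) = A b" using Wc[OF K(2)] N(1) cv_inj[OF y(1)] by metis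
  have cM: "c (\<psi> z) = A (P (c (\<psi> z)))" if z: "z \<in> K" "z \<in> pts M" for z
  proof -
    have zV: "z \<in> V" using z K by auto
    have "W z \<in> range (\<lambda>a. cv z (A a))" using N(5)[of z] z tangent_in_eq[OF zV] by (auto simp: K_def)
    then obtain a where "cv z (c (\<psi> z)) = cv z (A a)" using Wc[OF z(1)] by auto
    then have "c (\<psi> z) = A a" by (rule cv_inj[OF zV])
    then show ?thesis by simp
  qed
  \<comment> \<open>Along \<open>M\<close> the components \<open>c\<close> take values in
    \<open>range A\<close>. Comparing the derivatives of \<open>c\<close> and \<open>A (P c)\<close>
    along \<open>M\<close> shows that \<open>d\<close> lies there too.\<close>
  define d where "d = fderiv c (\<psi> y) (A a)"
  have dd: "d = A (P d)"
  proof -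
    have yU: "y \<in> U" by (rule in_U[OF y])
    have oK: "open (\<phi> ` (U \<inter> (K \<inter> pts M)))" by (rule m.open_image[OF opens_M[OF K(1)]])
    have "(c has_derivative fderiv c (A (\<phi> y))) (at (A (\<phi> y)))"
      using C_infinity_has_derivative[OF c] K(2) \<psi>_eq[OF y] by (metis imageI)
    from has_derivative_compose[OF linear_imp_has_derivative[OF linear_A] this]
    have d1: "((\<lambda>s. c (A s)) has_derivative (\<lambda>a. fderiv c (\<psi> y) (A a))) (at (\<phi> y))"
      by (simp add: \<psi>_eq[OF y])
    have lAP: "bounded_linear (\<lambda>v. A (P v))"
      using linear_comp[OF linear_P linear_A] by (simp add: o_def linear_conv_bounded_linear)
    have "((\<lambda>s. A (P (c (A s)))) has_derivative (\<lambda>a. A (P (fderiv c (\<psi> y) (A a))))) (at (\<phi> y))"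
      by (rule bounded_linear.has_derivative[OF lAP d1])
    then have "((\<lambda>s. c (A s)) has_derivative (\<lambda>a. A (P (fderiv c (\<psi> y) (A a))))) (at (\<phi> y))"
    proof (rule has_derivative_transform_within_open[OF _ oK])
      show "\<phi> y \<in> \<phi> ` (U \<inter> (K \<inter> pts M))" using yU K y by auto
      show "A (P (c (A s))) = c (A s)" if "s \<in> \<phi> ` (U \<inter> (K \<inter> pts M))" for s
      proof -
        obtain z where z: "s = \<phi> z" "z \<in> K" "z \<in> pts M" using \<open>s \<in> _\<close> by auto
        then have "A s = \<psi> z" using \<psi>_eq[of z] K(3) by auto
        then show ?thesis using cM[OF z(2,3)] by simp
      qed
    qed
    from has_derivative_unique[OF d1 this] show ?thesis
      unfolding d_def by (rule fun_cong)
  qed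
  have "D y (cv y (A a)) W = cv y (d + \<Gamma> y (A a) (A b))"
    using D_field[OF K c Wc, of "A a"] cy by (simp add: d_def)
  moreover have "(d + \<Gamma> y (A a) (A b)) - (\<Gamma> y (A a) (A b) - A (m.\<Gamma> y a b)) = A (P d + m.\<Gamma> y a b)"
    using dd by (simp add: linear_add[OF linear_A])
  ultimately have "normal_part (g y) (tangent_space X y) (tangent_in X M y) (D y (cv y (A a)) W) =
      cv y (\<Gamma> y (A a) (A b) - A (m.\<Gamma> y a b))"
    using normal_part_cv[OF y tangential_part[OF y]] by simp
  then show ?thesis
    by (simp add: second_fundamental_form_def W_def Let_def)
qed

text \<open>The form in which minimality is used: the trace of the Christoffel symbols of
  \<open>X\<close> over the tangent space has no normal component, and its tangential part is the
  corresponding trace for \<open>M\<close>.\<close>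

lemma mean_curvature_zero:
  assumes y: "y \<in> V" "y \<in> pts M" and I: "finite I" and sp: "span (w ` I) = range A"
    and orth: "\<And>i j. i \<in> I \<Longrightarrow> j \<in> I \<Longrightarrow> i \<noteq> j \<Longrightarrow> G y (w i) (w j) = 0"
    and nz: "\<And>i. i \<in> I \<Longrightarrow> w i \<noteq> 0"
    and H: "mean_curvature X g D M y = 0"
  shows "(\<Sum>i\<in>I. (1 / G y (w i) (w i)) *\<^sub>R \<Gamma> y (w i) (w i)) =
    A (\<Sum>i\<in>I. (1 / G y (w i) (w i)) *\<^sub>R m.\<Gamma> y (P (w i)) (P (w i)))"
proof -
  note yU = in_U[OF y]
  define F where "F a b = cv y (\<Gamma> y (A a) (A b) - A (m.\<Gamma> y a b))" for a b
  have lin1: "linear (\<lambda>a. F a b)" for b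
    unfolding F_def
    by (intro linear_comp[OF _ linear_cv[OF y(1)]] linear_compose_sub
        linear_comp[OF linear_A linear_\<Gamma>_left[OF y(1)]]
        linear_comp[OF m.linear_\<Gamma>_left[OF yU] linear_A])
  have lin2: "linear (F a)" for a
    unfolding F_def
    by (intro linear_comp[OF _ linear_cv[OF y(1)]] linear_compose_sub
        linear_comp[OF linear_A linear_\<Gamma>_right[OF y(1)]]
        linear_comp[OF m.linear_\<Gamma>_right[OF yU] linear_A])
  have lcA: "linear (\<lambda>a. cv y (A a))"
    using linear_comp[OF linear_A linear_cv[OF y(1)]] by (simp add: o_def)
  have II: "bilinear_map_on (tangent_in X M y) (second_fundamental_form X g D M y)"
    unfolding bilinear_map_on_def tangent_in_eq[OF y]
    by (auto simp: second_fundamental_form_cv[OF y, folded F_def]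
        linear_add[OF lin1] linear_cmul[OF lin1] linear_add[OF lin2] linear_cmul[OF lin2]
        simp flip: linear_add[OF lcA] linear_cmul[OF lcA])
  have T: "tangent_in X M y = span ((\<lambda>i. cv y (w i)) ` I)"
    unfolding span_cv[OF y(1)] sp tangent_in_eq[OF y] by auto
  have sub: "tangent_in X M y \<subseteq> tangent_space X y" using y(1) by (auto simp: tangent_in_eq[OF y])
  have "trace_on (g y) (tangent_in X M y) (second_fundamental_form X g D M y) =
      (\<Sum>i\<in>I. (1 / g y (cv y (w i)) (cv y (w i))) *\<^sub>R second_fundamental_form X g D M y (cv y (w i)) (cv y (w i)))"
  proof (rule trace_on_orthogonal[where w = "\<lambda>i. cv y (w i)",
        OF bilinear_map_on_subset[OF bilinear_g[OF y(1)] sub] II I T])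
    show "g y u v = g y v u" if "u \<in> tangent_in X M y" "v \<in> tangent_in X M y" for u v
      using that sub by (intro sym_g[OF y(1)]) auto
  qed (use orth G_pos[OF y(1) nz] in \<open>auto simp: G_def\<close>)
  also have "\<dots> = (\<Sum>i\<in>I. (1 / G y (w i) (w i)) *\<^sub>R cv y (\<Gamma> y (w i) (w i) - A (m.\<Gamma> y (P (w i)) (P (w i)))))"
  proof (rule sum.cong[OF refl])
    fix i assume "i \<in> I"
    then have "w i \<in> range A" unfolding sp[symmetric] by (auto intro: span_base)
    then have "A (P (w i)) = w i" by auto
    then show "(1 / g y (cv y (w i)) (cv y (w i))) *\<^sub>R second_fundamental_form X g D M y (cv y (w i)) (cv y (w i))
        = (1 / G y (w i) (w i)) *\<^sub>R cv y (\<Gamma> y (w i) (w i) - A (m.\<Gamma> y (P (w i)) (P (w i))))"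
      using second_fundamental_form_cv[OF y, of "P (w i)" "P (w i)"] by (simp add: G_def)
  qed
  also have "\<dots> = cv y ((\<Sum>i\<in>I. (1 / G y (w i) (w i)) *\<^sub>R \<Gamma> y (w i) (w i)) -
      A (\<Sum>i\<in>I. (1 / G y (w i) (w i)) *\<^sub>R m.\<Gamma> y (P (w i)) (P (w i))))"
    by (simp only: linear_sum[OF linear_cv[OF y(1)]] linear_diff[OF linear_cv[OF y(1)]] linear_cmul[OF linear_cv[OF y(1)]]
        linear_sum[OF linear_A] linear_cmul[OF linear_A] scaleR_diff_right sum_subtractf)
  finally have "cv y ((\<Sum>i\<in>I. (1 / G y (w i) (w i)) *\<^sub>R \<Gamma> y (w i) (w i)) -
      A (\<Sum>i\<in>I. (1 / G y (w i) (w i)) *\<^sub>R m.\<Gamma> y (P (w i)) (P (w i)))) = cv y 0"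
    using H linear_0[OF linear_cv[OF y(1)]] by (simp only: mean_curvature_def)
  from cv_inj[OF y(1) this] show ?thesis by simp
qed

text \<open>Each \<open>w i\<close> lies in \<open>range A\<close>, so
  \<open>A (P (w i)) = w i\<close>; hence the vectors \<open>P (w i)\<close> form an orthogonal
  frame of \<open>M\<close> with the same lengths.\<close>

lemma laplace_beltrami_frame:
  assumes y: "y \<in> V" "y \<in> pts M" and I: "finite I" and sp: "span (w ` I) = range A"
    and orth: "\<And>i j. i \<in> I \<Longrightarrow> j \<in> I \<Longrightarrow> i \<noteq> j \<Longrightarrow> G y (w i) (w j) = 0"
    and nz: "\<And>i. i \<in> I \<Longrightarrow> w i \<noteq> 0"
    and f: "smooth_near M y f"
  shows "laplace_beltrami M (induced_metric X g) D\<^sub>M f y =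
    (\<Sum>i\<in>I. (hess (f \<circ> m.\<xi>) (\<phi> y) (P (w i)) (P (w i))
      - fderiv (f \<circ> m.\<xi>) (\<phi> y) (m.\<Gamma> y (P (w i)) (P (w i)))) / G y (w i) (w i))"
proof -
  note yU = in_U[OF y]
  have AP: "A (P (w i)) = w i" if "i \<in> I" for i
  proof -
    have "w i \<in> range A" unfolding sp[symmetric] using that by (auto intro: span_base)
    then show ?thesis by auto
  qed
  have "span (P ` w ` I) = P ` range A" unfolding linear_span_image[OF linear_P] sp ..
  also have "\<dots> = UNIV" by (auto simp: image_image)
  finally have T: "tangent_space M y = m.cv y ` span ((\<lambda>i. P (w i)) ` I)"
    by (simp add: m.tangent_space_eq[OF yU] image_image)
  have bil: "bilinear_map_on (tangent_space M y) (induced_metric X g y)"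
    by (rule m.bilinear_map_on_tangent_space[OF yU])
      (use linear_comp[OF linear_A linear_G_left[OF y(1)]] linear_comp[OF linear_A linear_G_right[OF y(1)]] in
        \<open>simp_all add: induced_metric_cv[OF y] o_def\<close>)
  have "laplace_beltrami M (induced_metric X g) D\<^sub>M f y =
    (\<Sum>i\<in>I. (hess (f \<circ> m.\<xi>) (\<phi> y) (P (w i)) (P (w i))
      - fderiv (f \<circ> m.\<xi>) (\<phi> y) (m.\<Gamma> y (P (w i)) (P (w i))))
      / induced_metric X g y (m.cv y (P (w i))) (m.cv y (P (w i))))"
    unfolding laplace_beltrami_def T
  proof (rule m.trace_hessian[where w = "\<lambda>i. P (w i)", OF yU f I bil])
    show "induced_metric X g y (m.cv y a) (m.cv y b) = induced_metric X g y (m.cv y b) (m.cv y a)" for a b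
      using G_sym[OF y(1)] by (simp add: induced_metric_cv[OF y])
  qed (use orth G_pos[OF y(1) nz] AP in \<open>auto simp: induced_metric_cv[OF y]\<close>)
  then show ?thesis using AP by (simp add: induced_metric_cv[OF y])
qed

end

section \<open>Penalization\<close>

definition usc_on :: "'e::topological_space set \<Rightarrow> ('e \<Rightarrow> real) \<Rightarrow> bool"
  where "usc_on K h \<longleftrightarrow> (\<forall>a. openin (top_of_set K) {p \<in> K. h p < a})"

lemma usc_on_diff:
  assumes "usc_on K h" "continuous_on K f"
  shows "usc_on K (\<lambda>p. h p - f p)"
  unfolding usc_on_def
proof
  fix a
  \<comment> \<open>A threshold \<open>b\<close> between \<open>h p\<close> and
    \<open>a + f p\<close> separates the semi-continuous condition from the continuous one.\<close>
  have "{p \<in> K. h p - f p < a} = (\<Union>b. {p \<in> K. h p < b} \<inter> (K \<inter> f -` {b - a<..}))"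
  proof (intro equalityI subsetI)
    fix p assume p: "p \<in> {p \<in> K. h p - f p < a}"
    then obtain b where "h p < b" "b < a + f p" using dense[of "h p" "a + f p"] by auto
    then show "p \<in> (\<Union>b. {p \<in> K. h p < b} \<inter> (K \<inter> f -` {b - a<..}))" using p by auto
  qed auto
  moreover have "openin (top_of_set K) ({p \<in> K. h p < b} \<inter> (K \<inter> f -` {b - a<..}))" for b
    using assms(1) continuous_openin_preimage_gen[OF assms(2) open_greaterThan]
    unfolding usc_on_def by blast
  ultimately show "openin (top_of_set K) {p \<in> K. h p - f p < a}" by auto
qed

text \<open>Without a maximum the sets where \<open>h\<close> is below one of its values cover
  \<open>K\<close>. In a finite subcover the point with the largest such value is left
  uncovered.\<close>

lemma usc_on_attains_max:
  assumes "usc_on K h" "compact K" "K \<noteq> {}"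
  shows "\<exists>x\<in>K. \<forall>y\<in>K. h y \<le> h x"
proof (rule ccontr)
  assume "\<not> ?thesis"
  then have *: "\<forall>x\<in>K. \<exists>y\<in>K. h x < h y" by (auto simp: not_le)
  let ?C = "(\<lambda>y. {p \<in> K. h p < h y}) ` K"
  have "(\<forall>c\<in>?C. openin (top_of_set K) c) \<and> K \<subseteq> \<Union>?C"
    using assms(1) * unfolding usc_on_def by blast
  then obtain D where D: "D \<subseteq> ?C" "finite D" "K \<subseteq> \<Union>D"
    using assms(2) unfolding compact_eq_openin_cover by meson
  obtain Y where Y: "Y \<subseteq> K" "finite Y" "D = (\<lambda>y. {p \<in> K. h p < h y}) ` Y"
    using finite_subset_image[OF D(2,1)] by blast
  have "Y \<noteq> {}" using D(3) Y(3) assms(3) by auto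
  then have "Max (h ` Y) \<in> h ` Y" using Y(2) by (intro Max_in) auto
  then obtain y where y: "y \<in> Y" "h y = Max (h ` Y)" by auto
  have "h z \<le> h y" if "z \<in> Y" for z using y(2) Y(2) that by auto
  moreover obtain z where "z \<in> Y" "h y < h z" using D(3) Y(1,3) y(1) by blast
  ultimately show False by force
qed

lemma usc_on_sequence:
  assumes "usc_on K h" "\<And>n. y n \<in> K" "y \<longlonglongrightarrow> z" "z \<in> K" "h z < a"
  shows "\<forall>\<^sub>F n in sequentially. h (y n) < a"
proof -
  obtain T where T: "open T" "{p \<in> K. h p < a} = K \<inter> T"
    using assms(1) unfolding usc_on_def openin_open by metis
  then have "z \<in> T" using assms(4,5) by auto
  from topological_tendstoD[OF assms(3) T(1) this] show ?thesis
    by eventually_elim (use T(2) assms(2) in blast)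
qed

text \<open>Comparison with \<open>p0\<close> bounds \<open>n * q (Y n)\<close> by
  \<open>h (Y n)\<close>, hence by the maximum of \<open>h\<close>, so \<open>q\<close> vanishes at
  any cluster point. There \<open>h\<close> is not negative, and strictness leaves only
  \<open>p0\<close>. The weights are the indices of the convergent subsequence.\<close>

lemma penalization:
  fixes v f q :: "'e::euclidean_space \<Rightarrow> real"
  assumes K: "compact K" "p0 \<in> K" and v: "usc_on K v"
    and f: "continuous_on K f" and q: "continuous_on K q" "\<And>p. 0 \<le> q p" "q p0 = 0"
    and eq: "v p0 = f p0" and strict: "\<And>p. p \<in> K \<Longrightarrow> q p = 0 \<Longrightarrow> p \<noteq> p0 \<Longrightarrow> v p < f p"
  obtains y :: "nat \<Rightarrow> 'e" and m :: "nat \<Rightarrow> real" where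
    "\<And>n. y n \<in> K" "\<And>n. 0 \<le> m n" "y \<longlonglongrightarrow> p0" "(\<lambda>n. m n * q (y n)) \<longlonglongrightarrow> 0"
    "\<And>n p. p \<in> K \<Longrightarrow> v p - f p - m n * q p \<le> v (y n) - f (y n) - m n * q (y n)"
proof -
  define h where "h = (\<lambda>p. v p - f p)"
  have h: "usc_on K h" unfolding h_def by (rule usc_on_diff[OF v f])
  have "\<exists>y\<in>K. \<forall>p\<in>K. h p - real n * q p \<le> h y - real n * q y" for n
    using K by (intro usc_on_attains_max usc_on_diff[OF h] continuous_intros q(1)) auto
  then obtain Y where Y: "\<And>n. Y n \<in> K" "\<And>n p. p \<in> K \<Longrightarrow> h p - real n * q p \<le> h (Y n) - real n * q (Y n)"
    by metis
  obtain B where B: "\<And>p. p \<in> K \<Longrightarrow> h p \<le> B"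
    using usc_on_attains_max[OF h K(1)] K(2) by blast
  have le: "real n * q (Y n) \<le> h (Y n)" for n
    using Y(2)[OF K(2), of n] q(3) eq by (simp add: h_def)
  obtain z r where z: "z \<in> K" "strict_mono r" "(Y \<circ> r) \<longlonglongrightarrow> z"
    using K(1) Y(1) unfolding compact_def by metis
  have qY: "(\<lambda>n. q ((Y \<circ> r) n)) \<longlonglongrightarrow> q z"
    using continuous_on_tendsto_compose[OF q(1) z(3,1)] Y(1) by simp
  have "(\<lambda>n. q (Y n)) \<longlonglongrightarrow> 0"
  proof (rule tendsto_sandwich[OF _ _ tendsto_const lim_const_over_n[of B]])
    show "\<forall>\<^sub>F n in sequentially. 0 \<le> q (Y n)" using q(2) by simp
    show "\<forall>\<^sub>F n in sequentially. q (Y n) \<le> B / real n"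
    proof (rule eventually_sequentiallyI[of 1])
      fix n :: nat assume "1 \<le> n"
      then show "q (Y n) \<le> B / real n"
        using order_trans[OF le[of n] B[OF Y(1)[of n]]] by (simp add: field_simps)
    qed
  qed
  from LIMSEQ_subseq_LIMSEQ[OF this z(2)] have "q z = 0"
    using LIMSEQ_unique[OF qY] by (simp add: o_def)
  have hY: "0 \<le> real n * q (Y n)" for n using q(2) by simp
  \<comment> \<open>By semi-continuity a negative value at \<open>z\<close> would persist along the
    sequence, where \<open>h\<close> is bounded below by the penalty and hence by zero.\<close>
  have "\<not> h z < 0"
  proof
    assume "h z < 0"
    from usc_on_sequence[OF h _ z(3,1) this] have "\<forall>\<^sub>F n in sequentially. h ((Y \<circ> r) n) < 0"
      using Y(1) by simp
    then obtain n where "h (Y (r n)) < 0" by (auto simp: eventually_sequentially)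
    then show False using le[of "r n"] hY[of "r n"] by linarith
  qed
  then have zp: "z = p0" using strict[OF z(1) \<open>q z = 0\<close>] by (auto simp: h_def)
  \<comment> \<open>Semi-continuity at \<open>p0\<close>, where \<open>h\<close> is zero, makes
    \<open>h\<close> less than \<open>e\<close> along the sequence, and the penalty lies between
    \<open>0\<close> and \<open>h\<close>.\<close>
  have lim: "(\<lambda>n. real (r n) * q (Y (r n))) \<longlonglongrightarrow> 0"
  proof (rule tendstoI)
    fix e :: real assume "e > 0"
    then have "h z < e" using zp eq by (simp add: h_def)
    from usc_on_sequence[OF h _ z(3,1) this] have "\<forall>\<^sub>F n in sequentially. h ((Y \<circ> r) n) < e"
      using Y(1) by simp
    then show "\<forall>\<^sub>F n in sequentially. dist (real (r n) * q (Y (r n))) 0 < e"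
    proof eventually_elim
      case (elim n)
      then show ?case using le[of "r n"] hY[of "r n"] by simp
    qed
  qed
  show thesis
    by (rule that[of "Y \<circ> r" "\<lambda>n. real (r n)"]) (use Y z zp lim in \<open>auto simp: h_def o_def\<close>)
qed

text \<open>Serves two perturbations: \<open>L = P\<close> with \<open>m = \<delta>\<close> makes
  the test function strict, and \<open>L = \<tau>\<close> with \<open>c = 0\<close> is the penalty.
  The constant \<open>k\<close> lifts the function until it touches \<open>u\<close>.\<close>

lemma derivatives_add_square:
  fixes f :: "'e::euclidean_space \<Rightarrow> real" and L :: "'e \<Rightarrow> 'b::euclidean_space" and m k :: real and c :: 'b
  assumes S: "open S" "C_infinity f S" and L: "linear L" and p: "p \<in> S"
  defines "h \<equiv> \<lambda>p. f p + m * ((L p - c) \<bullet> (L p - c)) + k"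
  shows "fderiv h p b = fderiv f p b + m * (2 * ((L p - c) \<bullet> L b))"
    and "hess h p a b =
      hess f p a b + m * (2 * (L a \<bullet> L b))"
    and "C_infinity h S"
proof -
  have dL: "(L has_derivative L) (at q)" for q by (rule linear_imp_has_derivative[OF L])
  have d: "((\<lambda>p. L p - c) has_derivative L) (at q)" for q
    using has_derivative_diff[OF dL has_derivative_const] by simp
  have dh: "(h has_derivative (\<lambda>e. fderiv f q e + m * (2 * ((L q - c) \<bullet> L e)))) (at q)"
    if "q \<in> S" for q
  proof -
    have "(h has_derivative (\<lambda>e. fderiv f q e + m * ((L q - c) \<bullet> L e + L e \<bullet> (L q - c)) + 0)) (at q)"
      unfolding h_def
      by (intro has_derivative_add has_derivative_const has_derivative_mult_right has_derivative_inner d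
          C_infinity_has_derivative[OF S(2) that])
    then show ?thesis by (simp add: inner_commute[of "L _" "L q - c"])
  qed
  have 1: "fderiv h q b = fderiv f q b + m * (2 * ((L q - c) \<bullet> L b))"
    if "q \<in> S" for q b
    using fun_cong[OF frechet_derivative_at[OF dh[OF that]], of b] by simp
  show "fderiv h p b = fderiv f p b + m * (2 * ((L p - c) \<bullet> L b))"
    by (rule 1[OF p])
  have "((\<lambda>q. fderiv f q b + m * (2 * ((L q - c) \<bullet> L b))) has_derivative
      (\<lambda>a. hess f p a b + m * (2 * (L a \<bullet> L b)))) (at p)"
    by (intro has_derivative_add has_derivative_mult_right d
        bounded_linear.has_derivative[OF bounded_linear_inner_left]
        C_infinity_has_derivative[OF C_infinity_frechet[OF S(2)] p])
  from frechet_derivative_at[OF this]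
  have "fderiv (\<lambda>q. fderiv f q b + m * (2 * ((L q - c) \<bullet> L b))) p a =
      hess f p a b + m * (2 * (L a \<bullet> L b))"
    by metis
  then show "hess h p a b =
      hess f p a b + m * (2 * (L a \<bullet> L b))"
    using frechet_derivative_eq_on_open[OF S(1) p 1] by simp
  have Lc: "C_infinity (\<lambda>p. L p - c) S"
    by (intro C_infinity_diff C_infinity_linear C_infinity_const S(1) L)
  show "C_infinity h S"
    unfolding h_def
    by (intro C_infinity_add[OF S(1)] S(2) C_infinity_const C_infinity_mult[OF S(1)] C_infinity_inner[OF S(1)] Lc)
qed

lemma derivatives_compose_linear:
  fixes f :: "'f::euclidean_space \<Rightarrow> real" and P :: "'e::euclidean_space \<Rightarrow> 'f"
  assumes S: "open S" "C_infinity f S" and P: "linear P" and p: "P p \<in> S"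
  shows "fderiv (\<lambda>p. f (P p)) p b = fderiv f (P p) (P b)"
    and "hess (\<lambda>p. f (P p)) p a b =
      hess f (P p) (P a) (P b)"
proof -
  have dP: "(P has_derivative P) (at q)" for q by (rule linear_imp_has_derivative[OF P])
  have comp: "fderiv (\<lambda>p. F (P p)) q = (\<lambda>e. fderiv F (P q) (P e))"
    if "C_infinity F S" "P q \<in> S" for F :: "'f \<Rightarrow> real" and q
    by (rule frechet_derivative_at[OF has_derivative_compose[OF dP C_infinity_has_derivative[OF that]], symmetric])
  show "fderiv (\<lambda>p. f (P p)) p b = fderiv f (P p) (P b)"
    by (simp add: comp[OF S(2) p])
  have o: "open (P -` S)"
    using P by (intro open_vimage[OF S(1)]) (simp add: linear_continuous_on linear_conv_bounded_linear)
  have "fderiv (\<lambda>p. fderiv (\<lambda>p. f (P p)) p b) p =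
      fderiv (\<lambda>p. fderiv f (P p) (P b)) p"
    by (rule frechet_derivative_eq_on_open[OF o]) (use p comp[OF S(2)] in auto)
  then show "hess (\<lambda>p. f (P p)) p a b =
      hess f (P p) (P a) (P b)"
    using comp[OF C_infinity_frechet[OF S(2)] p] by simp
qed

text \<open>Compare \<open>k p\<close> with \<open>k (R p) = 0\<close> by the local Lipschitz bound;
  continuity of \<open>R\<close> keeps \<open>R p\<close> in the same ball.\<close>

lemma vanishing_bound:
  fixes k :: "'e::euclidean_space \<Rightarrow> 'b::real_normed_vector" and R :: "'e \<Rightarrow> 'e"
  assumes S: "open S" "p0 \<in> S" "C_infinity k S" and R: "linear R" "\<And>p. R (R p) = R p" "R p0 = p0"
    and z: "\<And>p. p \<in> S \<Longrightarrow> R p = p \<Longrightarrow> k p = 0"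
  shows "\<exists>C. \<forall>\<^sub>F p in nhds p0. norm (k p) \<le> C * norm (p - R p)"
proof -
  obtain r L where r: "r > 0" "ball p0 r \<subseteq> S" "L \<ge> 0"
    "\<And>x y. x \<in> ball p0 r \<Longrightarrow> y \<in> ball p0 r \<Longrightarrow> norm (k x - k y) \<le> L * norm (x - y)"
    using C_infinity_lipschitz[OF S(3,1,2)] by metis
  have "isCont R p0" using R(1) by (simp add: linear_continuous_at linear_conv_bounded_linear)
  then have "(R \<longlongrightarrow> p0) (nhds p0)"
    using tendsto_at_iff_tendsto_nhds[of R p0] R(3) by (simp add: isCont_def)
  then have "\<forall>\<^sub>F p in nhds p0. R p \<in> ball p0 r"
    using r(1) by (intro topological_tendstoD) auto
  moreover have "\<forall>\<^sub>F p in nhds p0. p \<in> ball p0 r"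
    using r(1) by (intro eventually_nhds_in_open) auto
  ultimately have "\<forall>\<^sub>F p in nhds p0. norm (k p) \<le> L * norm (p - R p)"
  proof eventually_elim
    case (elim p)
    then have "k (R p) = 0" using z[of "R p"] R(2) r(2) by auto
    then show ?case using r(4)[of p "R p"] elim by simp
  qed
  then show ?thesis by blast
qed

text \<open>A product of two quantities of first order in \<open>t\<close> is quadratic in
  \<open>t\<close>, which is the order that the penalization controls.\<close>

lemma vanishing_inner_bound:
  fixes k l :: "'e::euclidean_space \<Rightarrow> 'b::real_inner" and t :: "'e \<Rightarrow> 'c::real_inner"
  assumes "\<exists>C. \<forall>\<^sub>F p in F. norm (k p) \<le> C * norm (t p)" "\<exists>C. \<forall>\<^sub>F p in F. norm (l p) \<le> C * norm (t p)"
  shows "\<exists>C. \<forall>\<^sub>F p in F. \<bar>k p \<bullet> l p\<bar> \<le> C * (t p \<bullet> t p)"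
proof -
  obtain C C' where C: "\<forall>\<^sub>F p in F. norm (k p) \<le> C * norm (t p)" "\<forall>\<^sub>F p in F. norm (l p) \<le> C' * norm (t p)"
    using assms by blast
  have "\<forall>\<^sub>F p in F. \<bar>k p \<bullet> l p\<bar> \<le> (C * C') * (t p \<bullet> t p)"
    using C
  proof eventually_elim
    case (elim p)
    have "\<bar>k p \<bullet> l p\<bar> \<le> norm (k p) * norm (l p)" by (rule Cauchy_Schwarz_ineq2)
    also have "\<dots> \<le> (C * norm (t p)) * (C' * norm (t p))"
      using elim by (intro mult_mono) (auto intro: order_trans[OF norm_ge_zero])
    also have "\<dots> = (C * C') * (t p \<bullet> t p)" by (simp add: dot_square_norm power2_eq_square)
    finally show ?case .
  qed
  then show ?thesis by blast
qed

lemma sum_bound: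
  fixes k :: "'i \<Rightarrow> 'e \<Rightarrow> real"
  assumes "finite I" "\<And>i. i \<in> I \<Longrightarrow> \<exists>C. \<forall>\<^sub>F p in F. \<bar>k i p\<bar> \<le> C * t p"
  shows "\<exists>C. \<forall>\<^sub>F p in F. \<bar>\<Sum>i\<in>I. k i p\<bar> \<le> C * t p"
proof -
  obtain C where C: "\<And>i. i \<in> I \<Longrightarrow> \<forall>\<^sub>F p in F. \<bar>k i p\<bar> \<le> C i * t p" using assms(2) by metis
  have "\<forall>\<^sub>F p in F. \<forall>i\<in>I. \<bar>k i p\<bar> \<le> C i * t p"
    using C assms(1) by (simp add: eventually_ball_finite_distrib)
  then have "\<forall>\<^sub>F p in F. \<bar>\<Sum>i\<in>I. k i p\<bar> \<le> (\<Sum>i\<in>I. C i) * t p"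
    by eventually_elim (auto simp: sum_distrib_right intro!: order_trans[OF sum_abs] sum_mono)
  then show ?thesis by blast
qed

section \<open>The viscosity argument\<close>

text \<open>The frame is orthogonal on all of \<open>N\<close>, but its span is prescribed only
  along \<open>M\<close>. That the planes off \<open>M\<close> are Lagrangian is left out here; it
  enters through the hypothesis on traces in \<open>perturbed_inequality\<close>.\<close>

locale framed_chart = adapted_riemannian_chart X V \<psi> M U \<phi> A P g D D\<^sub>M
  for X :: "('a, 'e::euclidean_space) mfd" and V \<psi> and M :: "('a, 'f::euclidean_space) mfd" and U \<phi> A P
    and g D D\<^sub>M +
  fixes N :: "'e set" and I :: "'i set" and w :: "'i \<Rightarrow> 'e \<Rightarrow> 'e"
  assumes open_N: "open N" and N_subset: "N \<subseteq> \<psi> ` V" and finite_I: "finite I"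
    and smooth_w: "i \<in> I \<Longrightarrow> C_infinity (w i) N"
    and orth_w: "p \<in> N \<Longrightarrow> i \<in> I \<Longrightarrow> j \<in> I \<Longrightarrow> i \<noteq> j \<Longrightarrow> G (\<xi> p) (w i p) (w j p) = 0"
    and w_nonzero: "p \<in> N \<Longrightarrow> i \<in> I \<Longrightarrow> w i p \<noteq> 0"
    and span_w: "p \<in> N \<Longrightarrow> \<xi> p \<in> pts M \<Longrightarrow> span ((\<lambda>i. w i p) ` I) = range A"
    and minimal: "y \<in> V \<Longrightarrow> y \<in> pts M \<Longrightarrow> mean_curvature X g D M y = 0"
begin

lemma in_V: "p \<in> N \<Longrightarrow> \<xi> p \<in> V"
  using N_subset by auto

lemma \<psi>_\<xi>_N: "p \<in> N \<Longrightarrow> \<psi> (\<xi> p) = p"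
  using N_subset by auto

definition nw :: "'i \<Rightarrow> 'e \<Rightarrow> real" where "nw i p = G (\<xi> p) (w i p) (w i p)"

definition \<Gamma>w :: "'i \<Rightarrow> 'e \<Rightarrow> 'e" where "\<Gamma>w i p = \<Gamma> (\<xi> p) (w i p) (w i p)"

text \<open>The trace of the Hessian over the plane spanned by the frame, as an operator on
  functions of the coordinates; \<open>nw\<close> accounts for the lengths of the frame
  vectors.\<close>

definition trace_hess :: "('e \<Rightarrow> real) \<Rightarrow> 'e \<Rightarrow> real"
  where "trace_hess h p = (\<Sum>i\<in>I. (hess h p (w i p) (w i p)
    - fderiv h p (\<Gamma>w i p)) / nw i p)"

lemma nw_pos: "p \<in> N \<Longrightarrow> i \<in> I \<Longrightarrow> nw i p > 0"
  unfolding nw_def by (rule G_pos[OF in_V w_nonzero])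

lemma smooth_G: "C_infinity (\<lambda>p. G (\<xi> p) a b) (\<psi> ` V)"
proof (rule C_infinity_local)
  fix p assume "p \<in> \<psi> ` V"
  then obtain y where y: "y \<in> V" "p = \<psi> y" by auto
  obtain K where "y \<in> K" "open (\<psi> ` K)" "C_infinity ((\<lambda>z. g z (cv z a) (cv z b)) \<circ> \<xi>) (\<psi> ` K)"
    using smooth_near_chart[OF smooth_g[OF y(1)] y(1)] by metis
  then show "\<exists>T. open T \<and> p \<in> T \<and> C_infinity (\<lambda>p. G (\<xi> p) a b) T"
    using y(2) by (intro exI[of _ "\<psi> ` K"]) (auto simp: G_def o_def)
qed

lemma smooth_nw: "i \<in> I \<Longrightarrow> C_infinity (nw i) N"
  unfolding nw_def
proof (rule C_infinity_apply[where h = "\<lambda>p. G (\<xi> p) (w i p)", OF open_N linear_G_right[OF in_V]])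
  show "C_infinity (\<lambda>p. G (\<xi> p) (w i p) e) N" if i: "i \<in> I" for e
    by (rule C_infinity_apply[where h = "\<lambda>p x. G (\<xi> p) x e", OF open_N linear_G_left[OF in_V]
          C_infinity_subset[OF smooth_G N_subset] smooth_w[OF i]])
qed (auto intro: smooth_w)

lemma smooth_\<Gamma>w: "i \<in> I \<Longrightarrow> C_infinity (\<Gamma>w i) N"
  unfolding \<Gamma>w_def
proof (rule C_infinity_apply[where h = "\<lambda>p. \<Gamma> (\<xi> p) (w i p)", OF open_N linear_\<Gamma>_right[OF in_V]])
  show "C_infinity (\<lambda>p. \<Gamma> (\<xi> p) (w i p) e) N" if i: "i \<in> I" for e
    by (rule C_infinity_apply[where h = "\<lambda>p x. \<Gamma> (\<xi> p) x e", OF open_N linear_\<Gamma>_left[OF in_V]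
          C_infinity_subset[OF smooth_\<Gamma> N_subset] smooth_w[OF i]])
qed (auto intro: smooth_w)

lemma trace_hessian_frame:
  assumes p: "p \<in> N" and f: "smooth_near X (\<xi> p) f"
  shows "trace_on (g (\<xi> p)) (cv (\<xi> p) ` span ((\<lambda>i. w i p) ` I)) (hessian X D f (\<xi> p)) = trace_hess (f \<circ> \<xi>) p"
proof -
  have "trace_on (g (\<xi> p)) (cv (\<xi> p) ` span ((\<lambda>i. w i p) ` I)) (hessian X D f (\<xi> p)) =
    (\<Sum>i\<in>I. (hess (f \<circ> \<xi>) (\<psi> (\<xi> p)) (w i p) (w i p)
      - fderiv (f \<circ> \<xi>) (\<psi> (\<xi> p)) (\<Gamma> (\<xi> p) (w i p) (w i p)))
      / g (\<xi> p) (cv (\<xi> p) (w i p)) (cv (\<xi> p) (w i p)))"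
    by (rule trace_hessian[OF in_V[OF p] f finite_I bilinear_g[OF in_V[OF p]]])
      (use G_sym[OF in_V[OF p]] orth_w[OF p] nw_pos[OF p] in \<open>auto simp: G_def nw_def\<close>)
  then show ?thesis
    by (simp add: trace_hess_def nw_def G_def \<Gamma>w_def \<psi>_\<xi>_N[OF p])
qed

lemma smooth_trace_hess:
  assumes S: "open S" "S \<subseteq> N" and h: "C_infinity h S"
  shows "C_infinity (trace_hess h) S"
  unfolding trace_hess_def
proof (rule C_infinity_sum[OF S(1)], rule C_infinity_divide[OF S(1) C_infinity_diff[OF S(1)]])
  fix i assume i: "i \<in> I"
  have wS: "C_infinity (w i) S" by (rule C_infinity_subset[OF smooth_w[OF i] S(2)])
  show "C_infinity (\<lambda>p. fderiv h p (\<Gamma>w i p)) S"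
    by (rule C_infinity_frechet_apply[OF S(1) h C_infinity_subset[OF smooth_\<Gamma>w[OF i] S(2)]])
  show "C_infinity (\<lambda>p. hess h p (w i p) (w i p)) S"
  proof (rule C_infinity_apply[where h = "\<lambda>p e. hess h p (w i p) e",
        OF S(1) second_derivative_linear[OF S(1) h] _ wS])
    show "C_infinity (\<lambda>p. hess h p (w i p) e) S" for e
      by (rule C_infinity_frechet_apply[OF S(1) C_infinity_frechet[OF h] wS])
  qed
  show "C_infinity (nw i) S" by (rule C_infinity_subset[OF smooth_nw[OF i] S(2)])
  show "nw i p \<noteq> 0" if "p \<in> S" for p using nw_pos[of p i] that S(2) i by auto
qed

lemma trace_hess_cong:
  assumes "open S" "p \<in> S" "\<And>q. q \<in> S \<Longrightarrow> f q = h q"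
  shows "trace_hess f p = trace_hess h p"
proof -
  have 1: "fderiv f q = fderiv h q" if "q \<in> S" for q
    by (rule frechet_derivative_eq_on_open[OF assms(1) that assms(3)])
  have "fderiv (\<lambda>q. fderiv f q e) p =
      fderiv (\<lambda>q. fderiv h q e) p" for e
    by (rule frechet_derivative_eq_on_open[OF assms(1,2)]) (simp add: 1)
  then show ?thesis by (simp add: trace_hess_def 1[OF assms(2)])
qed

lemma trace_hess_add_square:
  fixes L :: "'e \<Rightarrow> 'b::euclidean_space"
  assumes S: "open S" "C_infinity f S" and L: "linear L" and p: "p \<in> S"
  shows "trace_hess (\<lambda>p. f p + m * ((L p - c) \<bullet> (L p - c)) + k) p = trace_hess f p
    + m * (\<Sum>i\<in>I. (2 * (L (w i p) \<bullet> L (w i p)) - 2 * ((L p - c) \<bullet> L (\<Gamma>w i p))) / nw i p)"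
  unfolding trace_hess_def derivatives_add_square(1,2)[OF S L p]
  by (simp add: sum_distrib_left add_divide_distrib diff_divide_distrib right_diff_distrib
      flip: sum.distrib) (rule sum.cong, auto simp: algebra_simps)

lemma A_P_fixed: "p \<in> N \<Longrightarrow> A (P p) = p \<longleftrightarrow> \<xi> p \<in> pts M"
  using mem_iff[OF in_V] \<psi>_\<xi>_N by metis

lemma w_in_range: "p \<in> N \<Longrightarrow> \<xi> p \<in> pts M \<Longrightarrow> i \<in> I \<Longrightarrow> A (P (w i p)) = w i p"
proof -
  assume "p \<in> N" "\<xi> p \<in> pts M" "i \<in> I"
  then have "w i p \<in> range A" using span_w[of p] by (metis image_eqI span_base)
  then show ?thesis by auto
qed

lemma trace_\<Gamma>:
  assumes p: "p \<in> N" "\<xi> p \<in> pts M"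
  shows "(\<Sum>i\<in>I. (1 / nw i p) *\<^sub>R \<Gamma>w i p) =
    A (\<Sum>i\<in>I. (1 / nw i p) *\<^sub>R m.\<Gamma> (\<xi> p) (P (w i p)) (P (w i p)))"
  unfolding nw_def \<Gamma>w_def
  by (rule mean_curvature_zero[OF in_V[OF p(1)] p(2) finite_I span_w[OF p] orth_w[OF p(1)] w_nonzero[OF p(1)]
        minimal[OF in_V[OF p(1)] p(2)]])

definition \<tau> :: "'e \<Rightarrow> 'e" where "\<tau> p = p - A (P p)"

lemma linear_AP: "linear (\<lambda>p. A (P p))"
  by (rule linear_comp[OF linear_P linear_A])

lemma linear_\<tau>: "linear \<tau>"
proof -
  have "linear (\<lambda>p. p - A (P p))"
    by (rule linear_compose_sub[OF linear_ident linear_AP])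
  then show ?thesis by (simp add: \<tau>_def[abs_def])
qed

text \<open>The penalty \<open>|\<tau>|\<^sup>2\<close> contributes two terms: \<open>|\<tau> w\<^sub>i|\<^sup>2\<close>, which is quadratic in \<open>\<tau>\<close> as the frame is
  tangent to \<open>M\<close> along \<open>M\<close>, and \<open>\<tau> p \<bullet> \<tau> (\<Sum> \<Gamma>(w\<^sub>i, w\<^sub>i))\<close>, where the second factor vanishes on \<open>M\<close> by
  minimality.\<close>

lemma penalty_bound:
  assumes p0: "p0 \<in> N" "\<xi> p0 \<in> pts M"
  shows "\<exists>C. \<forall>\<^sub>F p in nhds p0.
    \<bar>\<Sum>i\<in>I. (2 * (\<tau> (w i p) \<bullet> \<tau> (w i p)) - 2 * ((\<tau> p - 0) \<bullet> \<tau> (\<Gamma>w i p))) / nw i p\<bar> \<le> C * (\<tau> p \<bullet> \<tau> p)"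
proof -
  have bl: "bounded_linear \<tau>" using linear_\<tau> by (simp add: linear_conv_bounded_linear)
  have vb: "\<exists>C. \<forall>\<^sub>F p in nhds p0. norm (k p) \<le> C * norm (\<tau> p)"
    if "C_infinity k N" "\<And>p. p \<in> N \<Longrightarrow> \<xi> p \<in> pts M \<Longrightarrow> k p = 0" for k :: "'e \<Rightarrow> 'e"
    unfolding \<tau>_def
    by (rule vanishing_bound[OF open_N p0(1) that(1) linear_AP])
      (use that(2) A_P_fixed p0 in auto)
  have nwi: "C_infinity (\<lambda>p. 1 / nw i p) N" if i: "i \<in> I" for i
    by (rule C_infinity_divide[OF open_N C_infinity_const smooth_nw[OF i]])
      (use nw_pos[OF _ i] in force)
  have sw: "C_infinity (\<lambda>p. \<tau> (w i p)) N" if i: "i \<in> I" for i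
    by (rule C_infinity_bounded_linear[OF open_N bl smooth_w[OF i]])
  have 1: "\<exists>C. \<forall>\<^sub>F p in nhds p0. \<bar>\<Sum>i\<in>I. \<tau> (w i p) \<bullet> (1 / nw i p) *\<^sub>R \<tau> (w i p)\<bar> \<le> C * (\<tau> p \<bullet> \<tau> p)"
  proof (rule sum_bound[OF finite_I vanishing_inner_bound])
    fix i assume i: "i \<in> I"
    have z: "\<tau> (w i p) = 0" if "p \<in> N" "\<xi> p \<in> pts M" for p
      using w_in_range[OF that i] by (simp add: \<tau>_def)
    show "\<exists>C. \<forall>\<^sub>F p in nhds p0. norm (\<tau> (w i p)) \<le> C * norm (\<tau> p)"
      by (rule vb[OF sw[OF i] z])
    show "\<exists>C. \<forall>\<^sub>F p in nhds p0. norm ((1 / nw i p) *\<^sub>R \<tau> (w i p)) \<le> C * norm (\<tau> p)"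
      by (rule vb[OF C_infinity_scaleR[OF open_N nwi[OF i] sw[OF i]]]) (simp add: z)
  qed
  \<comment> \<open>The single vectors \<open>\<Gamma>w i p\<close> may have normal components on
    \<open>M\<close>. The weighted sum has to be formed inside \<open>\<tau>\<close> before
    estimating, since only the sum becomes tangential.\<close>
  have 2: "\<exists>C. \<forall>\<^sub>F p in nhds p0. \<bar>\<tau> p \<bullet> \<tau> (\<Sum>i\<in>I. (1 / nw i p) *\<^sub>R \<Gamma>w i p)\<bar> \<le> C * (\<tau> p \<bullet> \<tau> p)"
  proof (rule vanishing_inner_bound)
    show "\<exists>C. \<forall>\<^sub>F p in nhds p0. norm (\<tau> p) \<le> C * norm (\<tau> p)"
      by (rule exI[of _ 1]) simp
    show "\<exists>C. \<forall>\<^sub>F p in nhds p0. norm (\<tau> (\<Sum>i\<in>I. (1 / nw i p) *\<^sub>R \<Gamma>w i p)) \<le> C * norm (\<tau> p)"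
    proof (rule vb)
      show "C_infinity (\<lambda>p. \<tau> (\<Sum>i\<in>I. (1 / nw i p) *\<^sub>R \<Gamma>w i p)) N"
        by (rule C_infinity_bounded_linear[OF open_N bl C_infinity_sum[OF open_N]],
            rule C_infinity_scaleR[OF open_N nwi smooth_\<Gamma>w])
      show "\<tau> (\<Sum>i\<in>I. (1 / nw i p) *\<^sub>R \<Gamma>w i p) = 0" if "p \<in> N" "\<xi> p \<in> pts M" for p
        unfolding trace_\<Gamma>[OF that] by (simp add: \<tau>_def)
    qed
  qed
  have eq: "(\<Sum>i\<in>I. (2 * (\<tau> (w i p) \<bullet> \<tau> (w i p)) - 2 * ((\<tau> p - 0) \<bullet> \<tau> (\<Gamma>w i p))) / nw i p) =
      2 * (\<Sum>i\<in>I. \<tau> (w i p) \<bullet> (1 / nw i p) *\<^sub>R \<tau> (w i p)) - 2 * (\<tau> p \<bullet> \<tau> (\<Sum>i\<in>I. (1 / nw i p) *\<^sub>R \<Gamma>w i p))" for p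
    by (simp add: linear_sum[OF linear_\<tau>] linear_cmul[OF linear_\<tau>] inner_sum_right sum_distrib_left
        diff_divide_distrib sum_subtractf)
  obtain C1 C2 where C: "\<forall>\<^sub>F p in nhds p0. \<bar>\<Sum>i\<in>I. \<tau> (w i p) \<bullet> (1 / nw i p) *\<^sub>R \<tau> (w i p)\<bar> \<le> C1 * (\<tau> p \<bullet> \<tau> p)"
    "\<forall>\<^sub>F p in nhds p0. \<bar>\<tau> p \<bullet> \<tau> (\<Sum>i\<in>I. (1 / nw i p) *\<^sub>R \<Gamma>w i p)\<bar> \<le> C2 * (\<tau> p \<bullet> \<tau> p)"
    using 1 2 by blast
  show ?thesis
    unfolding eq
  proof (rule exI[of _ "2 * C1 + 2 * C2"], use C in eventually_elim)
    case (elim p)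
    then show ?case unfolding distrib_right by linarith
  qed
qed

text \<open>For the extension that is constant along the kernel of \<open>P\<close>, the
  second-order terms agree at once. The first-order terms agree because \<open>P\<close> carries the
  trace of \<open>\<Gamma>\<close> to that of the connection of \<open>M\<close>, by
  minimality.\<close>

lemma laplace_beltrami_trace_hess:
  assumes p0: "p0 \<in> N" "\<xi> p0 \<in> pts M" and S: "open S" "C_infinity (f \<circ> m.\<xi>) S" "P p0 \<in> S"
    and f: "smooth_near M (\<xi> p0) f"
  shows "trace_hess (\<lambda>p. (f \<circ> m.\<xi>) (P p)) p0 = laplace_beltrami M (induced_metric X g) D\<^sub>M f (\<xi> p0)"
proof -
  have \<phi>: "\<phi> (\<xi> p0) = P p0" using coordinates[OF in_V[OF p0(1)] p0(2)] \<psi>_\<xi>_N[OF p0(1)] by simp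
  have lin: "linear (fderiv (f \<circ> m.\<xi>) (P p0))"
    by (rule C_infinity_linear_frechet[OF S(2,3)])
  have "(\<Sum>i\<in>I. fderiv (f \<circ> m.\<xi>) (P p0) (P (\<Gamma>w i p0)) / nw i p0) =
      fderiv (f \<circ> m.\<xi>) (P p0) (P (\<Sum>i\<in>I. (1 / nw i p0) *\<^sub>R \<Gamma>w i p0))"
    by (simp add: linear_sum[OF linear_P] linear_cmul[OF linear_P] linear_sum[OF lin] linear_cmul[OF lin])
  also have "\<dots> = (\<Sum>i\<in>I. fderiv (f \<circ> m.\<xi>) (P p0) (m.\<Gamma> (\<xi> p0) (P (w i p0)) (P (w i p0))) / nw i p0)"
    unfolding trace_\<Gamma>[OF p0] by (simp add: linear_sum[OF lin] linear_cmul[OF lin])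
  finally have \<Gamma>: "(\<Sum>i\<in>I. fderiv (f \<circ> m.\<xi>) (P p0) (P (\<Gamma>w i p0)) / nw i p0) = \<dots>" .
  have "laplace_beltrami M (induced_metric X g) D\<^sub>M f (\<xi> p0) =
    (\<Sum>i\<in>I. (hess (f \<circ> m.\<xi>) (P p0) (P (w i p0)) (P (w i p0))
      - fderiv (f \<circ> m.\<xi>) (P p0) (m.\<Gamma> (\<xi> p0) (P (w i p0)) (P (w i p0)))) / nw i p0)"
    unfolding nw_def \<phi>[symmetric]
    by (rule laplace_beltrami_frame[OF in_V[OF p0(1)] p0(2) finite_I span_w[OF p0] orth_w[OF p0(1)] w_nonzero[OF p0(1)] f])
  then show ?thesis
    unfolding trace_hess_def derivatives_compose_linear[OF S(1,2) linear_P S(3)]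
    by (simp add: diff_divide_distrib sum_subtractf \<Gamma>)
qed

end

section \<open>Comparison of \<open>u\<close> with the penalized test functions\<close>

lemma (in chart) smooth_near_on:
  "opens X N \<Longrightarrow> y \<in> N \<Longrightarrow> smooth_on X N f \<Longrightarrow> smooth_near X y f"
  unfolding smooth_near_def by blast

text \<open>A lower truncation makes \<open>u\<close> real-valued; \<open>c\<close> will lie below the test function.\<close>

lemma (in chart) usc_on_truncation:
  assumes u: "usc X u" and K: "K \<subseteq> \<psi> ` U"
  shows "usc_on K (\<lambda>p. real_of_ereal (max (u (\<xi> p)) (ereal c)))"
    and "\<And>p. p \<in> K \<Longrightarrow> ereal (real_of_ereal (max (u (\<xi> p)) (ereal c))) = max (u (\<xi> p)) (ereal c)"
proof -
  have fin: "ereal (real_of_ereal (max (u (\<xi> p)) (ereal c))) = max (u (\<xi> p)) (ereal c)" if "p \<in> \<psi> ` U" for p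
  proof (rule ereal_real')
    have "u (\<xi> p) < \<infinity>" using u U_subset that unfolding usc_def by auto
    then show "\<bar>max (u (\<xi> p)) (ereal c)\<bar> \<noteq> \<infinity>"
      by (cases "u (\<xi> p)") (auto simp: max_def)
  qed
  then show "\<And>p. p \<in> K \<Longrightarrow> ereal (real_of_ereal (max (u (\<xi> p)) (ereal c))) = max (u (\<xi> p)) (ereal c)"
    using K by blast
  show "usc_on K (\<lambda>p. real_of_ereal (max (u (\<xi> p)) (ereal c)))"
    unfolding usc_on_def
  proof
    fix a
    have o: "open (\<psi> ` (U \<inter> {y \<in> pts X. u y < ereal a}))"
      using u by (intro open_image) (simp add: usc_def)
    have iff: "real_of_ereal (max (u (\<xi> p)) (ereal c)) < a \<longleftrightarrow> c < a \<and> p \<in> \<psi> ` (U \<inter> {y \<in> pts X. u y < ereal a})"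
      if p: "p \<in> K" for p
    proof -
      have pU: "p \<in> \<psi> ` U" using p K by auto
      have "real_of_ereal (max (u (\<xi> p)) (ereal c)) < a \<longleftrightarrow> max (u (\<xi> p)) (ereal c) < ereal a"
        using fin[OF pU] by (metis ereal_less(1) less_ereal.simps(1))
      also have "\<dots> \<longleftrightarrow> c < a \<and> u (\<xi> p) < ereal a" by auto
      also have "u (\<xi> p) < ereal a \<longleftrightarrow> p \<in> \<psi> ` (U \<inter> {y \<in> pts X. u y < ereal a})"
        using pU U_subset by auto
      finally show ?thesis .
    qed
    have "{p \<in> K. real_of_ereal (max (u (\<xi> p)) (ereal c)) < a} =
        (if c < a then K \<inter> \<psi> ` (U \<inter> {y \<in> pts X. u y < ereal a}) else {})"
      using iff by auto
    then show "openin (top_of_set K) {p \<in> K. real_of_ereal (max (u (\<xi> p)) (ereal c)) < a}"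
      using o by (simp add: openin_open_Int)
  qed
qed

context framed_chart
begin

text \<open>The traces at the maximizers are not negative; their limit at \<open>x\<close> is the
  Laplacian of \<open>f\<close> plus the contribution of the strictness term, since the penalty
  contributes nothing in the limit.\<close>

lemma perturbed_inequality:
  assumes x: "x \<in> V" "x \<in> pts M" "\<psi> x \<in> N" and u: "usc X u"
    and test: "\<And>p \<Phi>. p \<in> N \<Longrightarrow> test_function X u (\<xi> p) \<Phi> \<Longrightarrow>
      trace_on (g (\<xi> p)) (cv (\<xi> p) ` span ((\<lambda>i. w i p) ` I)) (hessian X D \<Phi> (\<xi> p)) \<ge> 0"
    and f: "test_function M u x f" and \<delta>: "\<delta> > 0"
  shows "0 \<le> laplace_beltrami M (induced_metric X g) D\<^sub>M f x + \<delta> * (\<Sum>i\<in>I. 2 * (P (w i (\<psi> x)) \<bullet> P (w i (\<psi> x))) / nw i (\<psi> x))"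
proof -
  define p0 where "p0 = \<psi> x"
  have p0: "p0 \<in> N" "\<xi> p0 = x" "A (P p0) = p0"
    using x mem_iff[OF x(1)] by (auto simp: p0_def)
  have xU: "x \<in> U" "\<phi> x = P p0" using coordinates[OF x(1,2)] by (auto simp: p0_def)
  obtain N1 where N1: "opens M N1" "x \<in> N1" "smooth_on M N1 f" "\<And>y. y \<in> N1 \<Longrightarrow> u y \<le> ereal (f y)"
    and ux: "u x = ereal (f x)"
    using f unfolding test_function_def by blast
  define N2 where "N2 = U \<inter> N1"
  have N2: "opens M N2" "x \<in> N2" "N2 \<subseteq> U"
    using N1 xU m.opens_U by (auto simp: N2_def)
  define S1 where "S1 = \<phi> ` N2"
  have S1: "open S1" "P p0 \<in> S1" using m.open_image'[OF N2(1,3)] N2(2) unfolding xU(2)[symmetric] by (auto simp: S1_def)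
  define F where "F = f \<circ> m.\<xi>"
  have F: "C_infinity F S1"
    unfolding F_def S1_def N2_def by (rule m.smooth_on_chart[OF N1(1,3)])
  have fF: "u y \<le> ereal (F (P (\<psi> y)))" if "y \<in> V" "y \<in> pts M" "P (\<psi> y) \<in> S1" for y
  proof -
    have y: "y \<in> U" "\<phi> y = P (\<psi> y)" using coordinates[OF that(1,2)] by auto
    then have "\<phi> y \<in> \<phi> ` N2" using that(3) by (simp add: S1_def)
    then obtain z where "z \<in> N2" "\<phi> y = \<phi> z" by blast
    then have "y \<in> N2" using y N2(3) m.inj by (metis inj_onD subsetD)
    then show ?thesis using N1(4)[of y] y(1) y(2)[symmetric] by (simp add: F_def N2_def)
  qed
  have contP: "continuous_on UNIV P"
    using linear_P by (simp add: linear_continuous_on linear_conv_bounded_linear)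
  define S where "S = N \<inter> P -` S1"
  have S: "open S" "p0 \<in> S" "S \<subseteq> N" "S \<subseteq> \<psi> ` V"
    using open_N open_vimage[OF S1(1) contP] p0 S1 N_subset by (auto simp: S_def)
  obtain r where r: "r > 0" "cball p0 r \<subseteq> S" using S(1,2) open_contains_cball by blast
  define K where "K = cball p0 r"
  have K: "compact K" "p0 \<in> K" "K \<subseteq> S" using r by (auto simp: K_def)
  have FP: "C_infinity (\<lambda>p. F (P p)) S"
    by (rule C_infinity_compose[OF S(1) S1(1) _ F C_infinity_linear[OF S(1) linear_P]]) (auto simp: S_def)
  \<comment> \<open>On \<open>M\<close> the coordinate \<open>P p\<close> determines
    \<open>p\<close>, so the square of \<open>P p - P p0\<close> is enough for strictness along
    \<open>M\<close>; off \<open>M\<close> the penalty acts. The final \<open>0\<close> matches the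
    shape of \<open>derivatives_add_square\<close>.\<close>
  define h where "h = (\<lambda>p. F (P p) + \<delta> * ((P p - P p0) \<bullet> (P p - P p0)) + 0)"
  have h: "C_infinity h S"
    unfolding h_def by (rule derivatives_add_square(3)[OF S(1) FP linear_P S(2)])
  have hF: "F (P p) < h p" if "P p \<noteq> P p0" for p
    using that \<delta> by (simp add: h_def)
  have hc: "continuous_on K h" by (rule continuous_on_subset[OF C_infinity_continuous_on[OF h] K(3)])
  obtain z where z: "z \<in> K" "\<And>p. p \<in> K \<Longrightarrow> h z \<le> h p"
    using continuous_attains_inf[OF K(1) _ hc] K(2) by blast
  \<comment> \<open>One less than the minimum of \<open>h\<close> on \<open>K\<close>. At a
    maximizer the truncated function is at least \<open>h\<close>, hence above \<open>c\<close>, so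
    there the truncation has no effect.\<close>
  define c where "c = h z - 1"
  have c: "c < h p" if "p \<in> K" for p using z(2)[OF that] by (simp add: c_def)
  define v where "v = (\<lambda>p. real_of_ereal (max (u (\<xi> p)) (ereal c)))"
  have KV: "K \<subseteq> \<psi> ` V" using K(3) S(4) by blast
  have v: "usc_on K v" and vu: "ereal (v p) = max (u (\<xi> p)) (ereal c)" if "p \<in> K" for p
    unfolding v_def using usc_on_truncation[OF u KV] that by auto
  have uv: "u (\<xi> p) \<le> ereal (v p)" if "p \<in> K" for p
    using vu[OF that] by simp
  define q where "q = (\<lambda>p. (\<tau> p - 0) \<bullet> (\<tau> p - 0))"

  have q: "continuous_on K q" "\<And>p. 0 \<le> q p" "q p0 = 0"
  proof -
    show "continuous_on K q"
      unfolding q_def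
      by (intro continuous_intros
          continuous_on_subset[OF C_infinity_continuous_on[OF C_infinity_linear[OF S(1) linear_\<tau>]] K(3)])
  qed (auto simp: q_def \<tau>_def p0)
  have v0: "v p0 = h p0"
  proof -
    have "u (\<xi> p0) = ereal (h p0)" using ux xU(1) by (simp add: p0(2) h_def F_def flip: xU(2))
    then have "ereal (v p0) = ereal (h p0)" using vu[OF K(2)] c[OF K(2)] by (simp add: max_def)
    then show ?thesis by simp
  qed
  have vlt: "v p < h p" if p: "p \<in> K" "q p = 0" "p \<noteq> p0" for p
  proof -
    have pS: "p \<in> N" "P p \<in> S1" using p(1) K(3) by (auto simp: S_def)
    have AP: "A (P p) = p" using p(2) by (simp add: q_def \<tau>_def)
    then have "P p \<noteq> P p0" using p(3) p0(3) by metis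
    moreover have "u (\<xi> p) \<le> ereal (F (P p))"
      using fF[OF in_V[OF pS(1)]] A_P_fixed[OF pS(1)] AP \<psi>_\<xi>_N[OF pS(1)] pS(2) by simp
    ultimately have "u (\<xi> p) < ereal (h p)" using hF by (meson le_less_trans less_ereal.simps(1))
    then have "ereal (v p) < ereal (h p)" using vu[OF p(1)] c[OF p(1)] by simp
    then show ?thesis by simp
  qed
  obtain y m where y: "\<And>n. y n \<in> K" "\<And>n. 0 \<le> m n" "y \<longlonglongrightarrow> p0" "(\<lambda>n. m n * q (y n)) \<longlonglongrightarrow> 0"
    "\<And>n p. p \<in> K \<Longrightarrow> v p - h p - m n * q p \<le> v (y n) - h (y n) - m n * q (y n)"
  proof (rule penalization[OF K(1,2) v[OF K(2)] hc q v0])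
    show "v p < h p" if "p \<in> K" "q p = 0" "p \<noteq> p0" for p by (rule vlt[OF that])
  qed (rule that)
  define R where "R = (\<lambda>p. \<Sum>i\<in>I. (2 * (\<tau> (w i p) \<bullet> \<tau> (w i p)) - 2 * ((\<tau> p - 0) \<bullet> \<tau> (\<Gamma>w i p))) / nw i p)"
  have step: "0 \<le> trace_hess h (y n) + m n * R (y n)" if yb: "y n \<in> ball p0 r" for n
  proof -
    \<comment> \<open>The maximal value itself: adding it makes \<open>H\<close> equal to
      \<open>v\<close> at \<open>y n\<close> and at least \<open>v\<close> on
      \<open>K\<close>.\<close>
    define k where "k = v (y n) - h (y n) - m n * q (y n)"
    define H where "H = (\<lambda>p. h p + m n * ((\<tau> p - 0) \<bullet> (\<tau> p - 0)) + k)"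
    have yS: "y n \<in> S" "y n \<in> N" using y(1) K(3) S(3) by auto
    have H: "C_infinity H S"
      unfolding H_def by (rule derivatives_add_square(3)[OF S(1) h linear_\<tau> S(2)])
    \<comment> \<open>Maximality is known on the closed ball only, whereas a test function needs an
      open neighbourhood; hence \<open>y n\<close> is required to lie in the open ball.\<close>
    define B where "B = {z \<in> V. \<psi> z \<in> ball p0 r}"
    have B: "opens X B" "B \<subseteq> V" "\<xi> (y n) \<in> B"
      unfolding B_def using open_preimage[OF open_ball] yb in_V[OF yS(2)] \<psi>_\<xi>_N[OF yS(2)] by auto
    have BS: "\<psi> ` B \<subseteq> S" using r(2) ball_subset_cball by (fastforce simp: B_def)
    define \<Phi> where "\<Phi> = (\<lambda>z. H (\<psi> z))"
    have sm: "smooth_on X B \<Phi>"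
      by (rule smooth_onI[OF B(1,2) C_infinity_subset[OF H BS]]) (simp add: \<Phi>_def)
    have vH: "v p \<le> H p" if "p \<in> K" for p
      using y(5)[OF that, of n] by (simp add: H_def k_def q_def)
    have "test_function X u (\<xi> (y n)) \<Phi>"
      unfolding test_function_def
    proof (intro conjI exI[of _ B] ballI B(1,3) sm)
      fix z assume "z \<in> B"
      then have "\<psi> z \<in> K" "\<xi> (\<psi> z) = z" by (auto simp: B_def K_def)
      then show "u z \<le> ereal (\<Phi> z)"
        using uv[of "\<psi> z"] vH[of "\<psi> z"] by (simp add: \<Phi>_def order_trans)
    next
      have vy: "H (y n) = v (y n)" by (simp add: H_def k_def q_def)
      have "0 \<le> v (y n) - h (y n) - m n * q (y n)"
        using y(5)[OF K(2), of n] v0 q(3) by simp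
      moreover have "0 \<le> m n * q (y n)" using y(2) q(2) by simp
      ultimately have "c < v (y n)" using c[OF y(1)[of n]] by linarith
      then have "ereal c \<noteq> ereal (v (y n))" by simp
      then have "u (\<xi> (y n)) = ereal (v (y n))"
        using vu[OF y(1)[of n]] unfolding max_def by (simp split: if_splits)
      then show "u (\<xi> (y n)) = ereal (\<Phi> (\<xi> (y n)))" by (simp add: \<Phi>_def \<psi>_\<xi>_N[OF yS(2)] vy)
    qed
    from test[OF yS(2) this] have "0 \<le> trace_hess (\<Phi> \<circ> \<xi>) (y n)"
      using trace_hessian_frame[OF yS(2) smooth_near_on[OF B(1,3) sm]] by simp
    also have "trace_hess (\<Phi> \<circ> \<xi>) (y n) = trace_hess H (y n)"
      by (rule trace_hess_cong[OF S(1) yS(1)]) (use S(4) in \<open>auto simp: \<Phi>_def\<close>)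
    also have "\<dots> = trace_hess h (y n) + m n * R (y n)"
      unfolding H_def R_def by (rule trace_hess_add_square[OF S(1) h linear_\<tau> yS(1)])
    finally show ?thesis .
  qed
  have "0 \<le> trace_hess h p0"
  proof (rule LIMSEQ_le_const)
    have "isCont (trace_hess h) p0"
      using C_infinity_continuous_on[OF smooth_trace_hess[OF S(1,3) h]] S(1,2)
      by (simp add: continuous_on_eq_continuous_at)
    then have 1: "(\<lambda>n. trace_hess h (y n)) \<longlonglongrightarrow> trace_hess h p0"
      using y(3) by (rule isCont_tendsto_compose)
    have xM: "\<xi> p0 \<in> pts M" using x(2) p0(2) by simp
    obtain C where C: "\<forall>\<^sub>F p in nhds p0. \<bar>R p\<bar> \<le> C * (\<tau> p \<bullet> \<tau> p)"
      using penalty_bound[OF p0(1) xM] unfolding R_def by blast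
    have "\<forall>\<^sub>F n in sequentially. \<bar>R (y n)\<bar> \<le> C * (\<tau> (y n) \<bullet> \<tau> (y n))"
      using C y(3) by (rule eventually_compose_filterlim)
    then have "\<forall>\<^sub>F n in sequentially. norm (m n * R (y n)) \<le> C * (m n * q (y n))"
    proof eventually_elim
      case (elim n)
      then have "m n * \<bar>R (y n)\<bar> \<le> m n * (C * (\<tau> (y n) \<bullet> \<tau> (y n)))"
        using y(2) by (intro mult_left_mono) auto
      then show ?case using y(2)[of n] by (simp add: abs_mult q_def mult.left_commute)
    qed
    moreover have "(\<lambda>n. C * (m n * q (y n))) \<longlonglongrightarrow> 0"
      using tendsto_mult_right_zero[OF y(4)] .
    \<comment> \<open>\<open>R\<close> is quadratic in \<open>\<tau>\<close> near \<open>p0\<close>,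
      so \<open>m n * R (y n)\<close> is at most a constant times the vanishing quantity
      \<open>m n * q (y n)\<close>.\<close>
    ultimately have 2: "(\<lambda>n. m n * R (y n)) \<longlonglongrightarrow> 0" by (rule Lim_null_comparison)
    show "(\<lambda>n. trace_hess h (y n) + m n * R (y n)) \<longlonglongrightarrow> trace_hess h p0"
      using tendsto_add[OF 1 2] by simp
    have "\<forall>\<^sub>F n in sequentially. y n \<in> ball p0 r"
      using r(1) by (intro topological_tendstoD[OF y(3)]) auto
    then show "\<exists>N. \<forall>n\<ge>N. 0 \<le> trace_hess h (y n) + m n * R (y n)"
      using step unfolding eventually_sequentially by blast
  qed
  also have "trace_hess h p0 = trace_hess (\<lambda>p. F (P p)) p0
      + \<delta> * (\<Sum>i\<in>I. (2 * (P (w i p0) \<bullet> P (w i p0)) - 2 * ((P p0 - P p0) \<bullet> P (\<Gamma>w i p0))) / nw i p0)"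
    unfolding h_def by (rule trace_hess_add_square[OF S(1) FP linear_P S(2)])
  also have "trace_hess (\<lambda>p. F (P p)) p0 = laplace_beltrami M (induced_metric X g) D\<^sub>M f x"
    using laplace_beltrami_trace_hess[OF p0(1) _ S1(1) F[unfolded F_def] S1(2)] x(2) p0(2)
      m.smooth_near_on[OF N1(1-3)] by (simp add: F_def)
  finally show ?thesis by (simp add: p0_def)
qed

text \<open>The coefficient of \<open>\<delta>\<close> in the perturbed inequality does not depend
  on \<open>\<delta>\<close>, which may therefore tend to zero.\<close>

lemma laplace_beltrami_nonneg:
  assumes "x \<in> V" "x \<in> pts M" "\<psi> x \<in> N" and "usc X u"
    and "\<And>p \<Phi>. p \<in> N \<Longrightarrow> test_function X u (\<xi> p) \<Phi> \<Longrightarrow>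
      trace_on (g (\<xi> p)) (cv (\<xi> p) ` span ((\<lambda>i. w i p) ` I)) (hessian X D \<Phi> (\<xi> p)) \<ge> 0"
    and "test_function M u x f"
  shows "0 \<le> laplace_beltrami M (induced_metric X g) D\<^sub>M f x"
proof (rule tendsto_lowerbound)
  define C where "C = (\<Sum>i\<in>I. 2 * (P (w i (\<psi> x)) \<bullet> P (w i (\<psi> x))) / nw i (\<psi> x))"
  let ?l = "laplace_beltrami M (induced_metric X g) D\<^sub>M f x"
  have "((\<lambda>\<delta>. ?l + \<delta> * C) \<longlongrightarrow> ?l + 0 * C) (at_right 0)"
    by (intro tendsto_intros)
  then show "((\<lambda>\<delta>. ?l + \<delta> * C) \<longlongrightarrow> ?l) (at_right 0)" by simp
  show "\<forall>\<^sub>F \<delta> in at_right 0. 0 \<le> ?l + \<delta> * C"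
    unfolding C_def using perturbed_inequality[OF assms]
    by (auto simp: eventually_at_right_field intro: exI[of _ 1])
qed simp

end

section \<open>Gromov manifolds\<close>

lemma vanishes_on_span:
  fixes B :: "'v::real_vector \<Rightarrow> 'v \<Rightarrow> real"
  assumes T: "subspace T" "bilinear_map_on T B" "S \<subseteq> T" and z: "\<And>u v. u \<in> S \<Longrightarrow> v \<in> S \<Longrightarrow> B u v = 0"
    and uv: "u \<in> span S" "v \<in> span S"
  shows "B u v = 0"
proof -
  have z0: "B 0 v = 0" "B v 0 = 0" if "v \<in> T" for v
  proof -
    have "B (0 *\<^sub>R v + 0 *\<^sub>R v) v = 0 *\<^sub>R B v v + 0 *\<^sub>R B v v" "B v (0 *\<^sub>R v + 0 *\<^sub>R v) = 0 *\<^sub>R B v v + 0 *\<^sub>R B v v"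
      using T(2) that unfolding bilinear_map_on_def by blast+
    then show "B 0 v = 0" "B v 0 = 0" by simp_all
  qed
  have sub: "subspace {u \<in> T. B u v = 0}" "subspace {u \<in> T. B v u = 0}" if v: "v \<in> T" for v
  proof -
    have l: "B (a *\<^sub>R x + b *\<^sub>R y) v = a *\<^sub>R B x v + b *\<^sub>R B y v"
      and r: "B v (a *\<^sub>R x + b *\<^sub>R y) = a *\<^sub>R B v x + b *\<^sub>R B v y" if "x \<in> T" "y \<in> T" for x y a b
      using T(2) v that unfolding bilinear_map_on_def by blast+
    show "subspace {u \<in> T. B u v = 0}"
      using l[of _ _ 1 1] l[of _ _ _ 0] z0(1)[OF v] T(1) by (auto simp: subspace_def)
    show "subspace {u \<in> T. B v u = 0}"
      using r[of _ _ 1 1] r[of _ _ _ 0] z0(2)[OF v] T(1) by (auto simp: subspace_def)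
  qed
  have 1: "B u s = 0" if "s \<in> S" "u \<in> span S" for u s
    using span_minimal[OF _ sub(1)[of s], of S] T(3) z that by auto
  have "u \<in> T" using span_minimal[OF T(3,1)] uv(1) by auto
  then show ?thesis
    using span_minimal[OF _ sub(2)[of u], of S] T(3) 1 uv by auto
qed

text \<open>Injectivity is recorded besides independence, because the dimension of the span is
  counted by the index set.\<close>

lemma independent_orthogonal_family:
  fixes B :: "'v::real_vector \<Rightarrow> 'v \<Rightarrow> real"
  assumes B: "\<And>v. linear (\<lambda>u. B u v)" and orth: "\<And>i j. i \<in> I \<Longrightarrow> j \<in> I \<Longrightarrow> i \<noteq> j \<Longrightarrow> B (w i) (w j) = 0"
    and pos: "\<And>i. i \<in> I \<Longrightarrow> B (w i) (w i) > 0"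
  shows "independent (w ` I)" "inj_on w I"
proof -
  show inj: "inj_on w I"
    by (rule inj_onI) (metis orth pos less_irrefl)
  show "independent (w ` I)"
    unfolding dependent_def
  proof clarify
    fix i assume i: "i \<in> I" and sp: "w i \<in> span (w ` I - {w i})"
    have sub: "subspace {u. B u (w i) = 0}"
      using linear_0[OF B] linear_add[OF B] linear_cmul[OF B] by (auto simp: subspace_def)
    have "w ` I - {w i} \<subseteq> {u. B u (w i) = 0}" using orth[OF _ i] by auto
    then have "w i \<in> {u. B u (w i) = 0}" using span_minimal[OF _ sub] sp by auto
    then show False using pos[OF i] by simp
  qed
qed

lemma gromov_metric_properties:
  assumes "gromov_manifold X \<omega> J" and x: "x \<in> pts X"
  defines "g \<equiv> gromov_metric \<omega> J"
  shows "bilinear_map_on (tangent_space X x) (\<omega> x)"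
    and "v \<in> tangent_space X x \<Longrightarrow> J x v \<in> tangent_space X x"
    and "v \<in> tangent_space X x \<Longrightarrow> J x (J x v) = - v"
    and "u \<in> tangent_space X x \<Longrightarrow> v \<in> tangent_space X x \<Longrightarrow>
      J x (a *\<^sub>R u + b *\<^sub>R v) = a *\<^sub>R J x u + b *\<^sub>R J x v"
    and "v \<in> tangent_space X x \<Longrightarrow> w \<in> tangent_space X x \<Longrightarrow> \<omega> x (J x v) (J x w) = \<omega> x v w"
    and "v \<in> tangent_space X x \<Longrightarrow> v \<noteq> 0 \<Longrightarrow> g x v v > 0"
proof -
  have G: "symplectic_form X \<omega>" "almost_complex_structure X J"
    "\<forall>x\<in>pts X. \<forall>v\<in>tangent_space X x. \<forall>w\<in>tangent_space X x. \<omega> x v w = \<omega> x (J x v) (J x w)"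
    "\<forall>x\<in>pts X. \<forall>v\<in>tangent_space X x. v \<noteq> 0 \<longrightarrow> \<omega> x (J x v) v > 0"
    using assms(1) by (simp_all add: gromov_manifold_def)
  have "\<forall>x\<in>pts X. bilinear_on (tangent_space X x) (\<omega> x)"
    using G(1) by (simp add: symplectic_form_def smooth_tensor2_def)
  then show "bilinear_map_on (tangent_space X x) (\<omega> x)" using x by (simp add: bilinear_on_iff)
  note J = G(2)[unfolded almost_complex_structure_def]
  show "v \<in> tangent_space X x \<Longrightarrow> J x v \<in> tangent_space X x"
    and "v \<in> tangent_space X x \<Longrightarrow> J x (J x v) = - v"
    using J[THEN conjunct1] x by blast+
  show "u \<in> tangent_space X x \<Longrightarrow> v \<in> tangent_space X x \<Longrightarrow>
      J x (a *\<^sub>R u + b *\<^sub>R v) = a *\<^sub>R J x u + b *\<^sub>R J x v"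
    using J[THEN conjunct2, THEN conjunct1] x by blast
  show "v \<in> tangent_space X x \<Longrightarrow> w \<in> tangent_space X x \<Longrightarrow> \<omega> x (J x v) (J x w) = \<omega> x v w"
    using G(3) x by simp
  show "v \<in> tangent_space X x \<Longrightarrow> v \<noteq> 0 \<Longrightarrow> g x v v > 0"
    using G(4) x by (simp add: g_def gromov_metric_def)
qed

lemma bilinear_gromov_metric:
  assumes X: "gromov_manifold X \<omega> J" and x: "x \<in> pts X"
  shows "bilinear_map_on (tangent_space X x) (gromov_metric \<omega> J x)"
  unfolding bilinear_map_on_def gromov_metric_def
proof (intro ballI allI)
  note p = gromov_metric_properties[OF X x]
  fix u v z a b assume uvz: "u \<in> tangent_space X x" "v \<in> tangent_space X x" "z \<in> tangent_space X x"
  show "\<omega> x (J x (a *\<^sub>R u + b *\<^sub>R v)) z = a *\<^sub>R \<omega> x (J x u) z + b *\<^sub>R \<omega> x (J x v) z \<and>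
    \<omega> x (J x z) (a *\<^sub>R u + b *\<^sub>R v) = a *\<^sub>R \<omega> x (J x z) u + b *\<^sub>R \<omega> x (J x z) v"
    unfolding p(4)[OF uvz(1,2)]
    using p(1) p(2)[OF uvz(1)] p(2)[OF uvz(2)] p(2)[OF uvz(3)] uvz
    unfolding bilinear_map_on_def by blast
qed

lemma omega_antisymmetric:
  assumes X: "gromov_manifold X \<omega> J" and x: "x \<in> pts X"
    and v: "v \<in> tangent_space X x" "w \<in> tangent_space X x" and sub: "subspace (tangent_space X x)"
  shows "\<omega> x v w = - \<omega> x w v"
proof -
  have alt: "\<forall>x\<in>pts X. \<forall>v\<in>tangent_space X x. \<omega> x v v = 0"
    using X by (simp add: gromov_manifold_def symplectic_form_def)
  have b: "\<omega> x (1 *\<^sub>R v + 1 *\<^sub>R w) z = 1 *\<^sub>R \<omega> x v z + 1 *\<^sub>R \<omega> x w z"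
    "\<omega> x z (1 *\<^sub>R v + 1 *\<^sub>R w) = 1 *\<^sub>R \<omega> x z v + 1 *\<^sub>R \<omega> x z w" if "z \<in> tangent_space X x" for z
    using gromov_metric_properties(1)[OF X x] v that unfolding bilinear_map_on_def by blast+
  have vw: "v + w \<in> tangent_space X x" by (rule subspace_add[OF sub v])
  have "\<omega> x (v + w) (v + w) = \<omega> x v v + \<omega> x v w + (\<omega> x w v + \<omega> x w w)"
    using b(1)[OF vw] b(2)[OF v(1)] b(2)[OF v(2)] by simp
  then show ?thesis using alt x v vw by simp
qed

text \<open>Inserting \<open>J\<close> in both arguments turns \<open>\<omega> (J v) w\<close> into
  \<open>- \<omega> v (J w)\<close>, and antisymmetry finishes.\<close>

lemma gromov_metric_sym:
  assumes X: "gromov_manifold X \<omega> J" and x: "x \<in> pts X"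
    and v: "v \<in> tangent_space X x" "w \<in> tangent_space X x" and sub: "subspace (tangent_space X x)"
  shows "gromov_metric \<omega> J x v w = gromov_metric \<omega> J x w v"
proof -
  note p = gromov_metric_properties[OF X x]
  have m: "- v = (-1) *\<^sub>R v + 0 *\<^sub>R v" by simp
  have "\<omega> x (J x v) w = \<omega> x (J x (J x v)) (J x w)" by (rule p(5)[OF p(2)[OF v(1)] v(2), symmetric])
  also have "\<dots> = \<omega> x ((-1) *\<^sub>R v + 0 *\<^sub>R v) (J x w)" by (simp only: p(3)[OF v(1)] m[symmetric])
  also have "\<dots> = (-1) *\<^sub>R \<omega> x v (J x w) + 0 *\<^sub>R \<omega> x v (J x w)"
    using p(1) v p(2)[OF v(2)] unfolding bilinear_map_on_def by blast
  also have "\<dots> = \<omega> x (J x w) v"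
    using omega_antisymmetric[OF X x v(1) p(2)[OF v(2)] sub] by simp
  finally show ?thesis by (simp add: gromov_metric_def)
qed

lemma minimal_lagrangian_laplace_nonneg:
  fixes X :: "('a, 'e::euclidean_space) mfd" and M :: "('a, 'f::euclidean_space) mfd"
  assumes gm: "gromov_manifold X \<omega> J" and lc: "levi_civita X (gromov_metric \<omega> J) D"
    and lag: "lagrangian_submanifold X \<omega> M" and min: "minimal_submanifold X (gromov_metric \<omega> J) D M"
    and lcM: "levi_civita M (induced_metric X (gromov_metric \<omega> J)) D\<^sub>M"
    and psh: "lagrangian_psh X \<omega> J D u" and x: "x \<in> pts M" and f: "test_function M u x f"
  shows "0 \<le> laplace_beltrami M (induced_metric X (gromov_metric \<omega> J)) D\<^sub>M f x"
proof -
  let ?g = "gromov_metric \<omega> J"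
  have X: "smooth_manifold X" using gm by (simp add: gromov_manifold_def)
  have sM: "submanifold X M" and dim: "2 * DIM('f) = DIM('e)"
    and lagM: "\<And>x v w. x \<in> pts M \<Longrightarrow> v \<in> tangent_in X M x \<Longrightarrow> w \<in> tangent_in X M x \<Longrightarrow> \<omega> x v w = 0"
    using lag by (auto simp: lagrangian_submanifold_def)
  have mM: "smooth_manifold M" using sM by (simp add: submanifold_def)
  obtain V \<psi> U \<phi> A P where ch: "(U, \<phi>) \<in> atlas M" "x \<in> U" "compatible_chart X V \<psi>" "x \<in> V" "linear A" "linear P"
    "\<And>s. P (A s) = s" "\<And>y. y \<in> V \<Longrightarrow> y \<in> pts M \<longleftrightarrow> \<psi> y = A (P (\<psi> y))"
    "\<And>y. y \<in> V \<Longrightarrow> y \<in> pts M \<Longrightarrow> y \<in> U \<and> \<phi> y = P (\<psi> y)"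
    by (rule adapted_chart_exists[OF X sM x]) (rule that)
  interpret c: chart X V \<psi> by unfold_locales (rule X, rule ch(3))
  interpret m: chart M U \<phi> by unfold_locales (rule mM, rule atlas_compatible_chart[OF mM ch(1)])
  note VX = subsetD[OF c.U_subset]
  note gp = gromov_metric_properties[OF gm VX]
  have Jsm: "\<forall>N V. opens X N \<and> smooth_vf X N V \<longrightarrow> smooth_vf X N (\<lambda>y. J y (V y))"
    using gm by (simp add: gromov_manifold_def almost_complex_structure_def)
  have \<omega>sm: "\<forall>N V W. opens X N \<and> smooth_vf X N V \<and> smooth_vf X N W \<longrightarrow> smooth_on X N (\<lambda>y. \<omega> y (V y) (W y))"
    using gm by (simp add: gromov_manifold_def symplectic_form_def smooth_tensor2_def)
  have Jvf: "smooth_vf X V (\<lambda>y. J y (c.cv y a))" for a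
    using Jsm c.opens_U c.smooth_vf_const by blast
  have gsm: "smooth_on X V (\<lambda>z. ?g z (c.cv z a) (c.cv z b))" for a b
    using \<omega>sm c.opens_U c.smooth_vf_const Jvf unfolding gromov_metric_def by blast
  interpret adapted_riemannian_chart X V \<psi> M U \<phi> A P ?g D D\<^sub>M
  proof unfold_locales
    show "submanifold X M" "levi_civita X ?g D" "levi_civita M (induced_metric X ?g) D\<^sub>M"
      by fact+
    show "A (a + b) = A a + A b" "A (r *\<^sub>R a) = r *\<^sub>R A a" for a b r
      by (rule linear_add[OF ch(5)], rule linear_cmul[OF ch(5)])
    show "P (a + b) = P a + P b" "P (r *\<^sub>R a) = r *\<^sub>R P a" for a b r
      by (rule linear_add[OF ch(6)], rule linear_cmul[OF ch(6)])
    show "P (A s) = s" for s by (rule ch(7))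
    show "y \<in> pts M \<longleftrightarrow> \<psi> y = A (P (\<psi> y))" if "y \<in> V" for y by (rule ch(8)[OF that])
    show "y \<in> U \<and> \<phi> y = P (\<psi> y)" if "y \<in> V" "y \<in> pts M" for y by (rule ch(9)[OF that])
    show "bilinear_map_on (tangent_space X y) (?g y)" if "y \<in> V" for y
      by (rule bilinear_gromov_metric[OF gm VX[OF that]])
    show "?g y v w = ?g y w v" if "y \<in> V" "v \<in> tangent_space X y" "w \<in> tangent_space X y" for y v w
      by (rule gromov_metric_sym[OF gm VX[OF that(1)] that(2,3) c.subspace_tangent_space[OF that(1)]])
    show "?g y v v > 0" if "y \<in> V" "v \<in> tangent_space X y" "v \<noteq> 0" for y v
      by (rule gp(6)[OF that])
    show "smooth_near X y (\<lambda>z. ?g z (c.cv z a) (c.cv z b))" if "y \<in> V" for y a b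
      by (rule c.smooth_near_on[OF c.opens_U that gsm])
  qed
  have g_eq: "?g y v z = \<omega> y (J y v) z" for y v z by (simp add: gromov_metric_def)
  \<comment> \<open>The almost complex structure in coordinates. Its compatibility with
    \<open>\<omega>\<close> gives \<open>G a (K b) = \<omega> a b\<close>, so the third relation of
    the frame says that the planes are Lagrangian.\<close>
  define K where "K = (\<lambda>p a. c.coord (J (c.\<xi> p) (c.cv (c.\<xi> p) a)))"
  have cvK: "c.cv (c.\<xi> p) (K p a) = J (c.\<xi> p) (c.cv (c.\<xi> p) a)" if "p \<in> \<psi> ` V" for p a
    unfolding K_def using that by (intro c.cv_coord gp(2)) auto
  have GK: "G (c.\<xi> p) (K p a) (K p b) = G (c.\<xi> p) a b"
    and KK: "K p (K p a) = - a" and \<omega>K: "G (c.\<xi> p) a (K p b) = \<omega> (c.\<xi> p) (c.cv (c.\<xi> p) a) (c.cv (c.\<xi> p) b)"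
    if p: "p \<in> \<psi> ` V" for p a b
  proof -
    have y: "c.\<xi> p \<in> V" using p by simp
    show "G (c.\<xi> p) a (K p b) = \<omega> (c.\<xi> p) (c.cv (c.\<xi> p) a) (c.cv (c.\<xi> p) b)"
      unfolding G_def g_eq cvK[OF p] using y by (intro gp(5)) auto
    show "G (c.\<xi> p) (K p a) (K p b) = G (c.\<xi> p) a b"
      unfolding G_def g_eq cvK[OF p] using y by (intro gp(5) gp(2)) auto
    have "c.cv (c.\<xi> p) (K p (K p a)) = - c.cv (c.\<xi> p) a"
      unfolding cvK[OF p] using y by (intro gp(3)) auto
    also have "\<dots> = c.cv (c.\<xi> p) (- a)" by (simp add: linear_neg[OF c.linear_cv[OF y]])
    finally show "K p (K p a) = - a" by (rule c.cv_inj[OF y])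
  qed
  have "\<exists>N w. open N \<and> \<psi> x \<in> N \<and> N \<subseteq> \<psi> ` V \<and> (\<forall>b\<in>Basis::'f set. C_infinity (w b) N) \<and>
    (\<forall>p\<in>N. (\<forall>b\<in>Basis. w b p \<noteq> 0) \<and>
      (\<forall>b\<in>Basis. \<forall>b'\<in>Basis. b \<noteq> b' \<longrightarrow> G (c.\<xi> p) (w b p) (w b' p) = 0) \<and>
      (\<forall>b\<in>Basis. \<forall>b'\<in>Basis. G (c.\<xi> p) (w b p) (K p (w b' p)) = 0) \<and>
      (p \<in> {p. c.\<xi> p \<in> pts M} \<longrightarrow> span ((\<lambda>b. w b p) ` Basis) = span (A ` Basis)))"
  proof (rule unitary_frame[where G = "\<lambda>p. G (c.\<xi> p)" and K = K and A = A])
    show "inj A" by (metis injI ch(7))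
    show "bilinear (G (c.\<xi> p))" if "p \<in> \<psi> ` V" for p
      using that linear_G_left linear_G_right by (simp add: bilinear_def)
    show "linear (K p)" if p: "p \<in> \<psi> ` V" for p
    proof (rule linearI)
      have y: "c.\<xi> p \<in> V" using p by simp
      have *: "K p (r *\<^sub>R a + s *\<^sub>R b) = r *\<^sub>R K p a + s *\<^sub>R K p b" for r s a b
      proof (rule c.cv_inj[OF y])
        show "c.cv (c.\<xi> p) (K p (r *\<^sub>R a + s *\<^sub>R b)) = c.cv (c.\<xi> p) (r *\<^sub>R K p a + s *\<^sub>R K p b)"
          using gp(4)[OF y c.cv_tangent[OF y] c.cv_tangent[OF y]]
          by (simp add: cvK[OF p] linear_add[OF c.linear_cv[OF y]] linear_cmul[OF c.linear_cv[OF y]])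
      qed
      show "K p (a + b) = K p a + K p b" for a b using *[of 1 a 1 b] by simp
      show "K p (r *\<^sub>R a) = r *\<^sub>R K p a" for r a using *[of r a 0 a] by simp
    qed
    show "C_infinity (\<lambda>p. G (c.\<xi> p) a b) (\<psi> ` V)" for a b
      using gsm[of a b] c.smooth_on_iff[OF c.opens_U order_refl] by (simp add: G_def o_def)
    show "C_infinity (\<lambda>p. K p a) (\<psi> ` V)" for a
      unfolding K_def by (rule c.smooth_vf_coord(1)[OF c.opens_U order_refl Jvf])
    show "G (c.\<xi> p) (A a) (K p (A b)) = 0" if p: "p \<in> \<psi> ` V" "p \<in> {p. c.\<xi> p \<in> pts M}" for p a b
    proof -
      have y: "c.\<xi> p \<in> V" "c.\<xi> p \<in> pts M" using p by auto
      then show ?thesis unfolding \<omega>K[OF p(1)] by (intro lagM) (auto simp: tangent_in_eq)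
    qed
    show "independent (Basis :: 'f set)" by (rule independent_Basis)
  qed (use ch(4,5) x c.open_range GK KK G_sym G_pos in auto)
  then obtain N w where N: "open N" "\<psi> x \<in> N" "N \<subseteq> \<psi> ` V" and w: "\<forall>b\<in>Basis::'f set. C_infinity (w b) N"
    and H: "\<forall>p\<in>N. (\<forall>b\<in>Basis. w b p \<noteq> 0) \<and>
      (\<forall>b\<in>Basis. \<forall>b'\<in>Basis. b \<noteq> b' \<longrightarrow> G (c.\<xi> p) (w b p) (w b' p) = 0) \<and>
      (\<forall>b\<in>Basis. \<forall>b'\<in>Basis. G (c.\<xi> p) (w b p) (K p (w b' p)) = 0) \<and>
      (p \<in> {p. c.\<xi> p \<in> pts M} \<longrightarrow> span ((\<lambda>b. w b p) ` Basis) = span (A ` Basis))"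
    by (elim exE conjE) (rule that)
  have spA: "span (A ` Basis) = range A"
    using linear_span_image[OF ch(5), of Basis] by simp
  interpret framed_chart X V \<psi> M U \<phi> A P ?g D D\<^sub>M N "Basis :: 'f set" w
  proof unfold_locales
    show "mean_curvature X ?g D M y = 0" if "y \<in> pts M" for y
      using min that by (simp add: minimal_submanifold_def)
    show "span ((\<lambda>i. w i p) ` Basis) = range A" if "p \<in> N" "c.\<xi> p \<in> pts M" for p
      using H that unfolding spA by blast
    show "w i p \<noteq> 0" if "p \<in> N" "i \<in> Basis" for p i using H that by blast
    show "G (c.\<xi> p) (w i p) (w j p) = 0" if "p \<in> N" "i \<in> Basis" "j \<in> Basis" "i \<noteq> j" for p i j
      using H that by blast
  qed (use N w in auto)
  show ?thesis
  proof (rule laplace_beltrami_nonneg[OF ch(4) x N(2) _ _ f])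
    show "usc X u" using psh by (simp add: lagrangian_psh_def)
    fix p \<Phi> assume p: "p \<in> N" and t: "test_function X u (c.\<xi> p) \<Phi>"
    let ?y = "c.\<xi> p" and ?W = "c.cv (c.\<xi> p) ` span ((\<lambda>i. w i p) ` Basis)"
    have y: "?y \<in> V" and pV: "p \<in> \<psi> ` V" using p N(3) by auto
    have W: "?W = span ((\<lambda>i. c.cv ?y (w i p)) ` Basis)" by (simp add: c.span_cv[OF y])
    \<comment> \<open>The frame stays independent off \<open>M\<close> because it is orthogonal with
      positive lengths; this gives the planes the dimension \<open>DIM('f)\<close>, half of that of
      \<open>X\<close>.\<close>
    have fam: "independent ((\<lambda>i. w i p) ` Basis)" "inj_on (\<lambda>i. w i p) Basis"
      using independent_orthogonal_family[of "G ?y" "Basis :: 'f set" "\<lambda>i. w i p"] linear_G_left[OF y]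
        orth_w[OF p] nw_pos[OF p] by (auto simp: nw_def)
    have cvi: "inj (c.cv ?y)" by (rule injI) (rule c.cv_inj[OF y])
    have "independent (c.cv ?y ` (\<lambda>i. w i p) ` Basis)"
      by (rule linear_independent_injective_image[OF c.linear_cv[OF y] fam(1)])
        (use cvi in \<open>auto intro: inj_on_subset\<close>)
    then have "dim ?W = card (c.cv ?y ` (\<lambda>i. w i p) ` (Basis :: 'f set))"
      using dim_span_eq_card_independent linear_span_image[OF c.linear_cv[OF y], of "(\<lambda>i. w i p) ` Basis"] by metis
    also have "\<dots> = DIM('f)"
      using fam(2) cvi by (simp add: card_image inj_on_subset)
    finally have dW: "2 * dim ?W = DIM('e)" using dim by simp
    have "\<omega> ?y u v = 0" if "u \<in> ?W" "v \<in> ?W" for u v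
    proof (rule vanishes_on_span[OF c.subspace_tangent_space[OF y] gp(1)[OF y]])
      show "u \<in> span ((\<lambda>i. c.cv ?y (w i p)) ` Basis)" "v \<in> span ((\<lambda>i. c.cv ?y (w i p)) ` Basis)"
        using that unfolding W by auto
      show "\<omega> ?y u v = 0" if "u \<in> (\<lambda>i. c.cv ?y (w i p)) ` Basis" "v \<in> (\<lambda>i. c.cv ?y (w i p)) ` Basis" for u v
        using that H p \<omega>K[OF pV] by auto
    qed (use y in auto)
    moreover have "subspace ?W" unfolding W by (rule subspace_span)
    moreover have "?W \<subseteq> tangent_space X ?y" using y by auto
    ultimately have "lagrangian_plane X \<omega> ?y ?W" using dW by (simp add: lagrangian_plane_def)
    then show "0 \<le> trace_on (?g ?y) ?W (hessian X D \<Phi> ?y)"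
      using psh t VX[OF y] unfolding lagrangian_psh_def by blast
  qed
qed

theorem theorem7p7:
  fixes X :: "('a, 'e::euclidean_space) mfd"
    and M :: "('a, 'f::euclidean_space) mfd"
    and \<omega> :: "'a form2"
    and J :: "'a \<Rightarrow> 'a tvec \<Rightarrow> 'a tvec"
    and D D\<^sub>M :: "'a conn"
    and u :: "'a \<Rightarrow> ereal"
  assumes "gromov_manifold X \<omega> J"
    and "levi_civita X (gromov_metric \<omega> J) D"
    and "lagrangian_submanifold X \<omega> M"
    and "minimal_submanifold X (gromov_metric \<omega> J) D M"
    and "levi_civita M (induced_metric X (gromov_metric \<omega> J)) D\<^sub>M"
    and "lagrangian_psh X \<omega> J D u"
  shows "subharmonic M (induced_metric X (gromov_metric \<omega> J)) D\<^sub>M u"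
proof -
  have sM: "submanifold X M" using assms(3) by (simp add: lagrangian_submanifold_def)
  then have sub: "pts M \<subseteq> pts X" by (simp add: submanifold_def)
  have u: "usc X u" using assms(6) by (simp add: lagrangian_psh_def)
  have "opens M {x \<in> pts M. u x < a}" for a
  proof -
    have "opens M ({x \<in> pts X. u x < a} \<inter> pts M)"
      using u by (intro opens_submanifold[OF sM]) (simp add: usc_def)
    moreover have "{x \<in> pts X. u x < a} \<inter> pts M = {x \<in> pts M. u x < a}" using sub by auto
    ultimately show ?thesis by simp
  qed
  then have "usc M u" using u sub by (auto simp: usc_def)
  then show ?thesis
    unfolding subharmonic_def using minimal_lagrangian_laplace_nonneg[OF assms] by blast
qed

end
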